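(* Let $k\ge0$ be an integer, regard $n$ as an indeterminate (with a formal square root $\sqrt n$), and let $G_{kn}$ be the Gram matrix associated to $S_n^+$. Then, as an identity of rational functions in $\sqrt n$, $$\det(G_{kn})=(\sqrt n)^{a_k}\prod_{r=1}^{k}P_r(\sqrt n)^{d_{kr}}.$$
   Context: Let $\mathcal P_s^+(k)$ be the set of all noncrossing set partitions of $\{1,\dots,k\}$. The Gram matrix associated to $S_n^+$ is $G_{kn}=(n^{|\pi\vee\sigma|})_{\pi,\sigma\in\mathcal P_s^+(k)}$, where $\pi\vee\sigma$ is the join in the lattice of all set partitions of $\{1,\dots,k\}$ and $|\cdot|$ is the number of blocks. Put $a_k=\sum_{\pi\in\mathcal P_s^+(k)}(2|\pi|-k)$. The Chebyshev polynomials $P_r$ are given by $P_0=1$, $P_1=n$, $P_{r+1}=nP_r-P_{r-1}$ (and $P_r(\sqrt n)$ is $P_r$ evaluated at $\sqrt n$). For integers $k,r$, $f_{kr}=\binom{2k}{k-r}-\binom{2k}{k-r-1}$ and $d_{kr}=f_{kr}-f_{k,r+1}$; binomial coefficients with negative lower index are $0$. *)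

theory Defs
  imports
    "HOL-Library.Disjoint_Sets"
    "HOL-Algebra.Lattice"
    "HOL-Computational_Algebra.Polynomial_Factorial"
    "Jordan_Normal_Form.Determinant"
begin

definition partition_lattice :: "'a set \<Rightarrow> 'a set set gorder"
  where "partition_lattice A =
    \<lparr>carrier = {P. partition_on A P}, eq = (=), le = refines A\<rparr>"

lemma lattice_partition_lattice: "Lattice.lattice (partition_lattice A)"
proof -
  interpret partial_order "partition_lattice A"
    by unfold_locales
      (auto simp: partition_lattice_def intro: refines_refl refines_trans dest: refines_asym)
  show ?thesis
  proof unfold_locales
    fix x y assume "x \<in> carrier (partition_lattice A)" "y \<in> carrier (partition_lattice A)"
    then have x: "partition_on A x" and y: "partition_on A y"
      by (auto simp: partition_lattice_def)
    define U where "U = {u. refines A x u \<and> refines A y u}"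
    have U: "partition_on A u" if "u \<in> U" for u
      using that by (auto simp: U_def refines_def)
    have "partition_on A ({A} - {{}})"
      by (auto simp: partition_on_def disjoint_def)
    moreover have "\<exists>Y\<in>{A} - {{}}. X \<subseteq> Y" if "partition_on A P" "X \<in> P" for P X
      using that by (auto simp: partition_on_def)
    ultimately have "{A} - {{}} \<in> U"
      using x y by (auto simp: U_def refines_def)
    then have ne: "U \<noteq> {}" by blast
    define s where "s = common_refinement U"
    have s: "partition_on A s"
      unfolding s_def using U ne by (intro partition_on_common_refinement) auto
    have "refines A x s" "refines A y s"
      unfolding s_def using x y U ne
      by (auto intro!: common_refinement_coarsest simp: U_def)
    moreover have "refines A s u" if "u \<in> U" for u
      unfolding s_def using U that by (intro refines_common_refinement)
    ultimately have "least (partition_lattice A) s (Upper (partition_lattice A) {x, y})"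
      using x y s unfolding least_def Upper_def by (auto simp: partition_lattice_def U_def)
    then show "\<exists>s. least (partition_lattice A) s (Upper (partition_lattice A) {x, y})" ..
    define m where "m = common_refinement {x, y}"
    have m: "partition_on A m"
      unfolding m_def using x y by (intro partition_on_common_refinement) auto
    have "refines A m x" "refines A m y"
      unfolding m_def using x y by (auto intro!: refines_common_refinement)
    moreover have "refines A l m" if "refines A l x" "refines A l y" for l
      unfolding m_def using x y that
      by (intro common_refinement_coarsest) (auto simp: refines_def)
    ultimately have "greatest (partition_lattice A) m (Lower (partition_lattice A) {x, y})"
      using x y m unfolding greatest_def Lower_def by (auto simp: partition_lattice_def)
    then show "\<exists>s. greatest (partition_lattice A) s (Lower (partition_lattice A) {x, y})" ..
  qed
qed

definition noncrossing :: "nat set set \<Rightarrow> bool"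
  where "noncrossing P \<longleftrightarrow>
    (\<forall>B\<in>P. \<forall>C\<in>P. B \<noteq> C \<longrightarrow>
      \<not> (\<exists>a b c d. a < b \<and> b < c \<and> c < d \<and> a \<in> B \<and> c \<in> B \<and> b \<in> C \<and> d \<in> C))"

definition noncrossing_partitions :: "nat \<Rightarrow> nat set set set"
  where "noncrossing_partitions k = {P. partition_on {1..k} P \<and> noncrossing P}"

lemma finite_noncrossing_partitions: "finite (noncrossing_partitions k)"
  by (rule finite_subset[of _ "{P. partition_on {1..k} P}"])
     (auto simp: noncrossing_partitions_def intro: finitely_many_partition_on)

text \<open>The rows and columns of the Gram matrix are indexed by the set partitions in the list
  \<open>ps\<close>, which is meant to enumerate \<^term>\<open>noncrossing_partitions k\<close> without repetition; the
  determinant does not depend on the enumeration. The join is taken in the lattice of all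
  set partitions, so it may be a crossing partition.\<close>

definition gram_matrix :: "nat \<Rightarrow> nat set set list \<Rightarrow> 'a::comm_ring_1 \<Rightarrow> 'a mat"
  where "gram_matrix k ps n =
    mat (length ps) (length ps)
      (\<lambda>(i, j). n ^ card (ps ! i \<squnion>\<^bsub>partition_lattice {1..k}\<^esub> ps ! j))"

definition a_exp :: "nat \<Rightarrow> int"
  where "a_exp k = (\<Sum>P\<in>noncrossing_partitions k. 2 * int (card P) - int k)"

fun cheb :: "nat \<Rightarrow> 'a::comm_ring_1 poly"
  where
    "cheb 0 = 1"
  | "cheb (Suc 0) = [:0, 1:]"
  | "cheb (Suc (Suc r)) = [:0, 1:] * cheb (Suc r) - cheb r"

definition ibinom :: "nat \<Rightarrow> int \<Rightarrow> int"
  where "ibinom m j = (if j < 0 then 0 else int (m choose nat j))"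

definition f_coef :: "nat \<Rightarrow> int \<Rightarrow> int"
  where "f_coef k r = ibinom (2 * k) (int k - r) - ibinom (2 * k) (int k - r - 1)"

definition d_coef :: "nat \<Rightarrow> int \<Rightarrow> int"
  where "d_coef k r = f_coef k r - f_coef k (r + 1)"

text \<open>The field of rational functions in \<open>\<surd>n\<close> is the fraction field of the polynomial ring
  whose variable is \<open>\<surd>n\<close>; the indeterminate \<open>n\<close> is the square of that variable.\<close>

definition sqrt_n :: "'a::field poly fract"
  where "sqrt_n = to_fract [:0, 1:]"

end

theory Submission
  imports Defs
begin

text \<open>Up to powers of \<open>\<surd>n\<close> in rows and columns, the Gram matrix is a product of a triangular matrix, a
diagonal matrix and the transpose of the triangular matrix, all indexed by noncrossing partitions.

Write \<open>x = \<surd>n\<close> and \<open>P r\<close> for the Chebyshev values at \<open>x\<close>. Doubling every point turns a noncrossing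
partition of \<open>{1..k}\<close> into a noncrossing system of arcs over \<open>2 k\<close> points of a line. The arcs cut the
half plane into regions, and the points cut the line into the positions \<open>0, \<dots>, 2 k\<close>: position
\<open>2 i - 1\<close> sees the region of the block of \<open>i\<close>, and the even positions see the regions between the
blocks, which form the Kreweras complement. A Dyck path \<open>h\<close> of length \<open>2 k\<close> assigns a height to every
position. For a partition \<open>r\<close> let \<open>A r h\<close> be the product of \<open>P (height)\<close> over the regions of \<open>r\<close> if \<open>h\<close>
is constant on each region, and \<open>0\<close> otherwise; let \<open>W h\<close> be the product of \<open>1 / P (h j)\<close> over all
positions \<open>j\<close>. The key identity (\<open>loop_form_eq_path_form\<close>) is

\<open>x ^ (2 \<bar>r \<squnion> s\<bar> - \<bar>r\<bar> - \<bar>s\<bar> + k) = (\<Sum>h. W h * A r h * A s h)\<close>.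

It holds because the generators \<open>e 1, \<dots>, e (2 k - 1)\<close> of the Temperley-Lieb algebra are self-adjoint
for both sides. On partitions \<open>e (2 i)\<close> glues the blocks of \<open>i\<close> and \<open>i + 1\<close>, and \<open>e (2 i - 1)\<close> splits
\<open>i\<close> off its block; on regions both cases read alike: position \<open>j\<close> is split off and the regions of
\<open>j - 1\<close> and \<open>j + 1\<close> are glued (\<open>region_glue\<close>, \<open>region_isolate\<close>). On amplitudes, \<open>e j\<close> is a sum over the
height at \<open>j\<close> (\<open>arc_op_amp\<close>), and the recursion \<open>P (a + 1) + P (a - 1) = x * P a\<close> gives a closed loop
its value \<open>x\<close>. As the generators lead from the partition into singletons to all noncrossing
partitions (\<open>nc_rels_induct\<close>), a form with this symmetry is determined by a single value
(\<open>arc_invariant_unique\<close>).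

Among the paths with \<open>A r h \<noteq> 0\<close> there is a highest one, the profile of \<open>r\<close>
(\<open>walk_le_profile\<close>), and \<open>r \<mapsto> profile r\<close> is a bijection onto the Dyck paths (\<open>bij_profile\<close>).
Hence the matrix of amplitudes is triangular, and the Gram determinant is the product over \<open>r\<close> of
\<open>x ^ (2 \<bar>r\<bar> - k) * W p * (A r p)\<^sup>2\<close> with \<open>p = profile r\<close>. The first factors multiply to the
power \<open>a_exp\<close> of \<open>x\<close>. Each region but the outer one, whose height
is \<open>0\<close>, is met for the first time after a rising step of the profile, and every rising step meets a new
region. Thus \<open>W p * (A r p)\<^sup>2\<close> is the product of \<open>P a\<close> over the steps of
\<open>p\<close> rising to height \<open>a\<close>, divided by the product of \<open>P a\<close> over the steps falling to height \<open>a\<close>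
(\<open>norm_profile\<close>). It remains to count, over all Dyck paths, the steps rising to \<open>a\<close> minus those falling
to \<open>a\<close>; a recursion in the length of the path shows that this is a difference of two ballot numbers
(\<open>total_rises_eq\<close>), namely \<open>d_coef k a\<close>.\<close>

section \<open>Splitting off and gluing classes of an equivalence relation\<close>

definition isolate :: "'b \<Rightarrow> 'b rel \<Rightarrow> 'b rel"
  where "isolate i r = {(u, v) \<in> r. u \<noteq> i \<and> v \<noteq> i} \<union> {(i, i)}"

text \<open>Meant for an equivalence relation: the two products of classes are then all that is missing to
join the classes of \<open>i\<close> and \<open>j\<close>, and no transitive closure has to be taken.\<close>
definition glue :: "'b \<Rightarrow> 'b \<Rightarrow> 'b rel \<Rightarrow> 'b rel"
  where "glue i j r = r \<union> r `` {i} \<times> r `` {j} \<union> r `` {j} \<times> r `` {i}"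

lemma equiv_reflD: "equiv A r \<Longrightarrow> u \<in> A \<Longrightarrow> (u, u) \<in> r"
  by (auto simp: equiv_def refl_on_def)

lemma equiv_symD: "equiv A r \<Longrightarrow> (u, v) \<in> r \<Longrightarrow> (v, u) \<in> r"
  by (meson equivE symD)

lemma equiv_transD: "equiv A r \<Longrightarrow> (u, v) \<in> r \<Longrightarrow> (v, w) \<in> r \<Longrightarrow> (u, w) \<in> r"
  by (meson equivE transD)

lemma equiv_fieldD: "equiv A r \<Longrightarrow> (u, v) \<in> r \<Longrightarrow> u \<in> A \<and> v \<in> A"
  using equiv_type by blast

lemma isolate_iff: "(u, v) \<in> isolate i r \<longleftrightarrow> (u = i \<and> v = i) \<or> (u \<noteq> i \<and> v \<noteq> i \<and> (u, v) \<in> r)"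
  by (auto simp: isolate_def)

lemma isolate_class: "isolate i r `` {u} = (if u = i then {i} else r `` {u} - {i})"
  by (auto simp: isolate_iff)

lemma glue_iff: "(u, v) \<in> glue i j r \<longleftrightarrow>
    (u, v) \<in> r \<or> (i, u) \<in> r \<and> (j, v) \<in> r \<or> (j, u) \<in> r \<and> (i, v) \<in> r"
  by (auto simp: glue_def)

lemma equiv_isolate:
  assumes r: "equiv A r" and "i \<in> A"
  shows "equiv A (isolate i r)"
proof (rule equivI)
  show "isolate i r \<subseteq> A \<times> A" using equiv_type[OF r] assms(2) by (auto simp: isolate_def)
  show "refl_on A (isolate i r)" using equiv_reflD[OF r] by (auto simp: refl_on_def isolate_iff)
  show "sym (isolate i r)" using equiv_symD[OF r] by (auto simp: sym_def isolate_iff)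
  show "trans (isolate i r)" using equiv_transD[OF r] unfolding trans_def isolate_iff by blast
qed

lemma equiv_glue:
  assumes r: "equiv A r" and "i \<in> A" "j \<in> A"
  shows "equiv A (glue i j r)"
proof (rule equivI)
  note S = equiv_symD[OF r] and T = equiv_transD[OF r]
  show "glue i j r \<subseteq> A \<times> A" using equiv_type[OF r] by (auto simp: glue_def)
  show "refl_on A (glue i j r)" using equiv_reflD[OF r] by (auto simp: refl_on_def glue_iff)
  show "sym (glue i j r)" using S by (auto simp: sym_def glue_iff)
  show "trans (glue i j r)"
  proof (rule transI)
    fix u v w assume "(u, v) \<in> glue i j r" "(v, w) \<in> glue i j r"
    then show "(u, w) \<in> glue i j r" unfolding glue_iff by (blast intro: S T)
  qed
qed

lemma isolate_idem:
  assumes r: "equiv A r" and "r `` {i} = {i}"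
  shows "isolate i r = r"
proof -
  have "u = i \<and> v = i" if "(u, v) \<in> r" "u = i \<or> v = i" for u v
    using that assms(2) equiv_symD[OF r that(1)] by blast
  moreover have "(i, i) \<in> r" using assms(2) by blast
  ultimately show ?thesis by (auto simp: isolate_def)
qed

lemma glue_idem:
  assumes r: "equiv A r" and "(i, j) \<in> r"
  shows "glue i j r = r"
  using assms(2) equiv_symD[OF r] equiv_transD[OF r] unfolding glue_def by blast

lemma glue_class:
  assumes r: "equiv A r" and u: "(i, u) \<in> r \<or> (j, u) \<in> r"
  shows "glue i j r `` {u} = r `` {i} \<union> r `` {j}"
proof -
  have "glue i j r `` {u} = r `` {u} \<union> (if (i, u) \<in> r then r `` {j} else {})
      \<union> (if (j, u) \<in> r then r `` {i} else {})"
    by (auto simp: glue_iff)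
  then show ?thesis
    using u equiv_class_eq[OF r, of i u] equiv_class_eq[OF r, of j u] by auto
qed

lemma quotient_glue:
  assumes r: "equiv A r" and "i \<in> A" "j \<in> A"
  shows "A // glue i j r = insert (r `` {i} \<union> r `` {j}) (A // r - {r `` {i}, r `` {j}})"
proof -
  note 1 = glue_class[OF r]
  have 2: "glue i j r `` {u} = r `` {u}" if "(i, u) \<notin> r" "(j, u) \<notin> r" for u
    using that by (auto simp: glue_iff)
  have 3: "r `` {u} = r `` {v} \<longleftrightarrow> (v, u) \<in> r" if "u \<in> A" "v \<in> A" for u v
    using that r by (metis eq_equiv_class_iff)
  show ?thesis
  proof (intro equalityI subsetI)
    fix X assume "X \<in> A // glue i j r"
    then obtain u where u: "u \<in> A" "X = glue i j r `` {u}" by (blast elim: quotientE)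
    show "X \<in> insert (r `` {i} \<union> r `` {j}) (A // r - {r `` {i}, r `` {j}})"
    proof (cases "(i, u) \<in> r \<or> (j, u) \<in> r")
      case True
      then show ?thesis using 1[OF True] u(2) by simp
    next
      case False
      then have "X = r `` {u}" "X \<noteq> r `` {i}" "X \<noteq> r `` {j}"
        using 2[of u] 3[OF u(1) assms(2)] 3[OF u(1) assms(3)] u(2) by simp_all
      then show ?thesis using quotientI[OF u(1), of r] by simp
    qed
  next
    fix X assume X: "X \<in> insert (r `` {i} \<union> r `` {j}) (A // r - {r `` {i}, r `` {j}})"
    show "X \<in> A // glue i j r"
    proof (cases "X = r `` {i} \<union> r `` {j}")
      case True
      then have "X = glue i j r `` {i}" using 1[of i i j] equiv_reflD[OF r assms(2)] by simp
      then show ?thesis using quotientI[OF assms(2), of "glue i j r"] by simp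
    next
      case False
      then obtain u where u: "u \<in> A" "X = r `` {u}" "X \<noteq> r `` {i}" "X \<noteq> r `` {j}"
        using X by (blast elim: quotientE)
      then have "X = glue i j r `` {u}"
        using 2[of u] 3[OF u(1) assms(2)] 3[OF u(1) assms(3)] by simp
      then show ?thesis using quotientI[OF u(1), of "glue i j r"] by simp
    qed
  qed
qed

lemma quotient_isolate:
  assumes r: "equiv A r" and "i \<in> A"
  shows "A // isolate i r = insert {i} ((A // r - {r `` {i}}) \<union> ({r `` {i} - {i}} - {{}}))"
proof -
  have i_in: "i \<in> r `` {u} \<longleftrightarrow> r `` {u} = r `` {i}" if "u \<in> A" for u
    using that r assms(2) by (metis Image_singleton_iff eq_equiv_class_iff)
  have 3: "u \<in> r `` {u}" if "u \<in> A" for u using that r by (simp add: equiv_reflD)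
  show ?thesis
  proof (intro equalityI subsetI)
    fix X assume "X \<in> A // isolate i r"
    then obtain u where u: "u \<in> A" "X = isolate i r `` {u}" by (blast elim: quotientE)
    show "X \<in> insert {i} ((A // r - {r `` {i}}) \<union> ({r `` {i} - {i}} - {{}}))"
    proof (cases "u = i")
      case True then show ?thesis using u isolate_class[of i r] by auto
    next
      case False
      then show ?thesis
        using u isolate_class[of i r u] i_in[OF u(1)] 3[OF u(1)] by (cases "i \<in> r `` {u}") (auto intro: quotientI)
    qed
  next
    fix X assume "X \<in> insert {i} ((A // r - {r `` {i}}) \<union> ({r `` {i} - {i}} - {{}}))"
    then consider "X = {i}" | "X \<in> A // r" "X \<noteq> r `` {i}" | "X = r `` {i} - {i}" "X \<noteq> {}" by auto
    then show "X \<in> A // isolate i r"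
    proof cases
      case 1
      have "X = isolate i r `` {i}" using 1 isolate_class[of i r i] by simp
      then show ?thesis using assms(2) by (auto intro: quotientI)
    next
      case 2
      then obtain u where u: "u \<in> A" "X = r `` {u}" by (blast elim: quotientE)
      then have "i \<notin> r `` {u}" "u \<noteq> i" using 2(2) i_in[OF u(1)] u(2) assms equiv_reflD[OF r] by auto
      then have "X = isolate i r `` {u}" using u(2) by (auto simp: isolate_iff)
      then show ?thesis using u(1) by (auto intro: quotientI)
    next
      case 3
      then obtain u where u: "(i, u) \<in> r" "u \<noteq> i" by auto
      then have "X = isolate i r `` {u}"
        using 3(1) equiv_class_eq[OF r u(1)] by (simp add: isolate_class)
      then show ?thesis using u(1) r by (meson equiv_fieldD quotientI)
    qed
  qed
qed

lemma respects_glue: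
  assumes "h respects r" "h i = h j"
  shows "h respects glue i j r"
proof (rule congruentI)
  fix u v assume uv: "(u, v) \<in> glue i j r"
  have *: "h a = h b" if "(a, b) \<in> r" for a b using assms(1) that by (rule congruentD)
  show "h u = h v" using uv *[of u v] *[of i u] *[of i v] *[of j u] *[of j v] assms(2)
    unfolding glue_iff by argo
qed

section \<open>Products over equivalence classes\<close>

text \<open>The factor of a class is read off at its least element. For a function that respects the relation
this is its common value on the class.\<close>
definition class_prod :: "nat set \<Rightarrow> nat rel \<Rightarrow> (nat \<Rightarrow> 'a::comm_monoid_mult) \<Rightarrow> 'a"
  where "class_prod A r g = (\<Prod>C\<in>A // r. g (Min C))"

lemma respects_Min_class:
  assumes "finite A" "equiv A r" "g respects r" "u \<in> A"
  shows "g (Min (r `` {u})) = g u"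
proof -
  have "finite (r `` {u})" by (meson assms equiv_type finite_equiv_class quotientI)
  moreover have "u \<in> r `` {u}" using assms by (simp add: equiv_reflD)
  ultimately have "Min (r `` {u}) \<in> r `` {u}" by (intro Min_in) auto
  then show ?thesis using assms(3) by (auto simp: congruent_def)
qed

text \<open>Two classes with the same value become one, so one of two equal factors disappears.\<close>
lemma class_prod_glue:
  assumes A: "finite A" and r: "equiv A r" and ij: "i \<in> A" "j \<in> A" "(i, j) \<notin> r"
    and g: "g respects glue i j r"
  shows "class_prod A r g = g i * class_prod A (glue i j r) g"
proof -
  let ?Q = "A // r" and ?I = "r `` {i}" and ?J = "r `` {j}"
  have gr: "g respects r" using g by (auto simp: congruent_def glue_iff)
  have fin: "finite ?Q" by (meson A r equiv_type finite_quotient)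
  have ne: "?I \<noteq> ?J" using ij r by (metis eq_equiv_class)
  have IJ: "?I \<in> ?Q" "?J \<in> ?Q" using ij by (auto intro: quotientI)
  have "g i = g j" using g ij r by (auto simp: congruent_def glue_iff equiv_reflD)
  have new: "?I \<union> ?J = glue i j r `` {i}"
    using glue_class[OF r, of i i j] ij(1) equiv_reflD[OF r] by simp
  have gU: "g (Min (?I \<union> ?J)) = g i"
    unfolding new by (rule respects_Min_class[OF A equiv_glue[OF r ij(1,2)] g ij(1)])
  have notin: "?I \<union> ?J \<notin> ?Q - {?I, ?J}"
  proof
    assume "?I \<union> ?J \<in> ?Q - {?I, ?J}"
    then have "?I \<union> ?J \<in> ?Q" by blast
    then obtain u where "u \<in> A" "?I \<union> ?J = r `` {u}" by (rule quotientE) blast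
    then have "(u, i) \<in> r" "(u, j) \<in> r" using ij r by (auto dest: equiv_reflD)
    then show False using ij(3) r by (meson equiv_symD equiv_transD)
  qed
  have "class_prod A r g = g (Min ?I) * (g (Min ?J) * (\<Prod>C\<in>?Q - {?I} - {?J}. g (Min C)))"
    unfolding class_prod_def
    by (subst prod.remove[OF fin IJ(1)], subst prod.remove[of _ ?J]) (use fin IJ ne in auto)
  also have "?Q - {?I} - {?J} = ?Q - {?I, ?J}" by auto
  also have "g (Min ?I) = g i" by (rule respects_Min_class[OF A r gr ij(1)])
  also have "g (Min ?J) = g i"
    using respects_Min_class[OF A r gr ij(2)] \<open>g i = g j\<close> by simp
  also have "g i * (\<Prod>C\<in>?Q - {?I, ?J}. g (Min C)) = class_prod A (glue i j r) g"
    unfolding class_prod_def quotient_glue[OF r ij(1,2)]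
    by (subst prod.insert) (use fin notin gU in auto)
  finally show ?thesis .
qed

text \<open>The class that \<open>i\<close> leaves still contains \<open>c\<close> and keeps its factor; the new class \<open>{i}\<close> may receive
any value, which is why \<open>g\<close> is changed at \<open>i\<close>.\<close>
lemma class_prod_isolate:
  assumes A: "finite A" and r: "equiv A r" and c: "(i, c) \<in> r" "c \<noteq> i" and g: "g respects r"
  shows "class_prod A (isolate i r) (g(i := x)) = x * class_prod A r g"
proof -
  let ?Q = "A // r" and ?I = "r `` {i}"
  have iA: "i \<in> A" "c \<in> A" using r c equiv_fieldD by fastforce+
  have fin: "finite ?Q" by (meson A r equiv_type finite_quotient)
  have I: "?I \<in> ?Q" using iA by (auto intro: quotientI)
  have resp: "g(i := x) respects isolate i r" using g by (auto simp: congruent_def isolate_iff)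
  have ne: "?I - {i} \<noteq> {}" using c by auto
  have cl: "?I - {i} = isolate i r `` {c}"
    using c(2) equiv_class_eq[OF r c(1)] by (simp add: isolate_class)
  have gI: "(g(i := x)) (Min (?I - {i})) = g c"
    unfolding cl using respects_Min_class[OF A equiv_isolate[OF r iA(1)] resp iA(2)] c by simp
  have rest: "(g(i := x)) (Min C) = g (Min C)" if C: "C \<in> ?Q - {?I}" for C
  proof -
    obtain u where u: "u \<in> A" "C = r `` {u}" using C by (blast elim: quotientE)
    have "i \<notin> C"
    proof
      assume "i \<in> C"
      then have "r `` {u} = r `` {i}" using u r by (auto simp: equiv_class_eq)
      then show False using C u by auto
    qed
    moreover have "finite C" "C \<noteq> {}"
      using C A r by (auto simp: in_quotient_imp_non_empty
          intro: finite_equiv_class[OF _ equiv_type])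
    ultimately have "Min C \<noteq> i" using Min_in by blast
    then show ?thesis by simp
  qed
  have gi: "g (Min ?I) = g c"
    using respects_Min_class[OF A r g iA(1)] g c by (auto simp: congruent_def)
  have notin: "?I - {i} \<notin> ?Q - {?I}" "{i} \<notin> insert (?I - {i}) (?Q - {?I})"
  proof -
    have no: "D \<notin> ?Q" if "D \<subseteq> ?I" "D \<noteq> ?I" "D \<noteq> {}" for D
    proof
      assume "D \<in> ?Q"
      then obtain u where "u \<in> A" "D = r `` {u}" by (blast elim: quotientE)
      moreover then have "(i, u) \<in> r" using that r by (auto simp: equiv_reflD)
      ultimately show False using that r by (simp add: equiv_class_eq)
    qed
    have "i \<in> ?I" using r iA by (auto simp: equiv_reflD)
    then show "?I - {i} \<notin> ?Q - {?I}" using no[of "?I - {i}"] ne by blast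
    show "{i} \<notin> insert (?I - {i}) (?Q - {?I})" using no[of "{i}"] \<open>i \<in> ?I\<close> c by blast
  qed
  have "A // isolate i r = insert {i} (insert (?I - {i}) (?Q - {?I}))"
    unfolding quotient_isolate[OF r iA(1)] using ne by auto
  then have "class_prod A (isolate i r) (g(i := x)) =
      x * (g c * (\<Prod>C\<in>?Q - {?I}. (g(i := x)) (Min C)))"
    unfolding class_prod_def using notin fin gI by simp
  also have "(\<Prod>C\<in>?Q - {?I}. (g(i := x)) (Min C)) = (\<Prod>C\<in>?Q - {?I}. g (Min C))"
    using rest by (rule prod.cong[OF refl])
  also have "g c * \<dots> = class_prod A r g"
    unfolding class_prod_def by (subst prod.remove[OF fin I]) (simp add: gi)
  finally show ?thesis .
qed

text \<open>Division-free form of: a singleton class contributes its own factor, and no other factor sees \<open>i\<close>.\<close>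
lemma class_prod_singleton:
  assumes A: "finite A" and r: "equiv A r" and iA: "i \<in> A" and i: "r `` {i} = {i}"
  shows "class_prod A r g * y = class_prod A r (g(i := y)) * g i"
proof -
  have fin: "finite (A // r)" by (meson A r equiv_type finite_quotient)
  have I: "{i} \<in> A // r" using iA i quotientI by metis
  have rest: "(g(i := y)) (Min C) = g (Min C)" if C: "C \<in> A // r - {{i}}" for C
  proof -
    have "i \<notin> C" using C i r iA
      by (metis DiffE I disjoint_iff insertI1 quotient_disj singletonI)
    moreover have "finite C" "C \<noteq> {}"
      using C A r by (auto simp: in_quotient_imp_non_empty
          intro: finite_equiv_class[OF _ equiv_type])
    ultimately have "Min C \<noteq> i" using Min_in by blast
    then show ?thesis by simp
  qed
  show ?thesis unfolding class_prod_def
    using prod.cong[OF refl rest, of "A // r - {{i}}"]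
    by (subst (1 2) prod.remove[OF fin I]) (simp add: ac_simps)
qed

lemma class_prod_minima:
  assumes "finite A" and r: "equiv A r"
  shows "class_prod A r g = (\<Prod>u | u \<in> A \<and> (\<forall>v. (v, u) \<in> r \<longrightarrow> u \<le> v). g u)"
proof -
  define M where "M = {u \<in> A. \<forall>v. (v, u) \<in> r \<longrightarrow> u \<le> v}"
  note S = equiv_symD[OF r]
  have fin: "finite (r `` {u})" for u
    by (rule finite_subset[OF _ assms(1)]) (use equiv_type[OF r] in auto)
  have Min_M: "Min (r `` {u}) = u" if "u \<in> M" for u
    using that fin equiv_reflD[OF r] S by (intro Min_eqI) (auto simp: M_def)
  have inj: "inj_on (\<lambda>u. r `` {u}) M"
    by (rule inj_onI) (metis Min_M)
  have "A // r = (\<lambda>u. r `` {u}) ` M"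
  proof (intro equalityI subsetI)
    fix C assume "C \<in> A // r"
    then obtain w where w: "w \<in> A" "C = r `` {w}" by (rule quotientE)
    let ?u = "Min C"
    have "C \<noteq> {}" using w equiv_reflD[OF r] by blast
    moreover have "finite C" using fin w(2) by simp
    ultimately have u: "?u \<in> C" by (rule Min_in[rotated])
    then have wu: "(w, ?u) \<in> r" using w by blast
    have "?u \<le> v" if "(v, ?u) \<in> r" for v
    proof -
      have "v \<in> C" using w(2) wu that S equiv_transD[OF r] by blast
      then show ?thesis using fin w(2) by simp
    qed
    then have "?u \<in> M" using equiv_fieldD[OF r wu] by (simp add: M_def)
    moreover have "C = r `` {?u}" using w(2) equiv_class_eq[OF r wu] by simp
    ultimately show "C \<in> (\<lambda>u. r `` {u}) ` M" by blast
  qed (auto simp: M_def intro: quotientI)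
  then have "class_prod A r g = (\<Prod>u\<in>M. g (Min (r `` {u})))"
    unfolding class_prod_def by (simp add: prod.reindex[OF inj])
  also have "\<dots> = (\<Prod>u\<in>M. g u)" using Min_M by (intro prod.cong) auto
  finally show ?thesis by (simp add: M_def)
qed

section \<open>Noncrossing relations\<close>

definition noncrossing_rel :: "nat rel \<Rightarrow> bool"
  where "noncrossing_rel r \<longleftrightarrow>
    (\<forall>a b c d. a < b \<and> b < c \<and> c < d \<and> (a, c) \<in> r \<and> (b, d) \<in> r \<longrightarrow> (a, b) \<in> r)"

definition nc_rels :: "nat \<Rightarrow> nat rel set"
  where "nc_rels k = {r. equiv {1..k} r \<and> noncrossing_rel r}"

lemma noncrossing_relD:
  "noncrossing_rel r \<Longrightarrow> a < b \<Longrightarrow> b < c \<Longrightarrow> c < d \<Longrightarrow> (a, c) \<in> r \<Longrightarrow> (b, d) \<in> r \<Longrightarrow> (a, b) \<in> r"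
  unfolding noncrossing_rel_def by blast

lemma nc_relsD:
  assumes "r \<in> nc_rels k"
  shows "equiv {1..k} r" "noncrossing_rel r"
  using assms by (auto simp: nc_rels_def)

lemma nc_isolate:
  assumes r: "r \<in> nc_rels k" and i: "1 \<le> i" "i \<le> k"
  shows "isolate i r \<in> nc_rels k"
proof -
  have "equiv {1..k} (isolate i r)" using equiv_isolate[OF nc_relsD(1)[OF r]] i by simp
  moreover have "noncrossing_rel (isolate i r)"
    unfolding noncrossing_rel_def
  proof (intro allI impI, elim conjE)
    fix a b c d assume A: "a < b" "b < c" "c < d" "(a, c) \<in> isolate i r" "(b, d) \<in> isolate i r"
    then have "a \<noteq> i" "b \<noteq> i" "(a, c) \<in> r" "(b, d) \<in> r" by (auto simp: isolate_iff)
    then show "(a, b) \<in> isolate i r"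
      using noncrossing_relD[OF nc_relsD(2)[OF r] A(1-3)] by (simp add: isolate_iff)
  qed
  ultimately show ?thesis by (simp add: nc_rels_def)
qed

text \<open>A block that enters the interval between two points of another block stays inside it.\<close>
lemma noncrossing_inside:
  assumes r: "r \<in> nc_rels k" and ac: "(a, c) \<in> r" and uv: "(u, v) \<in> r" "(a, u) \<notin> r"
    and u: "a < u" "u < c"
  shows "a < v \<and> v < c"
proof -
  note S = equiv_symD[OF nc_relsD(1)[OF r]] and T = equiv_transD[OF nc_relsD(1)[OF r]]
  note N = noncrossing_relD[OF nc_relsD(2)[OF r]]
  have "v \<noteq> a" "v \<noteq> c" using uv ac S T by blast+
  moreover have "\<not> v < a" using N[of v a u c] u ac uv S T by blast
  moreover have "\<not> c < v" using N[of a u c v] u ac uv by blast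
  ultimately show ?thesis by auto
qed

text \<open>A block \<open>C\<close> outside the glued block \<open>M\<close> cannot separate points of \<open>M\<close>: each half of \<open>M\<close> stays on
one side of any two points of \<open>C\<close>, and \<open>i\<close>, \<open>i + 1\<close> are on the same side since no point lies between
them.\<close>
lemma nc_glue:
  assumes r: "r \<in> nc_rels k" and i: "1 \<le> i" "i < k"
  shows "glue i (Suc i) r \<in> nc_rels k"
proof -
  have q: "equiv {1..k} r" using nc_relsD[OF r] by blast
  note S = equiv_symD[OF q] and T = equiv_transD[OF q]
  note N = noncrossing_relD[OF nc_relsD(2)[OF r]]
  define M where "M = r `` {i} \<union> r `` {Suc i}"
  have M: "u \<in> M \<longleftrightarrow> (i, u) \<in> r \<or> (Suc i, u) \<in> r" for u by (simp add: M_def)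
  have g: "(u, v) \<in> glue i (Suc i) r \<longleftrightarrow> (u, v) \<in> r \<or> u \<in> M \<and> v \<in> M" for u v
    unfolding glue_iff M using S[of i u] S[of "Suc i" u] T[of u i v] T[of u "Suc i" v] by blast
  have Mr: "v \<in> M" if "u \<in> M" "(u, v) \<in> r" for u v using that T unfolding M by blast
  have side: "a < v \<and> v < c" if ac: "(a, c) \<in> r" "a \<notin> M" and uv: "u \<in> M" "v \<in> M" and u: "a < u" "u < c"
    for a c u v
  proof -
    have nr: "(a, w) \<notin> r" if "w \<in> M" for w using that Mr ac S by blast
    have ins: "a < w \<and> w < c" if "(z, w) \<in> r" "z \<in> M" "a < z \<and> z < c" for w z
      using noncrossing_inside[OF r ac(1) that(1) nr[OF that(2)]] that(3) by blast
    have cM: "c \<notin> M" using Mr ac S by blast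
    have iM: "i \<in> M" "Suc i \<in> M" using equiv_reflD[OF q] i by (auto simp: M)
    have one: "a < i \<and> i < c \<longleftrightarrow> a < Suc i \<and> Suc i < c"
      using iM ac(2) cM by (metis Suc_lessI less_SucE less_Suc_eq less_trans lessI)
    have "a < i \<and> i < c" using uv(1) ins[of u i] ins[of u "Suc i"] u S one unfolding M
      using M uv(1) by blast
    then show ?thesis using ins[of i v] ins[of "Suc i" v] one iM uv(2) unfolding M by blast
  qed
  have "noncrossing_rel (glue i (Suc i) r)"
    unfolding noncrossing_rel_def
  proof (intro allI impI, elim conjE)
    fix a b c d assume A: "a < b" "b < c" "c < d" "(a, c) \<in> glue i (Suc i) r" "(b, d) \<in> glue i (Suc i) r"
    show "(a, b) \<in> glue i (Suc i) r"
    proof (cases "a \<in> M")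
      case aM: True
      then have cM: "c \<in> M" using A(4) Mr unfolding g by blast
      show ?thesis
      proof (cases "b \<in> M")
        case True
        then show ?thesis using aM g by blast
      next
        case False
        then have "(b, d) \<in> r" using A(5) g by blast
        then have False using side[OF _ False cM aM] A by auto
        then show ?thesis ..
      qed
    next
      case aM: False
      then have ac: "(a, c) \<in> r" using A(4) g by blast
      show ?thesis
      proof (cases "b \<in> M")
        case True
        then have dM: "d \<in> M" using A(5) Mr unfolding g by blast
        have False using side[OF ac aM True dM] A by auto
        then show ?thesis ..
      next
        case False
        then have "(b, d) \<in> r" using A(5) g by blast
        then show ?thesis using N[OF A(1-3) ac] g by blast
      qed
    qed
  qed
  moreover have "equiv {1..k} (glue i (Suc i) r)" using equiv_glue[OF q] i by simp
  ultimately show ?thesis by (simp add: nc_rels_def)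
qed

lemma Id_on_nc: "Id_on {1..k} \<in> nc_rels k"
  by (auto simp: nc_rels_def noncrossing_rel_def equiv_def refl_on_def sym_def trans_def)

section \<open>Regions of a noncrossing relation\<close>

text \<open>The even positions are the places \<open>0, \<dots>, k\<close>, where place \<open>a\<close> lies between the points \<open>a\<close> and \<open>a + 1\<close>.
Two places are in the same region if no block has points both between them and elsewhere. A point
\<open>u\<close> is between \<open>a\<close> and \<open>b\<close> exactly if \<open>a < u\<close> and \<open>b < u\<close> differ; with this test symmetry and
transitivity are propositional. On \<open>{0..k}\<close> the relation is the Kreweras complement, with \<open>0\<close> and \<open>k\<close>
identified.\<close>
definition gap :: "nat rel \<Rightarrow> nat \<Rightarrow> nat \<Rightarrow> bool"
  where "gap r a b \<longleftrightarrow> (\<forall>u v. (u, v) \<in> r \<longrightarrow> ((a < u) = (b < u)) = ((a < v) = (b < v)))"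

text \<open>Position \<open>2 a\<close> is place \<open>a\<close>, and position \<open>2 a + 1\<close> is point \<open>a + 1\<close>.\<close>
definition region :: "nat \<Rightarrow> nat rel \<Rightarrow> nat rel"
  where "region k r = {(u, v). u \<le> 2 * k \<and> v \<le> 2 * k \<and> even u = even v \<and>
    (if even u then gap r (u div 2) (v div 2) else (Suc (u div 2), Suc (v div 2)) \<in> r)}"

lemma gap_refl: "gap r a a"
  by (simp add: gap_def)

lemma gap_sym: "gap r a b \<Longrightarrow> gap r b a"
  unfolding gap_def by metis

lemma gap_trans: "gap r a b \<Longrightarrow> gap r b c \<Longrightarrow> gap r a c"
  unfolding gap_def by metis

lemma gap_intervalI:
  assumes r: "equiv A r" and "a \<le> b"
    and "\<And>u v. (u, v) \<in> r \<Longrightarrow> a < u \<Longrightarrow> u \<le> b \<Longrightarrow> a < v \<and> v \<le> b"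
  shows "gap r a b"
  unfolding gap_def
proof (intro allI impI)
  fix u v assume "(u, v) \<in> r"
  moreover have "((a < w) = (b < w)) \<longleftrightarrow> \<not> (a < w \<and> w \<le> b)" for w using assms(2) by auto
  ultimately show "((a < u) = (b < u)) = ((a < v) = (b < v))"
    using assms(3)[of u v] assms(3)[of v u] equiv_symD[OF r] by auto
qed

lemma gapD: "gap r a b \<Longrightarrow> (u, v) \<in> r \<Longrightarrow> ((a < u) = (b < u)) = ((a < v) = (b < v))"
  by (auto simp: gap_def)

lemma equiv_region:
  assumes r: "equiv {1..k} r"
  shows "equiv {..2 * k} (region k r)"
proof (rule equivI)
  show "region k r \<subseteq> {..2 * k} \<times> {..2 * k}" by (auto simp: region_def)
  show "refl_on {..2 * k} (region k r)"
    using equiv_reflD[OF r] by (auto simp: refl_on_def region_def gap_refl elim!: oddE)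
  show "sym (region k r)"
    unfolding sym_def region_def using gap_sym equiv_symD[OF r] by auto
  show "trans (region k r)"
    unfolding trans_def region_def using gap_trans equiv_transD[OF r] by (simp split: if_splits) blast
qed

lemma gap_isolate_mono:
  assumes "gap r a b"
  shows "gap (isolate i r) a b"
  using assms unfolding gap_def isolate_iff by blast

lemma gap_isolate_self: "gap (isolate (Suc i) r) i (Suc i)"
  unfolding gap_def isolate_iff by auto

lemma gap_single_iff:
  assumes r: "equiv A r"
  shows "gap r m (Suc m) \<longleftrightarrow> (\<forall>w. (Suc m, w) \<in> r \<longrightarrow> w = Suc m)"
proof
  assume s: "\<forall>w. (Suc m, w) \<in> r \<longrightarrow> w = Suc m"
  show "gap r m (Suc m)"
  proof (rule gap_intervalI[OF r])
    fix u v assume "(u, v) \<in> r" "m < u" "u \<le> Suc m"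
    then show "m < v \<and> v \<le> Suc m" using s by (metis le_eq_less_or_eq less_Suc_eq not_less)
  qed simp
next
  assume g: "gap r m (Suc m)"
  show "\<forall>w. (Suc m, w) \<in> r \<longrightarrow> w = Suc m"
    using gapD[OF g] by (metis lessI less_irrefl less_Suc_eq not_less_eq)
qed

text \<open>A block with points both between two consecutive points of a block and elsewhere would cross it.\<close>
lemma gap_next:
  assumes r: "r \<in> nc_rels k" and c: "(i, c) \<in> r" "i < c"
    and nx: "\<And>w. i < w \<Longrightarrow> w < c \<Longrightarrow> (i, w) \<notin> r"
  shows "gap r i (c - 1)"
proof (rule gap_intervalI[OF nc_relsD(1)[OF r]])
  note S = equiv_symD[OF nc_relsD(1)[OF r]] and T = equiv_transD[OF nc_relsD(1)[OF r]]
  note N = noncrossing_relD[OF nc_relsD(2)[OF r]]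
  show "i \<le> c - 1" using c by simp
  fix u v assume uv: "(u, v) \<in> r" "i < u" "u \<le> c - 1"
  then have u: "u < c" using c by simp
  have "v \<noteq> i" "v \<noteq> c" using nx[of u] uv S T c u by blast+
  moreover have "\<not> v < i" using N[of v i u c] uv S c u nx[of u] T by blast
  moreover have "\<not> c < v" using N[of i u c v] uv c u nx[of u] by blast
  ultimately show "i < v \<and> v \<le> c - 1" by auto
qed

text \<open>A block with points both below a whole block and outside its span would cross it.\<close>
lemma gap_block:
  assumes r: "r \<in> nc_rels k" and a: "(a, i) \<in> r"
    and mn: "\<And>w. (w, i) \<in> r \<Longrightarrow> a \<le> w" and mx: "\<And>w. (w, i) \<in> r \<Longrightarrow> w \<le> i"
  shows "gap r (a - 1) i"
proof (rule gap_intervalI[OF nc_relsD(1)[OF r]])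
  note S = equiv_symD[OF nc_relsD(1)[OF r]] and T = equiv_transD[OF nc_relsD(1)[OF r]]
  note N = noncrossing_relD[OF nc_relsD(2)[OF r]]
  have "1 \<le> a" using equiv_fieldD[OF nc_relsD(1)[OF r] a] by simp
  show "a - 1 \<le> i" using mx[OF a] by simp
  fix u v assume uv: "(u, v) \<in> r" "a - 1 < u" "u \<le> i"
  show "a - 1 < v \<and> v \<le> i"
  proof (cases "(u, i) \<in> r")
    case True
    then have "(v, i) \<in> r" using S T uv by blast
    then show ?thesis using mn mx \<open>1 \<le> a\<close> by fastforce
  next
    case False
    then have "u \<noteq> a" "u \<noteq> i" using a S T uv equiv_reflD equiv_fieldD by blast+
    then have "a < u" "u < i" using uv by auto
    moreover have "\<not> v < a" using N[of v a u i] \<open>a < u\<close> \<open>u < i\<close> uv S T a False by blast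
    moreover have "\<not> i < v" using N[of a u i v] \<open>a < u\<close> \<open>u < i\<close> uv S T a False by blast
    ultimately show ?thesis using \<open>1 \<le> a\<close> by auto
  qed
qed

text \<open>Removing \<open>i\<close> from its block opens a single passage, between the places \<open>i - 1\<close> and \<open>i\<close>. Indeed, if the
interval from \<open>a\<close> to \<open>b\<close> is a union of blocks only after the removal, then it separates \<open>i\<close> from the rest
of its block. If \<open>i\<close> lies inside, the two pieces into which \<open>i\<close> cuts the interval are unions of blocks;
if \<open>i\<close> lies outside, so are the stretch between \<open>i\<close> and the interval and the interval extended by this
stretch and \<open>i\<close>. In either case a block leaving one of these sets would have to cross the block of \<open>i\<close>.\<close>
lemma gap_isolateD:
  assumes r: "r \<in> nc_rels k" and i: "1 \<le> i" and G: "gap (isolate i r) a b"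
  shows "gap r a b \<or> gap r a (i - 1) \<and> gap r i b \<or> gap r a i \<and> gap r (i - 1) b"
  using G
proof (induction a b rule: linorder_wlog)
  case (sym a b)
  then show ?case using gap_sym by blast
next
  case (le a b)
  note S = equiv_symD[OF nc_relsD(1)[OF r]] and T = equiv_transD[OF nc_relsD(1)[OF r]]
  note N = noncrossing_relD[OF nc_relsD(2)[OF r]]
  note I = gap_intervalI[OF nc_relsD(1)[OF r]]
  have cl: "(a < u \<and> u \<le> b) \<longleftrightarrow> (a < v \<and> v \<le> b)" if "(u, v) \<in> r" "u \<noteq> i" "v \<noteq> i" for u v
    using gapD[OF le(2), of u v] that le(1) by (auto simp: isolate_iff)
  show ?case
  proof (rule ccontr)
    assume nt: "\<not> ?case"
    then have "\<not> gap r a b" by blast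
    then obtain u v where uv: "(u, v) \<in> r" "a < u" "u \<le> b" "\<not> (a < v \<and> v \<le> b)"
      using I[OF le(1)] by blast
    then have "u = i \<or> v = i" using cl[of u v] by blast
    \<comment> \<open>the point \<open>i\<close> is between \<open>a\<close> and \<open>b\<close> and the rest of its block is not, or vice versa\<close>
    then consider (inside) "u = i" "v \<noteq> i" | (outside) "v = i" "u \<noteq> i" using uv by blast
    then show False
    proof cases
      case inside
      have far: "\<not> (a < w \<and> w \<le> b)" if "(i, w) \<in> r" "w \<noteq> i" for w
        using cl[of w v] that inside uv S T by blast
      have "gap r a (i - 1)"
      proof (rule I)
        show "a \<le> i - 1" using uv inside by auto
        fix x y assume xy: "(x, y) \<in> r" "a < x" "x \<le> i - 1"
        then have "x < i" "x \<le> b" using i uv inside by auto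
        then have x: "x < i" "x \<le> b" "(i, x) \<notin> r" using far[of x] xy by auto
        then have y: "y \<noteq> i" "a < y" "y \<le> b" using xy S cl[of x y] by blast+
        have "\<not> i < y"
          using N[of v x i y] N[of x i y v] x xy y uv inside S T by (metis not_le le_less_trans)
        then show "a < y \<and> y \<le> i - 1" using y by auto
      qed
      moreover have "gap r i b"
      proof (rule I)
        show "i \<le> b" using uv inside by auto
        fix x y assume xy: "(x, y) \<in> r" "i < x" "x \<le> b"
        then have "a < x" using uv inside by auto
        then have x: "a < x" "(i, x) \<notin> r" using far[of x] xy by auto
        then have y: "y \<noteq> i" "a < y" "y \<le> b" using xy S cl[of x y] by blast+
        have "\<not> y < i"
          using N[of v y i x] N[of y i x v] x xy y uv inside S T by (metis not_le le_less_trans)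
        then show "i < y \<and> y \<le> b" using y by auto
      qed
      ultimately show False using nt by blast
    next
      case outside
      have far: "a < w \<and> w \<le> b" if "(i, w) \<in> r" "w \<noteq> i" for w
        using cl[of w u] that outside uv S T by blast
      have iu: "(i, u) \<in> r" using uv outside S by blast
      show False
      proof (cases "i \<le> a")
        case True
        have "gap r i a"
        proof (rule I)
          show "i \<le> a" by fact
          fix x y assume xy: "(x, y) \<in> r" "i < x" "x \<le> a"
          then have x: "(i, x) \<notin> r" using far[of x] by auto
          then have y: "y \<noteq> i" "\<not> (a < y \<and> y \<le> b)" using xy S cl[of x y] by auto
          have "\<not> y < i" using N[of y i x u] x xy iu uv S T by (metis le_less_trans)
          moreover have "\<not> b < y" using N[of i x u y] x xy iu uv by (metis le_less_trans)
          ultimately show "i < y \<and> y \<le> a" using y by auto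
        qed
        moreover have "gap r (i - 1) b"
        proof (rule I)
          show "i - 1 \<le> b" using True le by auto
          fix x y assume xy: "(x, y) \<in> r" "i - 1 < x" "x \<le> b"
          show "i - 1 < y \<and> y \<le> b"
          proof (cases "x = i \<or> y = i")
            case True
            then show ?thesis
              using xy far[of y] far[of x] S \<open>i \<le> a\<close> le(1) i by (cases "y = i"; cases "x = i") force+
          next
            case False
            show ?thesis
              using cl[of x y] gapD[OF \<open>gap r i a\<close> xy(1)] xy False i \<open>i \<le> a\<close> le(1) by auto
          qed
        qed
        ultimately show False using nt gap_sym by blast
      next
        case False
        then have bi: "b < i" using uv outside by auto
        have "gap r b (i - 1)"
        proof (rule I)
          show "b \<le> i - 1" using bi by simp
          fix x y assume xy: "(x, y) \<in> r" "b < x" "x \<le> i - 1"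
          then have "x < i" using i by simp
          then have x: "(i, x) \<notin> r" "x < i" using far[of x] xy bi by auto
          then have y: "y \<noteq> i" "\<not> (a < y \<and> y \<le> b)" using xy S cl[of x y] by auto
          have "\<not> i < y" using N[of u x i y] x xy iu uv S T by (metis le_less_trans)
          moreover have "\<not> y \<le> a" using N[of y u x i] x xy iu uv S T by (metis le_less_trans)
          ultimately show "b < y \<and> y \<le> i - 1" using y by auto
        qed
        moreover have "gap r a i"
        proof (rule I)
          show "a \<le> i" using bi le by auto
          fix x y assume xy: "(x, y) \<in> r" "a < x" "x \<le> i"
          show "a < y \<and> y \<le> i"
          proof (cases "x = i \<or> y = i")
            case True
            then show ?thesis
              using xy far[of y] far[of x] S bi le(1) i by (cases "y = i"; cases "x = i") force+
          next
            case False
            show ?thesis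
              using cl[of x y] gapD[OF \<open>gap r b (i - 1)\<close> xy(1)] xy False i bi le(1) by auto
          qed
        qed
        ultimately show False using nt gap_sym by blast
      qed
    qed
  qed
qed

text \<open>The points \<open>i\<close> and \<open>i + 1\<close> are on the same side of every union of blocks, so place \<open>i\<close> is cut off.\<close>
lemma gap_glueD:
  assumes "gap (glue i (Suc i) r) a b" "(i, i) \<in> r" "(Suc i, Suc i) \<in> r"
  shows "gap r a b" "a = i \<longleftrightarrow> b = i"
proof -
  show "gap r a b" using assms(1) by (auto simp: gap_def glue_iff)
  show "a = i \<longleftrightarrow> b = i" using gapD[OF assms(1), of i "Suc i"] assms(2,3) by (auto simp: glue_iff)
qed

text \<open>If neither end is place \<open>i\<close>, the interval cannot separate \<open>i\<close> from \<open>i + 1\<close>.\<close>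
lemma gap_glueI:
  assumes "gap r a b" "a \<noteq> i" "b \<noteq> i"
  shows "gap (glue i (Suc i) r) a b"
proof -
  have *: "(a < i) = (a < Suc i)" "(b < i) = (b < Suc i)" using assms by auto
  show ?thesis unfolding gap_def
  proof (intro allI impI)
    fix u v assume "(u, v) \<in> glue i (Suc i) r"
    then show "((a < u) = (b < u)) = ((a < v) = (b < v))"
      unfolding glue_iff using gapD[OF assms(1)] * by metis
  qed
qed

lemma mem_region_even: "(2 * a, 2 * b) \<in> region k r \<longleftrightarrow> a \<le> k \<and> b \<le> k \<and> gap r a b"
  by (auto simp: region_def)

lemma mem_region_odd:
  "equiv {1..k} r \<Longrightarrow> (Suc (2 * a), Suc (2 * b)) \<in> region k r \<longleftrightarrow> (Suc a, Suc b) \<in> r"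
  using equiv_fieldD[of "{1..k}" r "Suc a" "Suc b"] by (auto simp: region_def)

lemma mem_region_mixed:
  "(2 * a, Suc (2 * b)) \<notin> region k r" "(Suc (2 * b), 2 * a) \<notin> region k r"
  by (auto simp: region_def)

lemmas mem_region = mem_region_even mem_region_odd mem_region_mixed

lemma rel_eqI_parity:
  assumes "\<And>a b. (2 * a, 2 * b) \<in> R \<longleftrightarrow> (2 * a, 2 * b) \<in> S"
    "\<And>a b. (Suc (2 * a), Suc (2 * b)) \<in> R \<longleftrightarrow> (Suc (2 * a), Suc (2 * b)) \<in> S"
    "\<And>a b. (2 * a, Suc (2 * b)) \<in> R \<longleftrightarrow> (2 * a, Suc (2 * b)) \<in> S"
    "\<And>a b. (Suc (2 * a), 2 * b) \<in> R \<longleftrightarrow> (Suc (2 * a), 2 * b) \<in> S"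
  shows "R = S"
proof -
  have "(u, v) \<in> R \<longleftrightarrow> (u, v) \<in> S" for u v :: nat
    by (cases "even u"; cases "even v") (auto elim!: evenE oddE simp: assms)
  then show ?thesis by auto
qed

text \<open>The generator \<open>e j\<close> at an even position \<open>j\<close>.\<close>
lemma region_glue:
  assumes r: "equiv {1..k} r" and i: "1 \<le> i" "i < k"
  shows "region k (glue i (Suc i) r) =
    glue (2 * i - 1) (2 * i + 1) (isolate (2 * i) (region k r))"
proof -
  obtain m where m: "i = Suc m" using i by (cases i) auto
  have g: "equiv {1..k} (glue i (Suc i) r)" using r i by (intro equiv_glue) auto
  have ii: "(i, i) \<in> r" "(Suc i, Suc i) \<in> r" using i equiv_reflD[OF r] by auto
  have pos: "2 * i - 1 = Suc (2 * m)" "2 * i + 1 = Suc (2 * i)" using m by auto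
  have ne: "Suc (2 * x) \<noteq> 2 * y" "2 * y \<noteq> Suc (2 * x)" for x y :: nat by presburger+
  show ?thesis unfolding pos
  proof (rule rel_eqI_parity, goal_cases)
    case (1 a b)
    have "gap (glue i (Suc i) r) a b \<longleftrightarrow> (a = i \<and> b = i) \<or> (a \<noteq> i \<and> b \<noteq> i \<and> gap r a b)"
      using gap_glueD[OF _ ii] gap_glueI[of r a b i] gap_refl[of _ i] by metis
    then show ?case using i(2) by (auto simp: glue_iff isolate_iff mem_region ne)
  next
    case (2 a b)
    show ?case by (simp add: isolate_iff mem_region mem_region_odd[OF g] mem_region_odd[OF r] ne glue_iff m[symmetric])
  next
    case (3 a b)
    show ?case by (simp add: isolate_iff mem_region ne glue_iff)
  next
    case (4 a b)
    show ?case by (simp add: isolate_iff mem_region ne glue_iff)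
  qed
qed

text \<open>The generator \<open>e j\<close> at an odd position \<open>j\<close>; the rule on regions is that of the even case.\<close>
lemma region_isolate:
  assumes r: "r \<in> nc_rels k" and i: "1 \<le> i" "i \<le> k"
  shows "region k (isolate i r) =
    glue (2 * i - 2) (2 * i) (isolate (2 * i - 1) (region k r))"
proof -
  obtain m where m: "i = Suc m" using i by (cases i) auto
  have q: "equiv {1..k} r" using nc_relsD[OF r] by simp
  have g: "equiv {1..k} (isolate i r)" using q i by (intro equiv_isolate) auto
  have pos: "2 * i - 1 = Suc (2 * m)" "2 * i - 2 = 2 * m" using m by auto
  have ne: "Suc (2 * x) \<noteq> 2 * y" "2 * y \<noteq> Suc (2 * x)" for x y :: nat by presburger+
  show ?thesis unfolding pos
  proof (rule rel_eqI_parity, goal_cases)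
    case (1 a b)
    have "gap (isolate i r) a b \<longleftrightarrow> gap r a b \<or> gap r m a \<and> gap r i b \<or> gap r i a \<and> gap r m b"
    proof
      assume "gap (isolate i r) a b"
      from gap_isolateD[OF r i(1) this] show "gap r a b \<or> gap r m a \<and> gap r i b \<or> gap r i a \<and> gap r m b"
        using gap_sym m by auto
    next
      assume "gap r a b \<or> gap r m a \<and> gap r i b \<or> gap r i a \<and> gap r m b"
      moreover have "gap (isolate i r) m i" using m gap_isolate_self by simp
      ultimately show "gap (isolate i r) a b"
        using gap_isolate_mono[of r _ _ i] gap_sym gap_trans by meson
    qed
    moreover have "m \<le> k" using i m by simp
    ultimately show ?case using i(2) by (auto simp: glue_iff isolate_iff mem_region ne)
  next
    case (2 a b)
    have im: "Suc x = i \<longleftrightarrow> x = m" "i = Suc x \<longleftrightarrow> x = m" for x using m by auto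
    show ?case
      by (auto simp: im isolate_iff mem_region mem_region_odd[OF g] mem_region_odd[OF q] ne glue_iff)
  next
    case (3 a b)
    show ?case by (simp add: isolate_iff mem_region ne glue_iff)
  next
    case (4 a b)
    show ?case by (simp add: isolate_iff mem_region ne glue_iff)
  qed
qed

text \<open>The arc that leaves point \<open>i\<close> on the right ends at the next point \<open>c\<close> of the block if there is one, and
otherwise at the first point \<open>c\<close>. In both cases places \<open>i\<close> and \<open>c - 1\<close> are on the same side of it.\<close>
lemma gap_right_of:
  assumes r: "r \<in> nc_rels k" and i: "1 \<le> i" "i \<le> k"
  obtains c where "(i, c) \<in> r" "i < c" "gap r i (c - 1)"
  | c where "(i, c) \<in> r" "c \<le> i" "gap r (c - 1) i" "\<And>w. (i, w) \<in> r \<Longrightarrow> c \<le> w \<and> w \<le> i"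
proof (cases "\<exists>c>i. (i, c) \<in> r")
  case True
  define c where "c = (LEAST c. i < c \<and> (i, c) \<in> r)"
  have c: "i < c \<and> (i, c) \<in> r" unfolding c_def by (rule LeastI_ex) (use True in blast)
  have "gap r i (c - 1)"
  proof (rule gap_next[OF r])
    fix w assume "i < w" "w < c"
    then show "(i, w) \<notin> r" using not_less_Least[of w "\<lambda>c. i < c \<and> (i, c) \<in> r"] c_def by blast
  qed (use c in auto)
  then show ?thesis using c that(1) by blast
next
  case False
  have q: "equiv {1..k} r" using nc_relsD[OF r] by blast
  define c where "c = (LEAST c. (i, c) \<in> r)"
  have ii: "(i, i) \<in> r" using equiv_reflD[OF q] i by simp
  have c: "(i, c) \<in> r" unfolding c_def using ii by (rule LeastI)
  have mn: "c \<le> w" if "(i, w) \<in> r" for w unfolding c_def using that by (rule Least_le)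
  have mx: "w \<le> i" if "(i, w) \<in> r" for w using False that by (meson not_le)
  have "gap r (c - 1) i"
    by (rule gap_block[OF r]) (use c mn mx equiv_symD[OF q] in blast)+
  then show ?thesis using that(2) c mn mx by blast
qed

lemma even_region: "(u, v) \<in> region k r \<Longrightarrow> even u = even v"
  by (simp add: region_def)

lemma not_gap_joined:
  assumes r: "equiv {1..k} r" and i: "(i, Suc i) \<in> r" and g: "gap r i b"
  shows "b = i"
proof -
  have "(i, i) \<in> r" "(Suc i, Suc i) \<in> r"
    using equiv_reflD[OF r] equiv_fieldD[OF r i] by blast+
  then show ?thesis using gap_glueD(2)[of i r i b] glue_idem[OF r i] g by simp
qed

text \<open>A region that meets the line at \<open>j\<close> only is bounded by a single arc, and the positions \<open>j - 1\<close> and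
\<open>j + 1\<close> see the other side of that arc. Conversely, if they see the same region, this region encloses
position \<open>j\<close>.\<close>
lemma region_alone_iff:
  assumes r: "r \<in> nc_rels k" and j: "1 \<le> j" "j < 2 * k"
  shows "region k r `` {j} = {j} \<longleftrightarrow> (j - 1, j + 1) \<in> region k r"
proof (cases "even j")
  case True
  have q: "equiv {1..k} r" using nc_relsD[OF r] by blast
  obtain m where m: "j = 2 * Suc m" using True j by (metis evenE mult_0_right not0_implies_Suc not_one_le_zero)
  define i where "i = Suc m"
  have i: "1 \<le> i" "i < k" "j = 2 * i" "i \<le> k" using m j i_def by auto
  have jj: "j - 1 = Suc (2 * m)" "j + 1 = Suc (2 * i)" using m i_def by auto
  have ii: "(2 * i, 2 * i) \<in> region k r" using i by (simp add: mem_region_even gap_refl)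
  have "(i, Suc i) \<in> r" if s: "region k r `` {j} = {j}"
    using r i(1,4)
  proof (cases rule: gap_right_of)
    case (1 c)
    then have "c - 1 \<le> k" "c \<le> k" using equiv_fieldD[OF q 1(1)] by auto
    then have "(2 * i, 2 * (c - 1)) \<in> region k r" using 1 i by (simp add: mem_region_even)
    then have "2 * (c - 1) = 2 * i" using s i by blast
    then show ?thesis using 1 by (cases c) auto
  next
    case (2 c)
    have "c - 1 \<le> k" using 2(2) i(2) by simp
    then have "(2 * i, 2 * (c - 1)) \<in> region k r"
      using i(3,4) gap_sym[OF 2(3)] by (simp add: mem_region_even)
    then have "2 * (c - 1) = 2 * i" using s i by blast
    then show ?thesis using 2 i by auto
  qed
  moreover have "region k r `` {j} = {j}" if s: "(i, Suc i) \<in> r"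
  proof -
    have "v = 2 * i" if "(2 * i, v) \<in> region k r" for v
    proof -
      have "even v" using even_region[OF that] by simp
      then obtain b where "v = 2 * b" by blast
      then show ?thesis using that not_gap_joined[OF q s] by (simp add: mem_region_even)
    qed
    then show ?thesis using ii i by blast
  qed
  ultimately show ?thesis unfolding jj using mem_region_odd[OF q, of m i] i_def by simp blast
next
  case False
  have q: "equiv {1..k} r" using nc_relsD[OF r] by blast
  obtain m where m: "j = Suc (2 * m)" using False by (metis oddE Suc_eq_plus1)
  have mk: "m < k" using j m by simp
  have jj: "j - 1 = 2 * m" "j + 1 = 2 * (Suc m)" using m by auto
  have mm: "(Suc m, Suc m) \<in> r" using mk equiv_reflD[OF q] by simp
  have "region k r `` {j} = {j} \<longleftrightarrow> (\<forall>w. (Suc m, w) \<in> r \<longrightarrow> w = Suc m)"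
  proof
    assume s: "region k r `` {j} = {j}"
    show "\<forall>w. (Suc m, w) \<in> r \<longrightarrow> w = Suc m"
    proof (intro allI impI)
      fix w assume w: "(Suc m, w) \<in> r"
      then obtain w' where w': "w = Suc w'" using equiv_fieldD[OF q w] by (cases w) auto
      then have "(j, Suc (2 * w')) \<in> region k r" unfolding m using w by (simp add: mem_region_odd[OF q])
      then have "Suc (2 * w') = j" using s by blast
      then show "w = Suc m" using m w' by simp
    qed
  next
    assume s: "\<forall>w. (Suc m, w) \<in> r \<longrightarrow> w = Suc m"
    have "v = j" if "(j, v) \<in> region k r" for v
    proof -
      have "odd v" using even_region[OF that] m by simp
      then obtain b where b: "v = Suc (2 * b)" by (metis oddE Suc_eq_plus1)
      then have "(Suc m, Suc b) \<in> r" using that unfolding m by (simp add: mem_region_odd[OF q])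
      then have "Suc b = Suc m" using s by blast
      then show ?thesis using b m by simp
    qed
    moreover have "(j, j) \<in> region k r" unfolding m using mm by (simp add: mem_region_odd[OF q])
    ultimately show "region k r `` {j} = {j}" by blast
  qed
  also have "\<dots> \<longleftrightarrow> gap r m (Suc m)" by (rule gap_single_iff[OF q, symmetric])
  also have "\<dots> \<longleftrightarrow> (j - 1, j + 1) \<in> region k r"
    unfolding jj mem_region_even using mk by simp
  finally show ?thesis .
qed

text \<open>Follow an arc that bounds the region of \<open>j\<close> from its end next to position \<open>j\<close> to its other end. There the region
of \<open>j\<close> is seen at some position \<open>c\<close>, and at the neighbouring position \<open>d\<close> one sees the region across
the arc, which is that of \<open>j - 1\<close> or \<open>j + 1\<close>.\<close>
lemma region_neighbour:
  assumes r: "r \<in> nc_rels k" and j: "1 \<le> j" "j < 2 * k" and ns: "region k r `` {j} \<noteq> {j}"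
  obtains c where "(j, c) \<in> region k r" "c \<noteq> j"
    "\<exists>d. (c = Suc d \<or> d = Suc c) \<and> ((j - 1, d) \<in> region k r \<or> (j + 1, d) \<in> region k r)"
proof (cases "even j")
  case True
  have q: "equiv {1..k} r" using nc_relsD[OF r] by blast
  obtain m where m: "j = 2 * Suc m" using True j by (metis evenE mult_0_right not0_implies_Suc not_one_le_zero)
  define i where "i = Suc m"
  have i: "1 \<le> i" "i < k" "j = 2 * i" "i \<le> k" using m j i_def by auto
  have jj: "j - 1 = Suc (2 * m)" "j + 1 = Suc (2 * i)" using m i_def by auto
  have "(i, Suc i) \<notin> r"
    using ns region_alone_iff[OF r j] unfolding jj mem_region_odd[OF q] i_def by blast
  have "\<exists>c. (i, Suc c) \<in> r \<and> gap r i c \<and> c \<noteq> i"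
    using r i(1,4)
  proof (cases rule: gap_right_of)
    case (1 c)
    then show ?thesis using \<open>(i, Suc i) \<notin> r\<close> by (intro exI[of _ "c - 1"]) (cases c; auto)
  next
    case (2 c)
    then have "1 \<le> c" using equiv_fieldD[OF q] by fastforce
    then show ?thesis using 2(1,2) gap_sym[OF 2(3)] by (intro exI[of _ "c - 1"]) (cases c; auto)
  qed
  then obtain c where c: "(i, Suc c) \<in> r" "gap r i c" "c \<noteq> i" by blast
  have "c \<le> k" using equiv_fieldD[OF q c(1)] by auto
  show ?thesis
  proof (rule that)
    show "(j, 2 * c) \<in> region k r" using c i \<open>c \<le> k\<close> by (simp add: mem_region_even)
    show "2 * c \<noteq> j" using c i by simp
    have "(j - 1, Suc (2 * c)) \<in> region k r"
      unfolding jj using c(1) i_def by (simp add: mem_region_odd[OF q])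
    then show "\<exists>d. (2 * c = Suc d \<or> d = Suc (2 * c)) \<and>
        ((j - 1, d) \<in> region k r \<or> (j + 1, d) \<in> region k r)" by blast
  qed
next
  case False
  have q: "equiv {1..k} r" using nc_relsD[OF r] by blast
  obtain m where m: "j = Suc (2 * m)" using False by (metis oddE Suc_eq_plus1)
  have mk: "1 \<le> Suc m" "Suc m \<le> k" using j m by simp_all
  have jj: "j - 1 = 2 * m" "j + 1 = 2 * (Suc m)" using m by auto
  have ng: "\<not> gap r m (Suc m)"
    using ns region_alone_iff[OF r j] mk unfolding jj mem_region_even by simp
  have "\<exists>c. (Suc m, Suc c) \<in> r \<and> gap r (Suc m) c \<and> c \<noteq> m"
    using r mk
  proof (cases rule: gap_right_of)
    case (1 c)
    then show ?thesis by (intro exI[of _ "c - 1"]) (cases c; auto)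
  next
    case (2 c)
    then have "1 \<le> c" using equiv_fieldD[OF q] by fastforce
    then show ?thesis using 2(1,2) gap_sym[OF 2(3)] ng gap_sym by (intro exI[of _ "c - 1"]) (cases c; auto)
  qed
  then obtain c where c: "(Suc m, Suc c) \<in> r" "gap r (Suc m) c" "c \<noteq> m" by blast
  have "c \<le> k" using equiv_fieldD[OF q c(1)] by auto
  show ?thesis
  proof (rule that)
    show "(j, Suc (2 * c)) \<in> region k r" unfolding m using c by (simp add: mem_region_odd[OF q])
    show "Suc (2 * c) \<noteq> j" using c m by simp
    have "(j + 1, 2 * c) \<in> region k r"
      unfolding jj mem_region_even using c(2) mk \<open>c \<le> k\<close> by simp
    then show "\<exists>d. (Suc (2 * c) = Suc d \<or> d = Suc (Suc (2 * c))) \<and>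
        ((j - 1, d) \<in> region k r \<or> (j + 1, d) \<in> region k r)" by blast
  qed
qed

section \<open>Walks and the path representation of the generators\<close>

text \<open>A walk of length \<open>m\<close> is frozen at its last height \<open>e\<close>, so that it is represented by one function only.\<close>
definition walks :: "nat \<Rightarrow> nat \<Rightarrow> (nat \<Rightarrow> nat) set"
  where "walks m e = {h. h 0 = 0 \<and> (\<forall>j\<ge>m. h j = e) \<and>
    (\<forall>j<m. h (Suc j) = Suc (h j) \<or> h j = Suc (h (Suc j)))}"

lemma walk_step: "h \<in> walks m e \<Longrightarrow> j < m \<Longrightarrow> h (Suc j) = Suc (h j) \<or> h j = Suc (h (Suc j))"
  by (simp add: walks_def)

lemma walks_le: "h \<in> walks m e \<Longrightarrow> j \<le> m \<Longrightarrow> h j \<le> j"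
proof (induction j)
  case (Suc j)
  then have "h (Suc j) = Suc (h j) \<or> h j = Suc (h (Suc j))" by (simp add: walks_def)
  then show ?case using Suc by auto
qed (simp add: walks_def)

lemma finite_walks: "finite (walks m e)"
proof -
  have "walks m e \<subseteq> {h. \<forall>j. (j \<in> {..m} \<longrightarrow> h j \<in> {..m}) \<and> (j \<notin> {..m} \<longrightarrow> h j = e)}"
  proof
    fix h assume h: "h \<in> walks m e"
    have "h j \<le> m" if "j \<le> m" for j using walks_le[OF h that] that by simp
    moreover have "h j = e" if "\<not> j \<le> m" for j using h that by (simp add: walks_def)
    ultimately show "h \<in> {h. \<forall>j. (j \<in> {..m} \<longrightarrow> h j \<in> {..m}) \<and> (j \<notin> {..m} \<longrightarrow> h j = e)}"
      by simp
  qed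
  moreover have "finite {h. \<forall>j. (j \<in> {..m} \<longrightarrow> h j \<in> {..m}) \<and> (j \<notin> {..m} \<longrightarrow> h j = e)}"
    by (rule finite_set_of_finite_funs) simp_all
  ultimately show ?thesis by (rule finite_subset)
qed

lemma walk_update_iff:
  assumes h: "h \<in> walks m e" and j: "1 \<le> j" "j < m" and a: "h (j - 1) = a" "h (Suc j) = a"
  shows "h(j := t) \<in> walks m e \<longleftrightarrow> t = Suc a \<or> a = Suc t"
proof
  assume "h(j := t) \<in> walks m e"
  then have "(h(j := t)) (Suc j) = Suc ((h(j := t)) j) \<or> (h(j := t)) j = Suc ((h(j := t)) (Suc j))"
    using j by (auto simp: walks_def)
  then show "t = Suc a \<or> a = Suc t" using a by auto
next
  assume t: "t = Suc a \<or> a = Suc t"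
  have "(h(j := t)) (Suc i) = Suc ((h(j := t)) i) \<or> (h(j := t)) i = Suc ((h(j := t)) (Suc i))"
    if "i < m" for i
  proof -
    consider "i = j" | "Suc i = j" | "i \<noteq> j" "Suc i \<noteq> j" by blast
    then show ?thesis using t a j h that by cases (auto simp: walks_def)
  qed
  then show "h(j := t) \<in> walks m e" using h j by (auto simp: walks_def)
qed

text \<open>The values \<open>P r\<close> of the Chebyshev polynomials at a point \<open>x\<close> where none of them vanishes.\<close>
locale cheb_values =
  fixes P :: "nat \<Rightarrow> 'a::field" and x :: 'a
  assumes P_0: "P 0 = 1" and P_1: "P (Suc 0) = x"
    and P_rec: "\<And>n. P (Suc (Suc n)) = x * P (Suc n) - P n"
    and P_nz: "\<And>n. P n \<noteq> 0"
begin

text \<open>In the orthogonal path representation of the Temperley-Lieb algebra an arc between an inner region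
of height \<open>a\<close> and an outer region of height \<open>b\<close> has the factor \<open>\<surd>(P a / P b)\<close>. Multiplication by
\<open>\<surd>(P (h j))\<close> for all positions \<open>j\<close> collects these factors into one factor \<open>P a\<close> for every region, and
the square of the multiplier is cancelled by the weight \<open>wt\<close>. In this normalization no square roots
remain.\<close>
definition amp :: "nat \<Rightarrow> nat rel \<Rightarrow> (nat \<Rightarrow> nat) \<Rightarrow> 'a"
  where "amp k R h = (if h respects R then class_prod {..2 * k} R (P \<circ> h) else 0)"

definition wt :: "nat \<Rightarrow> (nat \<Rightarrow> nat) \<Rightarrow> 'a"
  where "wt k h = (\<Prod>j\<le>2 * k. inverse (P (h j)))"

text \<open>The generator \<open>e j\<close> in the path representation.\<close>
definition arc_op :: "nat \<Rightarrow> ((nat \<Rightarrow> nat) \<Rightarrow> 'a) \<Rightarrow> (nat \<Rightarrow> nat) \<Rightarrow> 'a"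
  where "arc_op j \<psi> h = (if h (j - 1) = h (Suc j)
    then P (h j) / P (h (j - 1)) * (\<Sum>t | t = Suc (h (j - 1)) \<or> h (j - 1) = Suc t. \<psi> (h(j := t)))
    else 0)"

lemma x_nz: "x \<noteq> 0" using P_nz[of "Suc 0"] P_1 by simp

text \<open>The value of a closed loop. The index set lacks the neighbour below \<open>a = 0\<close>, in accordance with
\<open>P (-1) = 0\<close>.\<close>
lemma sum_neighbours: "(\<Sum>t | t = Suc a \<or> a = Suc t. P t) = x * P a"
proof (cases a)
  case 0
  then have "{t. t = Suc a \<or> a = Suc t} = {1}" by auto
  then show ?thesis using 0 P_0 P_1 by simp
next
  case (Suc b)
  then have "{t. t = Suc a \<or> a = Suc t} = {Suc (Suc b), b}" by auto
  then show ?thesis using Suc P_rec[of b] by simp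
qed

lemma arc_op_sum:
  assumes h: "h \<in> walks m e" and j: "1 \<le> j" "j < m"
  shows "arc_op j \<psi> h = (\<Sum>h'\<in>walks m e. if h (j - 1) = h (Suc j) \<and> (\<forall>i. i \<noteq> j \<longrightarrow> h' i = h i)
    then P (h j) / P (h (j - 1)) * \<psi> h' else 0)"
proof (cases "h (j - 1) = h (Suc j)")
  case True
  let ?T = "{t. t = Suc (h (j - 1)) \<or> h (j - 1) = Suc t}"
  have img: "{h' \<in> walks m e. \<forall>i. i \<noteq> j \<longrightarrow> h' i = h i} = (\<lambda>t. h(j := t)) ` ?T"
  proof (intro equalityI subsetI)
    fix h' assume "h' \<in> {h' \<in> walks m e. \<forall>i. i \<noteq> j \<longrightarrow> h' i = h i}"
    then have "h' = h(j := h' j)" "h' \<in> walks m e" by auto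
    then show "h' \<in> (\<lambda>t. h(j := t)) ` ?T"
      using walk_update_iff[OF h j refl True[symmetric], of "h' j"] by force
  next
    fix h' assume "h' \<in> (\<lambda>t. h(j := t)) ` ?T"
    then show "h' \<in> {h' \<in> walks m e. \<forall>i. i \<noteq> j \<longrightarrow> h' i = h i}"
      using walk_update_iff[OF h j refl True[symmetric]] by auto
  qed
  have inj: "inj_on (\<lambda>t. h(j := t)) ?T" by (rule inj_onI) (metis fun_upd_same)
  have "(\<Sum>h'\<in>walks m e. if h (j - 1) = h (Suc j) \<and> (\<forall>i. i \<noteq> j \<longrightarrow> h' i = h i)
      then P (h j) / P (h (j - 1)) * \<psi> h' else 0)
    = (\<Sum>h'\<in>{h' \<in> walks m e. \<forall>i. i \<noteq> j \<longrightarrow> h' i = h i}. P (h j) / P (h (j - 1)) * \<psi> h')"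
    using True by (subst sum.inter_filter[OF finite_walks]) simp
  also have "\<dots> = arc_op j \<psi> h"
    unfolding img sum.reindex[OF inj] arc_op_def using True by (simp add: sum_distrib_left)
  finally show ?thesis by simp
qed (simp add: arc_op_def)

lemma wt_update:
  assumes "\<And>i. i \<noteq> j \<Longrightarrow> h' i = h i" "j \<le> 2 * k"
  shows "wt k h' * P (h' j) = wt k h * P (h j)"
proof -
  have "wt k g * P (g j) = (\<Prod>i\<in>{..2 * k} - {j}. inverse (P (g i)))" for g
    unfolding wt_def by (subst prod.remove[of _ j]) (use assms(2) P_nz in auto)
  then show ?thesis using assms(1) by simp
qed

text \<open>Up to the factor \<open>1 / P (h (j - 1))\<close> the kernel of \<open>wt k h * arc_op j\<close> is \<open>wt k h * P (h j)\<close> on pairs of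
walks that differ at most at \<open>j\<close>. Neither factor depends on the height at \<open>j\<close>, so the kernel is
symmetric.\<close>
lemma arc_op_adjoint:
  assumes j: "1 \<le> j" "j < 2 * k"
  shows "(\<Sum>h\<in>walks (2 * k) 0. wt k h * arc_op j \<psi> h * \<phi> h) =
    (\<Sum>h\<in>walks (2 * k) 0. wt k h * \<psi> h * arc_op j \<phi> h)"
proof -
  let ?W = "walks (2 * k) 0"
  \<comment> \<open>the kernel of \<open>wt k h * arc_op j\<close>\<close>
  define K where "K h h' = (if h (j - 1) = h (Suc j) \<and> (\<forall>i. i \<noteq> j \<longrightarrow> h' i = h i)
    then wt k h * P (h j) / P (h (j - 1)) else 0)" for h h'
  have sym: "K h h' = K h' h" for h h'
  proof (cases "h (j - 1) = h (Suc j) \<and> (\<forall>i. i \<noteq> j \<longrightarrow> h' i = h i)")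
    case True
    then have e: "h' (j - 1) = h (j - 1)" "h' (Suc j) = h (Suc j)" "\<forall>i. i \<noteq> j \<longrightarrow> h i = h' i"
      using j by auto
    have c: "h' (j - 1) = h' (Suc j) \<and> (\<forall>i. i \<noteq> j \<longrightarrow> h i = h' i)"
      using True e(1,2) e(3) by argo
    have "wt k h' * P (h' j) = wt k h * P (h j)"
      using wt_update[of j h' h k] True j by simp
    moreover have "K h h' = wt k h * P (h j) / P (h (j - 1))" by (simp only: K_def if_P[OF True])
    moreover have "K h' h = wt k h' * P (h' j) / P (h' (j - 1))" by (simp only: K_def if_P[OF c])
    ultimately show ?thesis by (simp only: e(1))
  next
    case False
    have "\<not> (h' (j - 1) = h' (Suc j) \<and> (\<forall>i. i \<noteq> j \<longrightarrow> h i = h' i))"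
    proof
      assume *: "h' (j - 1) = h' (Suc j) \<and> (\<forall>i. i \<noteq> j \<longrightarrow> h i = h' i)"
      then have "h (j - 1) = h' (j - 1)" "h (Suc j) = h' (Suc j)" using j by auto
      then show False using False * by metis
    qed
    then show ?thesis unfolding K_def if_not_P[OF False] by (rule if_not_P[symmetric])
  qed
  have E: "wt k h * arc_op j \<psi> h = (\<Sum>h'\<in>?W. K h h' * \<psi> h')" if "h \<in> ?W" for h \<psi>
    unfolding arc_op_sum[OF that j] K_def sum_distrib_left by (rule sum.cong) auto
  have "(\<Sum>h\<in>?W. wt k h * arc_op j \<psi> h * \<phi> h) = (\<Sum>h\<in>?W. \<Sum>h'\<in>?W. K h h' * \<psi> h' * \<phi> h)"
    using E by (intro sum.cong) (auto simp: sum_distrib_right)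
  also have "\<dots> = (\<Sum>h'\<in>?W. \<Sum>h\<in>?W. K h' h * \<phi> h * \<psi> h')"
    by (subst sum.swap) (simp add: sym mult_ac)
  also have "\<dots> = (\<Sum>h\<in>?W. wt k h * arc_op j \<phi> h * \<psi> h)"
    using E by (intro sum.cong) (auto simp: sum_distrib_right)
  finally show ?thesis by (simp add: mult_ac)
qed

text \<open>If position \<open>j\<close> is alone in its region, the sum over its height is a closed loop. Otherwise the height
at \<open>j\<close> is forced by another position \<open>c\<close> of the region, and one term survives. That the forced height
is adjacent to the height at \<open>j - 1\<close> and \<open>j + 1\<close>, so that the surviving walk is admissible, is the
content of \<open>region_neighbour\<close>.\<close>
lemma arc_op_amp:
  assumes r: "r \<in> nc_rels k" and j: "1 \<le> j" "j < 2 * k" and h: "h \<in> walks (2 * k) 0"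
  shows "arc_op j (amp k (region k r)) h = (if region k r `` {j} = {j} then x else 1) *
    amp k (glue (j - 1) (Suc j) (isolate j (region k r))) h"
proof -
  let ?A = "{..2 * k}"
  define R where "R = region k r"
  define S where "S = isolate j R"
  define a where "a = h (j - 1)"
  have R: "equiv ?A R" unfolding R_def using equiv_region nc_relsD[OF r] by blast
  have A: "j \<in> ?A" "j - 1 \<in> ?A" "Suc j \<in> ?A" using j by auto
  have S: "equiv ?A S" unfolding S_def by (rule equiv_isolate[OF R A(1)])
  have ne: "j - 1 \<noteq> j" using j by auto
  have upd: "P \<circ> h(j := t) = (P \<circ> h)(j := P t)" for t by auto
  show ?thesis
  proof (cases "R `` {j} = {j}")
    case True
    then have pq: "(j - 1, Suc j) \<in> R" using region_alone_iff[OF r j] R_def by simp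
    have same: "glue (j - 1) (Suc j) (isolate j R) = R"
      using isolate_idem[OF R True] glue_idem[OF R pq] by simp
    have resp: "h(j := t) respects R \<longleftrightarrow> h respects R" for t
    proof -
      have "u = j \<longleftrightarrow> v = j" if "(u, v) \<in> R" for u v
        using that True equiv_symD[OF R that] by blast
      then show ?thesis unfolding congruent_def by fastforce
    qed
    have main: "arc_op j (amp k R) h = x * amp k R h"
    proof (cases "h respects R")
      case False
      then show ?thesis by (simp add: arc_op_def amp_def resp)
    next
      case hr: True
      then have hh: "h (Suc j) = a" using pq by (auto simp: congruent_def a_def)
      have "P (h j) * amp k R (h(j := t)) = amp k R h * P t" for t
        using class_prod_singleton[OF _ R A(1) True, of "P \<circ> h" "P t"] hr
        by (simp add: amp_def resp upd mult.commute)
      then have "arc_op j (amp k R) h = (\<Sum>t | t = Suc a \<or> a = Suc t. amp k R h * P t) / P a"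
        unfolding arc_op_def using hh by (simp add: a_def sum_distrib_left flip: sum_divide_distrib)
      also have "\<dots> = amp k R h * (x * P a) / P a"
        using sum_neighbours[of a] by (simp flip: sum_distrib_left)
      finally show ?thesis using P_nz[of a] by simp
    qed
    then show ?thesis using same True by (simp add: R_def)
  next
    case False
    obtain c d where c: "(j, c) \<in> R" "c \<noteq> j" and d: "c = Suc d \<or> d = Suc c"
      "(j - 1, d) \<in> R \<or> (Suc j, d) \<in> R"
      using region_neighbour[OF r j] False R_def by (metis Suc_eq_plus1)
    have pqR: "(j - 1, Suc j) \<notin> R" using region_alone_iff[OF r j] R_def False by simp
    then have pq: "(j - 1, Suc j) \<notin> S" by (simp add: S_def isolate_iff)
    have "(j - 1, d) \<in> R \<Longrightarrow> d \<noteq> j" "(Suc j, d) \<in> R \<Longrightarrow> d \<noteq> j"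
      using even_region[of "j - 1" d k r] even_region[of "Suc j" d k r] j unfolding R_def by auto
    then have dS: "(j - 1, d) \<in> S \<or> (Suc j, d) \<in> S"
      using d(2) ne by (auto simp: S_def isolate_iff)
    have resp_S: "h respects S" if "h(j := t) respects R" for t
      unfolding congruent_def
    proof clarify
      fix u v assume "(u, v) \<in> S"
      then show "h u = h v"
        using that unfolding congruent_def S_def isolate_iff by (cases "u = j") fastforce+
    qed
    have "arc_op j (amp k R) h = amp k (glue (j - 1) (Suc j) S) h"
    proof (cases "h respects glue (j - 1) (Suc j) S")
      case False
      have "amp k R (h(j := t)) = 0" if "h (j - 1) = h (Suc j)" for t
      proof -
        have "\<not> h respects S"
        proof
          assume hS: "h respects S"
          have "h respects glue (j - 1) (Suc j) S"
            using hS \<open>h (j - 1) = h (Suc j)\<close> by (rule respects_glue)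
          then show False using False by simp
        qed
        then show ?thesis using resp_S by (auto simp: amp_def)
      qed
      then show ?thesis using False by (simp add: arc_op_def amp_def)
    next
      case True
      have hS: "h respects S" using True by (auto simp: congruent_def glue_iff)
      have hh: "h (Suc j) = a"
        using True equiv_reflD[OF S A(2)] equiv_reflD[OF S A(3)] by (auto simp: congruent_def glue_iff a_def)
      define t where "t = h c"
      have "h d = a" using dS hS hh by (auto simp: congruent_def a_def)
      have "c \<le> 2 * k" "d \<le> 2 * k" using equiv_fieldD[OF R c(1)] equiv_fieldD[OF R] d by auto
      then have ta: "t = Suc a \<or> a = Suc t"
        using d(1) walk_step[OF h, of c] walk_step[OF h, of d] \<open>h d = a\<close> unfolding t_def by auto
      have cj: "(u, v) \<in> R \<Longrightarrow> u \<noteq> j \<Longrightarrow> v = j \<Longrightarrow> h u = t" for u v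
        using hS c equiv_transD[OF R, of u j c] by (auto simp: congruent_def S_def isolate_iff t_def)
      have hR: "h(j := t) respects R"
        unfolding congruent_def
      proof clarify
        fix u v assume uv: "(u, v) \<in> R"
        show "(h(j := t)) u = (h(j := t)) v"
          using cj[OF uv] cj[OF equiv_symD[OF R uv]] congruentD[OF hS, of u v] uv
          by (cases "u = j"; cases "v = j") (simp_all add: S_def isolate_iff)
      qed
      have only: "amp k R (h(j := s)) = 0" if "s \<noteq> t" for s
      proof -
        have "\<not> h(j := s) respects R"
          using congruentD[of R "h(j := s)" j c] c that by (auto simp: t_def)
        then show ?thesis by (simp add: amp_def)
      qed
      have fin: "finite {t. t = Suc a \<or> a = Suc t}"
        by (rule finite_subset[of _ "{Suc a, a - 1}"]) auto
      have "(\<Sum>s | s = Suc a \<or> a = Suc s. amp k R (h(j := s))) = amp k R (h(j := t))"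
        using only ta by (subst sum.remove[OF fin, of t]) auto
      then have "arc_op j (amp k R) h = P (h j) / P a * amp k R (h(j := t))"
        unfolding arc_op_def using hh by (simp add: a_def)
      also have "amp k R (h(j := t)) = class_prod ?A R (P \<circ> h(j := t))" using hR by (simp add: amp_def)
      also have "P (h j) / P a * \<dots> = class_prod ?A S (P \<circ> h) / P a"
      proof -
        have "(P \<circ> h(j := t)) respects R" using hR by (auto simp: congruent_def)
        from class_prod_isolate[OF _ R c this, of "P (h j)"]
        moreover have "(P \<circ> h)(j := P (h j)) = P \<circ> h" by auto
        ultimately show ?thesis by (simp add: S_def upd)
      qed
      also have "class_prod ?A S (P \<circ> h) = P a * class_prod ?A (glue (j - 1) (Suc j) S) (P \<circ> h)"
      proof -
        have "(P \<circ> h) respects glue (j - 1) (Suc j) S" using True by (auto simp: congruent_def)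
        from class_prod_glue[OF _ S A(2,3) pq this] show ?thesis by (simp add: a_def)
      qed
      finally have "arc_op j (amp k R) h = class_prod ?A (glue (j - 1) (Suc j) S) (P \<circ> h)"
        using P_nz[of a] by simp
      then show ?thesis by (simp only: amp_def[of k "glue (j - 1) (Suc j) S"] if_P[OF True])
    qed
    then show ?thesis using False by (simp add: R_def S_def)
  qed
qed

end

lemma walk_parity: "h \<in> walks m e \<Longrightarrow> j \<le> m \<Longrightarrow> even (h j) = even j"
proof (induction j)
  case (Suc j)
  then show ?case using walk_step[of h m e j] by auto
qed (simp add: walks_def)

lemma walk_eqI:
  assumes g: "g \<in> walks m e" and h: "h \<in> walks m e"
    and up: "\<And>j. j < m \<Longrightarrow> g (Suc j) = Suc (g j) \<longleftrightarrow> h (Suc j) = Suc (h j)"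
  shows "g = h"
proof
  fix j
  show "g j = h j"
  proof (induction j)
    case 0
    then show ?case using g h by (simp add: walks_def)
  next
    case (Suc j)
    show ?case
    proof (cases "j < m")
      case True
      have "g (Suc j) = Suc (g j) \<and> h (Suc j) = Suc (h j) \<or> g j = Suc (g (Suc j)) \<and> h j = Suc (h (Suc j))"
        using up[OF True] walk_step[OF g True] walk_step[OF h True] by blast
      then show ?thesis using Suc by linarith
    next
      case False
      then show ?thesis using g h by (simp add: walks_def)
    qed
  qed
qed

lemma walk_zero_even_unique:
  assumes g: "g \<in> walks m e" "\<And>j. even j \<Longrightarrow> j \<le> m \<Longrightarrow> g j = 0"
    and h: "h \<in> walks m e" "\<And>j. even j \<Longrightarrow> j \<le> m \<Longrightarrow> h j = 0"
  shows "g = h"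
proof (rule walk_eqI[OF g(1) h(1)])
  fix j assume j: "j < m"
  show "g (Suc j) = Suc (g j) \<longleftrightarrow> h (Suc j) = Suc (h j)"
  proof (cases "even j")
    case True
    then show ?thesis using walk_step[OF g(1) j] walk_step[OF h(1) j] g(2)[of j] h(2)[of j] j by auto
  next
    case False
    then have "g (Suc j) = 0" "h (Suc j) = 0" using g(2)[of "Suc j"] h(2)[of "Suc j"] j by auto
    then show ?thesis by simp
  qed
qed

section \<open>The profile of a noncrossing relation\<close>

definition block_min :: "nat rel \<Rightarrow> nat \<Rightarrow> bool"
  where "block_min r i \<longleftrightarrow> (\<forall>u. (u, i) \<in> r \<longrightarrow> i \<le> u)"

definition block_max :: "nat rel \<Rightarrow> nat \<Rightarrow> bool"
  where "block_max r i \<longleftrightarrow> (\<forall>u. (u, i) \<in> r \<longrightarrow> u \<le> i)"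

definition open_after :: "nat rel \<Rightarrow> nat \<Rightarrow> nat set"
  where "open_after r i = {u. block_min r u \<and> u \<le> i \<and> (\<exists>v>i. (u, v) \<in> r)}"

definition around :: "nat rel \<Rightarrow> nat \<Rightarrow> nat set"
  where "around r i = {u. block_min r u \<and> u < i \<and> (u, i) \<notin> r \<and> (\<exists>v>i. (u, v) \<in> r)}"

text \<open>The number of arcs above a position: every block that stretches over it contributes two arcs at
an even position, and so does every foreign block at an odd position, where the block of the point
itself contributes one more. Blocks are represented by their least points.\<close>
definition profile :: "nat \<Rightarrow> nat rel \<Rightarrow> nat \<Rightarrow> nat"
  where "profile k r j = (if 2 * k \<le> j then 0 else if even j then 2 * card (open_after r (j div 2))
    else 2 * card (around r (Suc (j div 2))) + 1)"

lemma finite_around: "finite (around r i)"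
  by (rule finite_subset[of _ "{..<i}"]) (auto simp: around_def)

lemma finite_open_after: "finite (open_after r i)"
  by (rule finite_subset[of _ "{..i}"]) (auto simp: open_after_def)

lemma obtain_block_min:
  assumes r: "equiv A r" and "i \<in> A"
  obtains m where "(m, i) \<in> r" "block_min r m"
proof
  let ?m = "LEAST m. (m, i) \<in> r"
  show m: "(?m, i) \<in> r" by (rule LeastI[of _ i]) (rule equiv_reflD[OF assms])
  show "block_min r ?m" unfolding block_min_def
    using equiv_transD[OF r _ m] by (blast intro: Least_le)
qed

lemma block_min_unique:
  assumes "equiv A r" "block_min r m" "block_min r n" "(m, n) \<in> r"
  shows "m = n"
  using assms equiv_symD[OF assms(1)] unfolding block_min_def by (meson le_antisym)

lemma open_after_eq:
  assumes r: "equiv A r" and m: "(m, i) \<in> r" "block_min r m"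
  shows "open_after r i = around r i \<union> (if block_max r i then {} else {m})"
proof -
  note S = equiv_symD[OF r] and T = equiv_transD[OF r]
  have "u \<in> open_after r i \<longleftrightarrow> u \<in> around r i \<or> \<not> block_max r i \<and> u = m" for u
  proof (cases "(u, i) \<in> r")
    case True
    have "u \<in> open_after r i \<longleftrightarrow> \<not> block_max r i \<and> u = m"
    proof
      assume u: "u \<in> open_after r i"
      then obtain v where v: "v > i" "(u, v) \<in> r" by (auto simp: open_after_def)
      then have "(v, i) \<in> r" using S T True by blast
      then have "\<not> block_max r i" using v by (auto simp: block_max_def not_le)
      moreover have "u = m"
        using block_min_unique[OF r _ m(2) T[OF True S[OF m(1)]]] u by (simp add: open_after_def)
      ultimately show "\<not> block_max r i \<and> u = m" by simp
    next
      assume u: "\<not> block_max r i \<and> u = m"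
      then obtain v where v: "v > i" "(v, i) \<in> r" by (auto simp: block_max_def not_le)
      then have "(m, v) \<in> r" using S T m by blast
      moreover have "m \<le> i" using m S by (auto simp: block_min_def)
      ultimately show "u \<in> open_after r i" using u v m by (auto simp: open_after_def)
    qed
    then show ?thesis using True by (auto simp: around_def)
  next
    case False
    then have "u \<noteq> m" "u \<noteq> i" using m equiv_reflD[OF r] equiv_fieldD[OF r m(1)] by auto
    then show ?thesis using False by (auto simp: open_after_def around_def)
  qed
  then show ?thesis by auto
qed

lemma open_before_eq:
  assumes r: "equiv A r" and m: "(m, i) \<in> r" "block_min r m" and i: "1 \<le> i"
  shows "open_after r (i - 1) = around r i \<union> (if block_min r i then {} else {m})"
proof -
  note S = equiv_symD[OF r] and T = equiv_transD[OF r]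
  have "u \<in> open_after r (i - 1) \<longleftrightarrow> u \<in> around r i \<or> \<not> block_min r i \<and> u = m" for u
  proof (cases "(u, i) \<in> r")
    case True
    have mi: "m \<le> i" using m S by (auto simp: block_min_def)
    have "u \<in> open_after r (i - 1) \<longleftrightarrow> \<not> block_min r i \<and> u = m"
    proof
      assume u: "u \<in> open_after r (i - 1)"
      have "u = m"
        using block_min_unique[OF r _ m(2) T[OF True S[OF m(1)]]] u by (simp add: open_after_def)
      moreover have "u < i" using u i by (auto simp: open_after_def)
      ultimately show "\<not> block_min r i \<and> u = m" using True by (auto simp: block_min_def not_le)
    next
      assume u: "\<not> block_min r i \<and> u = m"
      then have "m \<noteq> i" using m by auto
      then have "m \<le> i - 1" using mi by simp
      moreover have "i - 1 < i" using i by simp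
      ultimately show "u \<in> open_after r (i - 1)" using u m by (auto simp: open_after_def)
    qed
    then show ?thesis using True by (auto simp: around_def)
  next
    case False
    then have "u \<noteq> m" using m by auto
    moreover have "u \<le> i - 1 \<longleftrightarrow> u < i" using i by auto
    moreover have "(\<exists>v>i - 1. (u, v) \<in> r) \<longleftrightarrow> (\<exists>v>i. (u, v) \<in> r)"
    proof
      assume "\<exists>v>i - 1. (u, v) \<in> r"
      then obtain v where v: "v > i - 1" "(u, v) \<in> r" by blast
      moreover have "v \<noteq> i" using False v by blast
      ultimately show "\<exists>v>i. (u, v) \<in> r" using i by (intro exI[of _ v]) auto
    next
      assume "\<exists>v>i. (u, v) \<in> r"
      then show "\<exists>v>i - 1. (u, v) \<in> r" by (meson le_less_trans diff_le_self)
    qed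
    ultimately show ?thesis using False by (auto simp: open_after_def around_def)
  qed
  then show ?thesis by auto
qed

lemma profile_odd: "1 \<le> i \<Longrightarrow> i \<le> k \<Longrightarrow> profile k r (2 * i - 1) = 2 * card (around r i) + 1"
  by (cases i) (auto simp: profile_def)

lemma open_after_top: "equiv {1..k} r \<Longrightarrow> k \<le> i \<Longrightarrow> open_after r i = {}"
  using equiv_fieldD[of "{1..k}" r] by (fastforce simp: open_after_def)

lemma profile_even: "equiv {1..k} r \<Longrightarrow> profile k r (2 * i) = 2 * card (open_after r i)"
  by (cases "k \<le> i") (auto simp: profile_def open_after_top)

lemma profile_after:
  assumes r: "equiv {1..k} r" and i: "1 \<le> i" "i \<le> k"
  shows "profile k r (2 * i) = profile k r (2 * i - 1) - 1 + (if block_max r i then 0 else 2)"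
proof -
  obtain m where m: "(m, i) \<in> r" "block_min r m" using obtain_block_min[OF r, of i] i by auto
  have "m \<notin> around r i" using m by (auto simp: around_def)
  then show ?thesis
    unfolding profile_even[OF r] profile_odd[OF i] open_after_eq[OF r m]
    using finite_around[of r i] by simp
qed

lemma profile_before:
  assumes r: "equiv {1..k} r" and i: "1 \<le> i" "i \<le> k"
  shows "profile k r (2 * i - 2) = profile k r (2 * i - 1) - 1 + (if block_min r i then 0 else 2)"
proof -
  obtain m where m: "(m, i) \<in> r" "block_min r m" using obtain_block_min[OF r, of i] i by auto
  have "m \<notin> around r i" using m by (auto simp: around_def)
  moreover have "2 * i - 2 = 2 * (i - 1)" by simp
  ultimately show ?thesis
    unfolding profile_odd[OF i] using profile_even[OF r, of "i - 1"] open_before_eq[OF r m i(1)]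
      finite_around[of r i] by simp
qed

lemma profile_odd_pos: "1 \<le> i \<Longrightarrow> i \<le> k \<Longrightarrow> 1 \<le> profile k r (2 * i - 1)"
  unfolding profile_odd by simp

text \<open>Steps come in pairs: for each point \<open>i\<close> one step into and one step out of position \<open>2 i - 1\<close>.\<close>
lemma position_cases:
  assumes "(j::nat) < 2 * k"
  obtains i where "1 \<le> i" "i \<le> k" "j = 2 * i - 2" "Suc j = 2 * i - 1"
  | i where "1 \<le> i" "i \<le> k" "j = 2 * i - 1" "Suc j = 2 * i"
proof (cases "even j")
  case True
  then obtain a where "j = 2 * a" by blast
  then show ?thesis using assms by (intro that(1)[of "Suc a"]) auto
next
  case False
  then obtain a where "j = 2 * a + 1" by (rule oddE)
  then show ?thesis using assms by (intro that(2)[of "Suc a"]) auto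
qed

lemma profile_in_walks:
  assumes r: "equiv {1..k} r"
  shows "profile k r \<in> walks (2 * k) 0"
proof -
  have "profile k r (Suc j) = Suc (profile k r j) \<or> profile k r j = Suc (profile k r (Suc j))"
    if "j < 2 * k" for j
    using that
  proof (cases rule: position_cases)
    case (1 i)
    then show ?thesis
      using profile_before[OF r 1(1,2)] profile_odd_pos[OF 1(1,2), of r] by (auto split: if_splits)
  next
    case (2 i)
    then show ?thesis
      using profile_after[OF r 2(1,2)] profile_odd_pos[OF 2(1,2), of r] by (auto split: if_splits)
  qed
  moreover have "profile k r 0 = 0"
  proof -
    have "open_after r 0 = {}" using equiv_fieldD[OF r] by (fastforce simp: open_after_def)
    then show ?thesis using profile_even[OF r, of 0] by simp
  qed
  ultimately show ?thesis by (simp add: walks_def profile_def)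
qed

text \<open>A block above one point of a block lies above all of it.\<close>
lemma around_subset:
  assumes r: "r \<in> nc_rels k" and ij: "(i, j) \<in> r"
  shows "around r i \<subseteq> around r j"
proof
  note S = equiv_symD[OF nc_relsD(1)[OF r]] and T = equiv_transD[OF nc_relsD(1)[OF r]]
  note N = noncrossing_relD[OF nc_relsD(2)[OF r]]
  fix u assume "u \<in> around r i"
  then obtain v where u: "block_min r u" "u < i" "(u, i) \<notin> r" "v > i" "(u, v) \<in> r"
    by (auto simp: around_def)
  have nuj: "(u, j) \<notin> r" using u(3) ij S T by blast
  then have "u \<noteq> j" "v \<noteq> j" using u ij S by blast+
  have "\<not> j < u" using N[of j u i v] u nuj S[OF ij] S by blast
  moreover have "\<not> v < j" using N[of u i v j] u ij by blast
  ultimately have "u < j" "j < v" using \<open>u \<noteq> j\<close> \<open>v \<noteq> j\<close> by auto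
  then show "u \<in> around r j" using u nuj by (auto simp: around_def)
qed

lemma open_after_subset:
  assumes g: "gap r a b"
  shows "open_after r a \<subseteq> open_after r b"
proof
  fix u assume "u \<in> open_after r a"
  then obtain v where u: "block_min r u" "u \<le> a" "v > a" "(u, v) \<in> r" by (auto simp: open_after_def)
  have "((a < u) = (b < u)) = ((a < v) = (b < v))" using gapD[OF g u(4)] .
  moreover have "u \<le> v" using u by simp
  ultimately have "u \<le> b" "b < v" using u by auto
  then show "u \<in> open_after r b" using u by (auto simp: open_after_def)
qed

lemma profile_respects:
  assumes r: "r \<in> nc_rels k"
  shows "profile k r respects region k r"
proof (rule congruentI)
  have q: "equiv {1..k} r" using nc_relsD[OF r] by blast
  fix u v assume uv: "(u, v) \<in> region k r"
  show "profile k r u = profile k r v"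
  proof (cases "even u")
    case True
    then have "even v" using even_region[OF uv] by simp
    then obtain a b where ab: "u = 2 * a" "v = 2 * b" using True by blast
    then have "gap r a b" using uv by (simp add: mem_region_even)
    then have "open_after r a = open_after r b" using open_after_subset gap_sym by blast
    then show ?thesis using ab by (simp add: profile_even[OF q])
  next
    case False
    then have "odd v" using even_region[OF uv] by simp
    then obtain a b where ab: "u = Suc (2 * a)" "v = Suc (2 * b)"
      using False by (metis oddE Suc_eq_plus1)
    then have *: "(Suc a, Suc b) \<in> r" using uv by (simp add: mem_region_odd[OF q])
    then have "around r (Suc a) = around r (Suc b)"
      using around_subset[OF r] equiv_symD[OF q] by blast
    moreover have "a < k" "b < k" using equiv_fieldD[OF q *] by auto
    ultimately show ?thesis using ab by (simp add: profile_def)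
  qed
qed

lemma not_block_max_gap:
  assumes r: "equiv A r" and i: "i \<in> A" and m: "\<not> block_max r i" and g: "gap r b i"
  shows "i \<le> b"
proof (rule ccontr)
  assume "\<not> i \<le> b"
  obtain v where v: "(v, i) \<in> r" "i < v" using m by (auto simp: block_max_def not_le)
  show False using gapD[OF g v(1)] \<open>\<not> i \<le> b\<close> v(2) by auto
qed

text \<open>Crossing an arc from left to right leads upwards exactly at its left end, and there a region is met
that has not been seen before.\<close>
lemma profile_up_iff:
  assumes r: "r \<in> nc_rels k" and j: "j < 2 * k"
  shows "profile k r (Suc j) = Suc (profile k r j) \<longleftrightarrow> (\<forall>v. (v, Suc j) \<in> region k r \<longrightarrow> Suc j \<le> v)"
  using j
proof (cases rule: position_cases)
  case (1 i)
  have q: "equiv {1..k} r" using nc_relsD[OF r] by blast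
  have "profile k r (Suc j) = Suc (profile k r j) \<longleftrightarrow> block_min r i"
    using profile_before[OF q 1(1,2)] profile_odd_pos[OF 1(1,2), of r] 1 by (auto split: if_splits)
  also have "\<dots> \<longleftrightarrow> (\<forall>v. (v, Suc j) \<in> region k r \<longrightarrow> Suc j \<le> v)"
  proof -
    obtain m where m: "i = Suc m" using 1 by (cases i) auto
    then have sj: "Suc j = Suc (2 * m)" using 1 by simp
    show ?thesis unfolding sj
    proof
      assume b: "block_min r i"
      show "\<forall>v. (v, Suc (2 * m)) \<in> region k r \<longrightarrow> Suc (2 * m) \<le> v"
      proof (intro allI impI)
        fix v assume v: "(v, Suc (2 * m)) \<in> region k r"
        then have "odd v" using even_region[OF v] by simp
        then obtain w where w: "v = Suc (2 * w)" by (metis oddE Suc_eq_plus1)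
        then have "(Suc w, Suc m) \<in> r" using v by (simp add: mem_region_odd[OF q])
        then show "Suc (2 * m) \<le> v" using b w m by (auto simp: block_min_def)
      qed
    next
      assume b: "\<forall>v. (v, Suc (2 * m)) \<in> region k r \<longrightarrow> Suc (2 * m) \<le> v"
      show "block_min r i" unfolding block_min_def
      proof (intro allI impI)
        fix u assume u: "(u, i) \<in> r"
        then obtain w where w: "u = Suc w" using equiv_fieldD[OF q u] by (cases u) auto
        then have "(Suc (2 * w), Suc (2 * m)) \<in> region k r" using u m by (simp add: mem_region_odd[OF q])
        then have "Suc (2 * m) \<le> Suc (2 * w)" using b by blast
        then show "i \<le> u" using w m by simp
      qed
    qed
  qed
  finally show ?thesis .
next
  case (2 i)
  have q: "equiv {1..k} r" using nc_relsD[OF r] by blast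
  have iA: "i \<in> {1..k}" using 2 by simp
  have "profile k r (Suc j) = Suc (profile k r j) \<longleftrightarrow> \<not> block_max r i"
    using profile_after[OF q 2(1,2)] profile_odd_pos[OF 2(1,2), of r] 2 by (auto split: if_splits)
  also have "\<dots> \<longleftrightarrow> (\<forall>v. (v, Suc j) \<in> region k r \<longrightarrow> Suc j \<le> v)"
    unfolding 2(4)
  proof
    assume b: "\<not> block_max r i"
    show "\<forall>v. (v, 2 * i) \<in> region k r \<longrightarrow> 2 * i \<le> v"
    proof (intro allI impI)
      fix v assume v: "(v, 2 * i) \<in> region k r"
      then have "even v" using even_region[OF v] by simp
      then obtain w where w: "v = 2 * w" by blast
      then have "gap r w i" using v by (simp add: mem_region_even)
      then show "2 * i \<le> v" using not_block_max_gap[OF q iA b] w by simp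
    qed
  next
    assume b: "\<forall>v. (v, 2 * i) \<in> region k r \<longrightarrow> 2 * i \<le> v"
    show "\<not> block_max r i"
    proof
      assume mx: "block_max r i"
      obtain m where m: "(m, i) \<in> r" "block_min r m" using obtain_block_min[OF q iA] by blast
      have mi: "1 \<le> m" "m \<le> i" using equiv_fieldD[OF q m(1)] mx m by (auto simp: block_max_def)
      have "gap r (m - 1) i"
        by (rule gap_block[OF r m(1)])
          (use mx m equiv_transD[OF q _ equiv_symD[OF q m(1)]] in \<open>auto simp: block_min_def block_max_def\<close>)
      moreover have "m - 1 \<le> k" using mi 2 by simp
      ultimately have "(2 * (m - 1), 2 * i) \<in> region k r" using 2 by (simp add: mem_region_even)
      then have "2 * i \<le> 2 * (m - 1)" using b by blast
      then show False using mi by simp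
    qed
  qed
  finally show ?thesis .
qed

text \<open>Where the profile rises, no walk can rise faster. Where it falls, it returns to a region seen before,
and there both heights are those of an earlier position.\<close>
lemma walk_le_profile:
  assumes r: "r \<in> nc_rels k" and h: "h \<in> walks (2 * k) 0" "h respects region k r"
  shows "h j \<le> profile k r j"
proof (induction j rule: less_induct)
  case (less j)
  have q: "equiv {1..k} r" using nc_relsD[OF r] by blast
  have w: "profile k r \<in> walks (2 * k) 0" by (rule profile_in_walks[OF q])
  show ?case
  proof (cases j)
    case 0
    then show ?thesis using h(1) by (simp add: walks_def)
  next
    case (Suc i)
    show ?thesis
    proof (cases "i < 2 * k")
      case False
      then show ?thesis using Suc h(1) by (simp add: walks_def)
    next
      case True
      show ?thesis
      proof (cases "profile k r (Suc i) = Suc (profile k r i)")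
        case up: True
        have "h (Suc i) \<le> Suc (h i)" using walk_step[OF h(1) True] by auto
        then show ?thesis using less.IH[of i] up Suc by simp
      next
        case False
        then obtain v where v: "(v, Suc i) \<in> region k r" "v < Suc i"
          using profile_up_iff[OF r True] by (auto simp: not_le)
        have "h (Suc i) = h v" using congruentD[OF h(2) v(1)] by simp
        also have "\<dots> \<le> profile k r v" using less.IH[of v] v(2) Suc by simp
        also have "\<dots> = profile k r (Suc i)" using congruentD[OF profile_respects[OF r] v(1)] by simp
        finally show ?thesis using Suc by simp
      qed
    qed
  qed
qed

section \<open>The noncrossing relation of a Dyck path\<close>

text \<open>Two positions of the same height see the same region if the path does not fall below that height
between them.\<close>
definition walk_rel :: "nat \<Rightarrow> (nat \<Rightarrow> nat) \<Rightarrow> nat rel"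
  where "walk_rel k h = {(u, v). u \<in> {1..k} \<and> v \<in> {1..k} \<and> h (2 * u - 1) = h (2 * v - 1) \<and>
    (\<forall>l. min (2 * u - 1) (2 * v - 1) \<le> l \<and> l \<le> max (2 * u - 1) (2 * v - 1) \<longrightarrow> h (2 * u - 1) \<le> h l)}"

lemma walk_rel_less:
  assumes "u \<le> v" "1 \<le> u"
  shows "(u, v) \<in> walk_rel k h \<longleftrightarrow> v \<le> k \<and> h (2 * u - 1) = h (2 * v - 1) \<and>
    (\<forall>l. 2 * u - 1 \<le> l \<and> l \<le> 2 * v - 1 \<longrightarrow> h (2 * u - 1) \<le> h l)"
proof -
  have "min (2 * u - 1) (2 * v - 1) = 2 * u - 1" "max (2 * u - 1) (2 * v - 1) = 2 * v - 1"
    using assms by auto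
  then show ?thesis using assms by (auto simp: walk_rel_def)
qed

lemma walk_rel_nc: "walk_rel k h \<in> nc_rels k"
proof -
  have "equiv {1..k} (walk_rel k h)"
  proof (rule equivI)
    show "walk_rel k h \<subseteq> {1..k} \<times> {1..k}" by (auto simp: walk_rel_def)
    show "refl_on {1..k} (walk_rel k h)" by (auto simp: refl_on_def walk_rel_def)
    show "sym (walk_rel k h)" by (auto simp: sym_def walk_rel_def min.commute max.commute)
    show "trans (walk_rel k h)"
    proof (rule transI)
      fix u v w assume uv: "(u, v) \<in> walk_rel k h" and vw: "(v, w) \<in> walk_rel k h"
      have "h (2 * u - 1) \<le> h l"
        if l: "min (2 * u - 1) (2 * w - 1) \<le> l" "l \<le> max (2 * u - 1) (2 * w - 1)" for l
      proof -
        have "min (2 * u - 1) (2 * v - 1) \<le> l \<and> l \<le> max (2 * u - 1) (2 * v - 1) \<or>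
          min (2 * v - 1) (2 * w - 1) \<le> l \<and> l \<le> max (2 * v - 1) (2 * w - 1)"
          using l unfolding min_le_iff_disj le_max_iff_disj by linarith
        then show ?thesis using uv vw unfolding walk_rel_def by auto
      qed
      then show "(u, w) \<in> walk_rel k h" using uv vw unfolding walk_rel_def by auto
    qed
  qed
  moreover have "noncrossing_rel (walk_rel k h)"
    unfolding noncrossing_rel_def
  proof (intro allI impI)
    fix a b c d assume A: "a < b \<and> b < c \<and> c < d \<and> (a, c) \<in> walk_rel k h \<and> (b, d) \<in> walk_rel k h"
    then have 1: "1 \<le> a" "1 \<le> b" "b \<le> k" by (auto simp: walk_rel_def)
    have ac: "h (2 * a - 1) = h (2 * c - 1)"
      "\<And>l. 2 * a - 1 \<le> l \<Longrightarrow> l \<le> 2 * c - 1 \<Longrightarrow> h (2 * a - 1) \<le> h l"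
      using A walk_rel_less[of a c k h] 1 by auto
    have bd: "\<And>l. 2 * b - 1 \<le> l \<Longrightarrow> l \<le> 2 * d - 1 \<Longrightarrow> h (2 * b - 1) \<le> h l"
      using A walk_rel_less[of b d k h] 1 by auto
    have "h (2 * a - 1) \<le> h (2 * b - 1)" by (rule ac(2)) (use A in auto)
    moreover have "h (2 * b - 1) \<le> h (2 * c - 1)" by (rule bd) (use A in auto)
    ultimately have "h (2 * a - 1) = h (2 * b - 1)" using ac(1) by simp
    moreover have "h (2 * a - 1) \<le> h l" if "2 * a - 1 \<le> l" "l \<le> 2 * b - 1" for l
      by (rule ac(2)) (use A that in auto)
    ultimately show "(a, b) \<in> walk_rel k h" using walk_rel_less[of a b k h] A 1 by auto
  qed
  ultimately show ?thesis by (simp add: nc_rels_def)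
qed

text \<open>If the path falls to position \<open>2 i - 1\<close>, the last earlier position of at most this height belongs to a
smaller point of the block of \<open>i\<close>.\<close>
lemma block_min_walk_rel:
  assumes h: "h \<in> walks (2 * k) 0" and i: "1 \<le> i" "i \<le> k"
  shows "block_min (walk_rel k h) i \<longleftrightarrow> h (2 * i - 1) = Suc (h (2 * i - 2))"
proof
  assume up: "h (2 * i - 1) = Suc (h (2 * i - 2))"
  show "block_min (walk_rel k h) i" unfolding block_min_def
  proof (intro allI impI)
    fix u assume u: "(u, i) \<in> walk_rel k h"
    show "i \<le> u"
    proof (rule ccontr)
      assume ui: "\<not> i \<le> u"
      have "1 \<le> u" using u by (auto simp: walk_rel_def)
      then have *: "h (2 * u - 1) = h (2 * i - 1)"
        "\<And>l. 2 * u - 1 \<le> l \<and> l \<le> 2 * i - 1 \<Longrightarrow> h (2 * u - 1) \<le> h l"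
        using u ui walk_rel_less[of u i k h] by auto
      have "h (2 * u - 1) \<le> h (2 * i - 2)" by (rule *(2)) (use ui in auto)
      then show False using up *(1) by simp
    qed
  qed
next
  assume b: "block_min (walk_rel k h) i"
  show "h (2 * i - 1) = Suc (h (2 * i - 2))"
  proof (rule ccontr)
    assume "h (2 * i - 1) \<noteq> Suc (h (2 * i - 2))"
    moreover have "2 * i - 1 = Suc (2 * i - 2)" "2 * i - 2 < 2 * k" using i by auto
    ultimately have down: "h (2 * i - 2) = Suc (h (2 * i - 1))"
      using walk_step[OF h, of "2 * i - 2"] by auto
    \<comment> \<open>positions before \<open>2 i - 1\<close> that are not higher; by parity the last of them is odd\<close>
    define B where "B = {l. l \<le> 2 * i - 2 \<and> h l \<le> h (2 * i - 1)}"
    define l where "l = Max B"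
    have "finite B" by (rule finite_subset[of _ "{..2 * i - 2}"]) (auto simp: B_def)
    moreover have "0 \<in> B" using h by (simp add: B_def walks_def)
    ultimately have lB: "l \<in> B" and lmax: "\<And>t. t \<in> B \<Longrightarrow> t \<le> l"
      unfolding l_def by (auto intro: Max_in)
    have l2: "l < 2 * i - 2" using lB down by (cases "l = 2 * i - 2") (auto simp: B_def)
    have above: "h (2 * i - 1) < h t" if "l < t" "t \<le> 2 * i - 2" for t
    proof (rule ccontr)
      assume "\<not> h (2 * i - 1) < h t"
      then have "t \<in> B" using that by (simp add: B_def)
      then show False using lmax[of t] that by simp
    qed
    have "h l = h (2 * i - 1)"
      using above[of "Suc l"] l2 lB walk_step[OF h, of l] i by (auto simp: B_def)
    moreover have "even (h l) = even l" "even (h (2 * i - 1)) = even (2 * i - 1)"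
      using walk_parity[OF h, of l] walk_parity[OF h, of "2 * i - 1"] l2 i by auto
    ultimately have "odd l" using i by auto
    then obtain a where a: "l = 2 * a + 1" by (rule oddE)
    define u where "u = Suc a"
    have u: "l = 2 * u - 1" "1 \<le> u" "u < i" using a u_def l2 by auto
    have "(u, i) \<in> walk_rel k h"
      unfolding walk_rel_less[OF less_imp_le[OF u(3)] u(2)]
    proof (intro conjI allI impI)
      show "i \<le> k" by fact
      show "h (2 * u - 1) = h (2 * i - 1)" using \<open>h l = _\<close> u by simp
      fix t assume t: "2 * u - 1 \<le> t \<and> t \<le> 2 * i - 1"
      show "h (2 * u - 1) \<le> h t"
      proof (cases "t = l \<or> t = 2 * i - 1")
        case True
        then show ?thesis using \<open>h l = _\<close> u by auto
      next
        case False
        then have "l < t" "t \<le> 2 * i - 2" using t u by auto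
        then show ?thesis using above[of t] \<open>h l = _\<close> u by simp
      qed
    qed
    then show False using b u(3) by (auto simp: block_min_def)
  qed
qed

text \<open>If the path rises from position \<open>2 i - 1\<close>, it returns to this height, since it ends at \<open>0\<close>; the first
return belongs to a larger point of the block of \<open>i\<close>.\<close>
lemma block_max_walk_rel:
  assumes h: "h \<in> walks (2 * k) 0" and i: "1 \<le> i" "i \<le> k"
  shows "block_max (walk_rel k h) i \<longleftrightarrow> h (2 * i - 1) = Suc (h (2 * i))"
proof
  assume up: "h (2 * i - 1) = Suc (h (2 * i))"
  show "block_max (walk_rel k h) i" unfolding block_max_def
  proof (intro allI impI)
    fix u assume "(u, i) \<in> walk_rel k h"
    then have u: "(i, u) \<in> walk_rel k h"
      using equiv_symD[OF nc_relsD(1)[OF walk_rel_nc]] by blast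
    show "u \<le> i"
    proof (rule ccontr)
      assume ui: "\<not> u \<le> i"
      then have "h (2 * i - 1) \<le> h (2 * i)"
        using u walk_rel_less[of i u k h] i by auto
      then show False using up by simp
    qed
  qed
next
  assume b: "block_max (walk_rel k h) i"
  show "h (2 * i - 1) = Suc (h (2 * i))"
  proof (rule ccontr)
    assume "h (2 * i - 1) \<noteq> Suc (h (2 * i))"
    moreover have "Suc (2 * i - 1) = 2 * i" "2 * i - 1 < 2 * k" using i by auto
    ultimately have down: "h (2 * i) = Suc (h (2 * i - 1))"
      using walk_step[OF h, of "2 * i - 1"] by auto
    \<comment> \<open>the first return to the height at \<open>2 i - 1\<close>; by parity it is at an odd position\<close>
    define l where "l = (LEAST l. 2 * i \<le> l \<and> h l \<le> h (2 * i - 1))"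
    have "2 * i \<le> 2 * k \<and> h (2 * k) \<le> h (2 * i - 1)" using h i by (simp add: walks_def)
    from LeastI[of "\<lambda>l. 2 * i \<le> l \<and> h l \<le> h (2 * i - 1)", OF this]
      Least_le[of "\<lambda>l. 2 * i \<le> l \<and> h l \<le> h (2 * i - 1)", OF this]
    have lB: "2 * i \<le> l" "h l \<le> h (2 * i - 1)" and lk: "l \<le> 2 * k"
      unfolding l_def by blast+
    have above: "h (2 * i - 1) < h t" if "2 * i \<le> t" "t < l" for t
      using not_less_Least[of t "\<lambda>l. 2 * i \<le> l \<and> h l \<le> h (2 * i - 1)"] that
      by (auto simp: l_def not_le)
    have l2: "2 * i < l" using lB down by (cases "l = 2 * i") auto
    have "h l = h (2 * i - 1)"
    proof -
      obtain l' where l': "l = Suc l'" using l2 by (cases l) auto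
      then show ?thesis using above[of l'] l2 lB(2) lk walk_step[OF h, of l'] by auto
    qed
    moreover have "even (h l) = even l" "even (h (2 * i - 1)) = even (2 * i - 1)"
      using walk_parity[OF h, of l] walk_parity[OF h, of "2 * i - 1"] lk i by auto
    ultimately have "odd l" using i by auto
    then obtain a where a: "l = 2 * a + 1" by (rule oddE)
    define u where "u = Suc a"
    have u: "l = 2 * u - 1" "i < u" "u \<le> k" using a u_def l2 lk by auto
    have "(i, u) \<in> walk_rel k h"
      unfolding walk_rel_less[OF less_imp_le[OF u(2)] i(1)]
    proof (intro conjI allI impI)
      show "u \<le> k" by fact
      show "h (2 * i - 1) = h (2 * u - 1)" using \<open>h l = _\<close> u by simp
      fix t assume t: "2 * i - 1 \<le> t \<and> t \<le> 2 * u - 1"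
      show "h (2 * i - 1) \<le> h t"
      proof (cases "t = l \<or> t = 2 * i - 1")
        case True
        then show ?thesis using \<open>h l = _\<close> u by auto
      next
        case False
        then have "t < l" "2 * i \<le> t" using t u by auto
        then show ?thesis using above[of t] by simp
      qed
    qed
    then have "(u, i) \<in> walk_rel k h"
      using equiv_symD[OF nc_relsD(1)[OF walk_rel_nc]] by blast
    then show False using b u(2) by (auto simp: block_max_def)
  qed
qed

lemma profile_walk_rel:
  assumes h: "h \<in> walks (2 * k) 0"
  shows "profile k (walk_rel k h) = h"
proof (rule walk_eqI)
  have q: "equiv {1..k} (walk_rel k h)" by (rule nc_relsD(1)[OF walk_rel_nc])
  show "profile k (walk_rel k h) \<in> walks (2 * k) 0" by (rule profile_in_walks[OF q])
  show "h \<in> walks (2 * k) 0" by fact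
  fix j assume j: "j < 2 * k"
  show "profile k (walk_rel k h) (Suc j) = Suc (profile k (walk_rel k h) j) \<longleftrightarrow> h (Suc j) = Suc (h j)"
    using j
  proof (cases rule: position_cases)
    case (1 i)
    have "profile k (walk_rel k h) (Suc j) = Suc (profile k (walk_rel k h) j) \<longleftrightarrow>
        block_min (walk_rel k h) i"
      using profile_before[OF q 1(1,2)] profile_odd_pos[OF 1(1,2), of "walk_rel k h"] 1
      by (auto split: if_splits)
    then show ?thesis using block_min_walk_rel[OF h 1(1,2)] 1 by simp
  next
    case (2 i)
    have "profile k (walk_rel k h) (Suc j) = Suc (profile k (walk_rel k h) j) \<longleftrightarrow>
        \<not> block_max (walk_rel k h) i"
      using profile_after[OF q 2(1,2)] profile_odd_pos[OF 2(1,2), of "walk_rel k h"] 2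
      by (auto split: if_splits)
    then show ?thesis using block_max_walk_rel[OF h 2(1,2)] walk_step[OF h j] 2 by auto
  qed
qed

text \<open>Between related points the profile does not fall below its height there, because every block above them
stretches over the whole span. If \<open>u < v\<close> are not related, consider the last point \<open>c\<close> of the block of
\<open>u\<close> before \<open>v\<close>. If the block ends at \<open>c\<close>, the profile falls below its height at \<open>u\<close> right after \<open>c\<close>;
otherwise the block of \<open>u\<close> lies above \<open>v\<close>, and the profile is higher at \<open>v\<close> than at \<open>u\<close>.\<close>
lemma walk_rel_profile:
  assumes r: "r \<in> nc_rels k"
  shows "walk_rel k (profile k r) = r"
proof -
  have q: "equiv {1..k} r" using nc_relsD[OF r] by blast
  note S = equiv_symD[OF q] and T = equiv_transD[OF q]
  note N = noncrossing_relD[OF nc_relsD(2)[OF r]]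
  let ?h = "profile k r"
  have wq: "equiv {1..k} (walk_rel k ?h)" by (rule nc_relsD(1)[OF walk_rel_nc])
  have odd: "?h (2 * i - 1) = 2 * card (around r i) + 1" if "i \<in> {1..k}" for i
    using that profile_odd[of i k r] by simp
  have pos: "1 \<le> u" "u \<le> k" "u \<in> {1..k}" if "(u, v) \<in> r" for u v
    using equiv_fieldD[OF q that] by auto
  have same: "around r u = around r v" if "(u, v) \<in> r" for u v
    using around_subset[OF r] that S by blast
  have deeper: "insert m (around r u) \<subseteq> around r i"
    if uv: "(u, v) \<in> r" "u < i" "i < v" "(u, i) \<notin> r" and m: "(m, u) \<in> r" "block_min r m" for u v i m
  proof
    fix w assume "w \<in> insert m (around r u)"
    then consider "w = m" | "w \<in> around r u" by blast
    then show "w \<in> around r i"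
    proof cases
      case 1
      have "m \<le> u" using m S by (auto simp: block_min_def)
      moreover have "(m, v) \<in> r" "(m, i) \<notin> r" using m uv S T by blast+
      ultimately show ?thesis using 1 m uv by (auto simp: around_def)
    next
      case 2
      then have w: "block_min r w" "w < u" "(w, u) \<notin> r" by (auto simp: around_def)
      obtain v' where v': "v < v'" "(w, v') \<in> r" using 2 same[OF uv(1)] by (auto simp: around_def)
      have "(w, i) \<notin> r" using N[of w u i v] w uv by blast
      then show ?thesis using w v' uv by (auto simp: around_def intro!: exI[of _ v'])
    qed
  qed
  have le: "(u, v) \<in> walk_rel k ?h" if uv: "(u, v) \<in> r" "u \<le> v" for u v
    unfolding walk_rel_less[OF uv(2) pos(1)[OF uv(1)]]
  proof (intro conjI allI impI)
    show "v \<le> k" using pos(2)[OF S[OF uv(1)]] .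
    show "?h (2 * u - 1) = ?h (2 * v - 1)"
      using odd pos(3)[OF uv(1)] pos(3)[OF S[OF uv(1)]] same[OF uv(1)] by simp
    fix l assume l: "2 * u - 1 \<le> l \<and> l \<le> 2 * v - 1"
    obtain m where m: "(m, u) \<in> r" "block_min r m"
      using obtain_block_min[OF q pos(3)[OF uv(1)]] by blast
    show "?h (2 * u - 1) \<le> ?h l"
    proof (cases "even l")
      case False
      then obtain a where a: "l = 2 * a + 1" by (rule oddE)
      define i where "i = Suc a"
      have i: "l = 2 * i - 1" "u \<le> i" "i \<le> v" using a l i_def by auto
      then have iA: "i \<in> {1..k}" using pos[OF uv(1)] pos[OF S[OF uv(1)]] by auto
      have "card (around r u) \<le> card (around r i)"
      proof (cases "(u, i) \<in> r")
        case True
        then show ?thesis using same by simp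
      next
        case False
        then have "u < i" "i < v" using i uv pos(3)[OF uv(1)] equiv_reflD[OF q]
          by (metis le_neq_implies_less)+
        then show ?thesis
          using deeper[OF uv(1) _ _ False m] by (intro card_mono finite_around) auto
      qed
      then show ?thesis using odd[OF iA] odd[OF pos(3)[OF uv(1)]] i by simp
    next
      case True
      then obtain i where i: "l = 2 * i" by blast
      have ui: "u \<le> i" "i < v" using l i pos[OF uv(1)] by auto
      have "insert m (around r u) \<subseteq> open_after r i"
      proof
        fix w assume "w \<in> insert m (around r u)"
        then consider "w = m" | "w \<in> around r u" by blast
        then show "w \<in> open_after r i"
        proof cases
          case 1
          have "m \<le> u" using m S by (auto simp: block_min_def)
          moreover have "(m, v) \<in> r" using m uv T by blast
          ultimately show ?thesis using 1 m ui by (auto simp: open_after_def)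
        next
          case 2
          then have w: "block_min r w" "w < u" by (auto simp: around_def)
          obtain v' where v': "v < v'" "(w, v') \<in> r" using 2 same[OF uv(1)] by (auto simp: around_def)
          then show ?thesis using w ui by (auto simp: open_after_def intro!: exI[of _ v'])
        qed
      qed
      then have "card (insert m (around r u)) \<le> card (open_after r i)"
        by (intro card_mono finite_open_after)
      moreover have "m \<notin> around r u" using m by (auto simp: around_def)
      ultimately have "card (around r u) + 1 \<le> card (open_after r i)" using finite_around by simp
      then show ?thesis using odd[OF pos(3)[OF uv(1)]] profile_even[OF q, of i] i by simp
    qed
  qed
  have ge: "(u, v) \<in> r" if uv: "(u, v) \<in> walk_rel k ?h" "u \<le> v" for u v
  proof (rule ccontr)
    assume nuv: "(u, v) \<notin> r"
    have A: "u \<in> {1..k}" "v \<in> {1..k}" using equiv_fieldD[OF wq uv(1)] by auto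
    then have ueq: "?h (2 * u - 1) = ?h (2 * v - 1)"
      and ule: "\<And>l. 2 * u - 1 \<le> l \<Longrightarrow> l \<le> 2 * v - 1 \<Longrightarrow> ?h (2 * u - 1) \<le> ?h l"
      using walk_rel_less[OF uv(2), of k ?h] uv(1) by auto
    have uu: "(u, u) \<in> r" using equiv_reflD[OF q A(1)] .
    then have "u < v" using uv(2) nuv by (metis le_neq_implies_less)
    \<comment> \<open>the part of the block of \<open>u\<close> before \<open>v\<close>\<close>
    define B where "B = {w. w < v \<and> (u, w) \<in> r}"
    have B: "finite B" "u \<in> B" using \<open>u < v\<close> uu by (auto simp: B_def)
    define c where "c = Max B"
    have "c \<in> B" unfolding c_def by (rule Max_in) (use B in auto)
    then have c: "c < v" "(u, c) \<in> r" by (simp_all add: B_def)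
    have cmax: "w \<le> c" if "w < v" "(u, w) \<in> r" for w
      using that B(1) by (auto simp: c_def B_def intro: Max_ge)
    have uc: "u \<le> c" using cmax \<open>u < v\<close> uu by blast
    have cA: "c \<in> {1..k}" using equiv_fieldD[OF q c(2)] by simp
    obtain m where m: "(m, c) \<in> r" "block_min r m" using obtain_block_min[OF q cA] by blast
    show False
    proof (cases "block_max r c")
      case True
      have "?h (2 * c) = ?h (2 * c - 1) - 1" using profile_after[OF q, of c] cA True by simp
      moreover have "?h (2 * c - 1) = ?h (2 * u - 1)"
        using odd[OF cA] odd[OF A(1)] same[OF c(2)] by simp
      moreover have "?h (2 * u - 1) \<le> ?h (2 * c)" by (rule ule) (use uc c(1) in auto)
      ultimately show False using odd[OF A(1)] by simp
    next
      case False
      then obtain d where d: "(d, c) \<in> r" "c < d" by (auto simp: block_max_def not_le)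
      have ud: "(u, d) \<in> r" using c d S T by blast
      then have "v < d" using cmax[of d] d nuv by (metis le_neq_implies_less not_le)
      have "(c, v) \<notin> r" using c(2) nuv T by blast
      then have "insert m (around r c) \<subseteq> around r v"
        using deeper[OF S[OF d(1)] c(1) \<open>v < d\<close> _ m] by blast
      then have "card (insert m (around r c)) \<le> card (around r v)"
        by (intro card_mono finite_around)
      moreover have "m \<notin> around r c" using m by (auto simp: around_def)
      ultimately have "card (around r c) < card (around r v)" using finite_around by simp
      then show False using ueq odd[OF A(1)] odd[OF A(2)] same[OF c(2)] by simp
    qed
  qed
  have "(u, v) \<in> walk_rel k ?h \<longleftrightarrow> (u, v) \<in> r" for u v
  proof (cases "u \<le> v")
    case True
    then show ?thesis using le ge by blast
  next
    case False
    then have "v \<le> u" by simp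
    then show ?thesis using le[of v u] ge[of v u] S equiv_symD[OF wq] by blast
  qed
  then show ?thesis by auto
qed

lemma bij_profile: "bij_betw (profile k) (nc_rels k) (walks (2 * k) 0)"
proof (rule bij_betw_byWitness)
  show "\<forall>r\<in>nc_rels k. walk_rel k (profile k r) = r" by (simp add: walk_rel_profile)
  show "\<forall>h\<in>walks (2 * k) 0. profile k (walk_rel k h) = h" by (simp add: profile_walk_rel)
  show "profile k ` nc_rels k \<subseteq> walks (2 * k) 0"
    using profile_in_walks nc_relsD(1) by blast
  show "walk_rel k ` walks (2 * k) 0 \<subseteq> nc_rels k" using walk_rel_nc by blast
qed

section \<open>Generation of all noncrossing relations\<close>

lemma glue_isolate_undo:
  assumes r: "equiv A r" and ij: "(i, j) \<in> r" "i \<noteq> j"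
  shows "glue i j (isolate i r) = r"
proof -
  note S = equiv_symD[OF r] and T = equiv_transD[OF r]
  have ii: "(i, i) \<in> r" using T[OF ij(1) S[OF ij(1)]] .
  have "(u, v) \<in> glue i j (isolate i r) \<longleftrightarrow> (u, v) \<in> r" for u v
  proof -
    have ju: "(j, w) \<in> r \<longleftrightarrow> (i, w) \<in> r" for w using ij S T by blast
    have sy: "(u, i) \<in> r \<longleftrightarrow> (i, u) \<in> r" using S by blast
    show ?thesis unfolding glue_iff isolate_iff ju
      using ij(2) ii sy by (cases "u = i"; cases "v = i") auto
  qed
  then show ?thesis by auto
qed

text \<open>A singleton that has been glued to another class can be split off again.\<close>
lemma isolate_glue_undo:
  assumes r: "equiv A r" and i: "i \<in> A" and j: "r `` {j} = {j}" and ij: "i \<noteq> j"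
  shows "isolate j (glue i j r) = r"
proof -
  have jj: "(j, v) \<in> r \<longleftrightarrow> v = j" for v using j by blast
  have jj': "(v, j) \<in> r \<longleftrightarrow> v = j" for v using jj equiv_symD[OF r] by blast
  have "(u, v) \<in> isolate j (glue i j r) \<longleftrightarrow> (u, v) \<in> r" for u v
    unfolding glue_iff isolate_iff jj by (cases "u = j"; cases "v = j") (auto simp: jj jj')
  then show ?thesis by auto
qed

definition nonsingle :: "nat \<Rightarrow> nat rel \<Rightarrow> nat set"
  where "nonsingle k r = {i \<in> {1..k}. r `` {i} \<noteq> {i}}"

lemma nonsingle_isolate: "nonsingle k (isolate i r) \<subseteq> nonsingle k r - {i}"
proof
  fix u assume u: "u \<in> nonsingle k (isolate i r)"
  then have "u \<noteq> i" by (auto simp: nonsingle_def isolate_class)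
  then show "u \<in> nonsingle k r - {i}" using u by (auto simp: nonsingle_def isolate_class)
qed

lemma nonsingle_glue:
  assumes "equiv {1..k} r" 
  shows "nonsingle k (glue i j r) \<subseteq> nonsingle k r \<union> {i, j}"
proof
  fix u assume u: "u \<in> nonsingle k (glue i j r)"
  show "u \<in> nonsingle k r \<union> {i, j}"
  proof (rule ccontr)
    assume n: "\<not> ?thesis"
    then have "r `` {u} = {u}" "u \<noteq> i" "u \<noteq> j" using u by (auto simp: nonsingle_def)
    moreover have "w = u" if "(w, u) \<in> r" for w
      using equiv_symD[OF assms that] \<open>r `` {u} = {u}\<close> by blast
    ultimately have "(i, u) \<notin> r" "(j, u) \<notin> r" by blast+
    then have "glue i j r `` {u} = r `` {u}" by (auto simp: glue_iff)
    then show False using u \<open>r `` {u} = {u}\<close> by (simp add: nonsingle_def)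
  qed
qed

lemma nonsingle_empty:
  assumes q: "equiv {1..k} r" and e: "nonsingle k r = {}"
  shows "r = Id_on {1..k}"
proof (intro equalityI subrelI)
  fix u v assume uv: "(u, v) \<in> r"
  then have u: "u \<in> {1..k}" using equiv_fieldD[OF q] by blast
  then have "r `` {u} = {u}" using e by (auto simp: nonsingle_def)
  then have "v = u" using uv by blast
  then show "(u, v) \<in> Id_on {1..k}" using u by blast
next
  fix u v assume "(u, v) \<in> Id_on {1..k}"
  then show "(u, v) \<in> r" using equiv_reflD[OF q] by auto
qed

text \<open>Choose a block with more than one point whose least point \<open>i\<close> is as large as possible. Then \<open>i + 1\<close>
belongs to this block or is a singleton: otherwise its block starts before \<open>i\<close> and crosses the
chosen one. In the first case \<open>i\<close> can be split off, and gluing it to \<open>i + 1\<close> undoes this. In the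
second case \<open>i + 1\<close> takes over the role of \<open>i\<close> in the block, and \<open>i\<close> becomes the singleton; this is
undone by gluing and then splitting off \<open>i + 1\<close>. Both moves reduce the sum of the distances of the
non-singleton points to the right end.\<close>
lemma nc_rels_induct [consumes 1, case_names discrete glue isolate]:
  assumes r: "r \<in> nc_rels k" and disc: "Q (Id_on {1..k})"
    and gl: "\<And>r i. r \<in> nc_rels k \<Longrightarrow> Q r \<Longrightarrow> 1 \<le> i \<Longrightarrow> i < k \<Longrightarrow> Q (glue i (Suc i) r)"
    and iso: "\<And>r i. r \<in> nc_rels k \<Longrightarrow> Q r \<Longrightarrow> 1 \<le> i \<Longrightarrow> i \<le> k \<Longrightarrow> Q (isolate i r)"
  shows "Q r"
  using r
proof (induction "\<Sum>i\<in>nonsingle k r. Suc k - i" arbitrary: r rule: less_induct)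
  case less
  have q: "equiv {1..k} r" using nc_relsD[OF less.prems] by blast
  note S = equiv_symD[OF q] and T = equiv_transD[OF q]
  note N = noncrossing_relD[OF nc_relsD(2)[OF less.prems]]
  have fin: "finite (nonsingle k r)" by (simp add: nonsingle_def)
  show ?case
  proof (cases "nonsingle k r = {}")
    case True
    have "r = Id_on {1..k}" using nonsingle_empty[OF q True] .
    then show ?thesis using disc by simp
  next
    case False
    \<comment> \<open>the least points of the blocks with more than one point\<close>
    define B where "B = {i \<in> nonsingle k r. block_min r i}"
    have up: "\<exists>m. (m, i) \<in> r \<and> m \<in> B" if "i \<in> nonsingle k r" for i
    proof -
      have iA: "i \<in> {1..k}" using that by (simp add: nonsingle_def)
      obtain m where m: "(m, i) \<in> r" "block_min r m" using obtain_block_min[OF q iA] by blast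
      have "r `` {m} \<noteq> {m}"
      proof
        assume "r `` {m} = {m}"
        then have "i = m" using m(1) by blast
        then show False using that \<open>r `` {m} = {m}\<close> by (simp add: nonsingle_def)
      qed
      then have "m \<in> B" using m equiv_fieldD[OF q m(1)] by (auto simp: B_def nonsingle_def)
      then show ?thesis using m by blast
    qed
    have fB: "finite B" using fin by (simp add: B_def)
    moreover have "B \<noteq> {}" using up False by blast
    define i where "i = Max B"
    have "i \<in> B" unfolding i_def by (rule Max_in) fact+
    then have ins: "i \<in> nonsingle k r" and imin: "block_min r i" by (auto simp: B_def)
    have imax: "m \<le> i" if "m \<in> B" for m unfolding i_def using fB that by simp
    have iA: "i \<in> {1..k}" using ins by (simp add: nonsingle_def)
    have "(i, i) \<in> r" using equiv_reflD[OF q iA] .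
    then obtain c where c: "(i, c) \<in> r" "c \<noteq> i" using ins by (auto simp: nonsingle_def)
    have ic: "i < c" using imin S[OF c(1)] c(2) by (auto simp: block_min_def le_neq_implies_less)
    have ik: "1 \<le> i" "i < k" using iA ic equiv_fieldD[OF q c(1)] by auto
    show ?thesis
    proof (cases "(i, Suc i) \<in> r")
      case True
      let ?r = "isolate i r"
      have nc: "?r \<in> nc_rels k" using nc_isolate[OF less.prems] ik by simp
      have "(\<Sum>i\<in>nonsingle k ?r. Suc k - i) \<le> (\<Sum>i\<in>nonsingle k r - {i}. Suc k - i)"
        by (rule sum_mono2) (use fin nonsingle_isolate in auto)
      also have "\<dots> < (\<Sum>i\<in>nonsingle k r. Suc k - i)"
        by (rule sum_strict_mono2[OF fin, of _ i]) (use ins ik in auto)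
      finally have "Q ?r" using less.hyps nc by blast
      then have "Q (glue i (Suc i) ?r)" using gl nc ik by blast
      then show ?thesis using glue_isolate_undo[OF q True] by simp
    next
      case False
      have single: "r `` {Suc i} = {Suc i}"
      proof (rule ccontr)
        assume "r `` {Suc i} \<noteq> {Suc i}"
        then have "Suc i \<in> nonsingle k r" using ik by (simp add: nonsingle_def)
        then obtain m where m: "(m, Suc i) \<in> r" "m \<in> B" using up by blast
        then have "m \<noteq> i" using False by blast
        then have "m < i" using imax[OF m(2)] by simp
        moreover have "Suc i < c" using ic c False by (metis Suc_lessI)
        ultimately have "(m, i) \<in> r" using N[of m i "Suc i" c] m c by simp
        then show False using imin \<open>m < i\<close> by (auto simp: block_min_def)
      qed
      let ?r1 = "glue i (Suc i) r"
      let ?r = "isolate i ?r1"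
      have q1: "equiv {1..k} ?r1" using equiv_glue[OF q] ik by simp
      have nc: "?r \<in> nc_rels k" using nc_isolate[OF nc_glue[OF less.prems]] ik by simp
      have "nonsingle k ?r \<subseteq> insert (Suc i) (nonsingle k r - {i})"
        using nonsingle_isolate[of k i ?r1] nonsingle_glue[OF q, of i "Suc i"] by blast
      then have "(\<Sum>i\<in>nonsingle k ?r. Suc k - i) \<le> (\<Sum>i\<in>insert (Suc i) (nonsingle k r - {i}). Suc k - i)"
        by (rule sum_mono2[rotated]) (use fin in auto)
      also have "\<dots> = (Suc k - Suc i) + (\<Sum>i\<in>nonsingle k r - {i}. Suc k - i)"
        using fin single by (subst sum.insert) (auto simp: nonsingle_def)
      also have "\<dots> < (Suc k - i) + (\<Sum>i\<in>nonsingle k r - {i}. Suc k - i)" using ik by simp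
      also have "\<dots> = (\<Sum>i\<in>nonsingle k r. Suc k - i)" using fin ins by (simp add: sum.remove)
      finally have "Q ?r" using less.hyps nc by blast
      then have "Q (glue i (Suc i) ?r)" using gl nc ik by blast
      moreover have "(i, Suc i) \<in> ?r1" using equiv_reflD[OF q, of i] equiv_reflD[OF q, of "Suc i"] ik
        by (auto simp: glue_iff)
      ultimately have "Q ?r1" using glue_isolate_undo[OF q1, of i "Suc i"] by simp
      then have "Q (isolate (Suc i) ?r1)"
        using iso[of ?r1 "Suc i"] nc_glue[OF less.prems ik] ik by simp
      then show ?thesis using isolate_glue_undo[OF q iA single] by simp
    qed
  qed
qed

section \<open>Block numbers and joins\<close>

definition nblocks :: "nat \<Rightarrow> nat rel \<Rightarrow> nat"
  where "nblocks k r = card ({1..k} // r)"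

definition join_rel :: "nat rel \<Rightarrow> nat rel \<Rightarrow> nat rel"
  where "join_rel r s = (r \<union> s)\<^sup>+"

text \<open>Turns the rules for class products into rules for the number of classes.\<close>
lemma class_prod_2: "class_prod A r (\<lambda>_. 2 :: nat) = 2 ^ card (A // r)"
  by (simp add: class_prod_def)

lemma nblocks_glue:
  assumes r: "equiv {1..k} r" and ij: "i \<in> {1..k}" "j \<in> {1..k}"
  shows "nblocks k r = nblocks k (glue i j r) + (if (i, j) \<in> r then 0 else 1)"
proof (cases "(i, j) \<in> r")
  case True
  then show ?thesis using glue_idem[OF r] by simp
next
  case False
  have "class_prod {1..k} r (\<lambda>_. 2 :: nat) = 2 * class_prod {1..k} (glue i j r) (\<lambda>_. 2)"
    by (rule class_prod_glue[OF _ r ij False]) (auto simp: congruent_def)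
  then have "(2::nat) ^ nblocks k r = 2 ^ Suc (nblocks k (glue i j r))"
    by (simp add: class_prod_2 nblocks_def)
  then show ?thesis using False by (simp only: power_inject_exp) simp
qed

lemma nblocks_isolate:
  assumes r: "equiv {1..k} r" and i: "i \<in> {1..k}"
  shows "nblocks k (isolate i r) = nblocks k r + (if r `` {i} = {i} then 0 else 1)"
proof (cases "r `` {i} = {i}")
  case True
  then show ?thesis using isolate_idem[OF r] by simp
next
  case False
  then obtain c where c: "(i, c) \<in> r" "c \<noteq> i" using equiv_reflD[OF r i] by blast
  have "class_prod {1..k} (isolate i r) ((\<lambda>_. 2 :: nat)(i := 2)) = 2 * class_prod {1..k} r (\<lambda>_. 2)"
    by (rule class_prod_isolate[OF _ r c]) (auto simp: congruent_def)
  moreover have "(\<lambda>_. 2 :: nat)(i := 2) = (\<lambda>_. 2)" by auto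
  ultimately have "(2::nat) ^ nblocks k (isolate i r) = 2 ^ Suc (nblocks k r)"
    by (simp add: class_prod_2 nblocks_def)
  then show ?thesis using False by (simp only: power_inject_exp) simp
qed

lemma equiv_join_rel:
  assumes r: "equiv A r" and s: "equiv A s"
  shows "equiv A (join_rel r s)"
proof (rule equivI)
  show "join_rel r s \<subseteq> A \<times> A"
    unfolding join_rel_def by (rule trancl_subset_Sigma) (use equiv_type[OF r] equiv_type[OF s] in blast)
  show "refl_on A (join_rel r s)"
    unfolding join_rel_def refl_on_def using equiv_reflD[OF r] by blast
  show "sym (join_rel r s)"
    unfolding join_rel_def using r s by (intro sym_trancl sym_Un) (auto elim: equivE)
  show "trans (join_rel r s)" unfolding join_rel_def by (rule trans_trancl)
qed

lemma join_rel_upper: "r \<subseteq> join_rel r s" "s \<subseteq> join_rel r s"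
  unfolding join_rel_def by auto

lemma join_rel_least:
  assumes "equiv A t" "r \<subseteq> t" "s \<subseteq> t"
  shows "join_rel r s \<subseteq> t"
proof -
  have "(r \<union> s)\<^sup>+ \<subseteq> t\<^sup>+" by (rule subsetI, erule trancl_mono) (use assms in blast)
  also have "t\<^sup>+ = t" using assms(1) by (intro trancl_id) (auto elim: equivE)
  finally show ?thesis by (simp add: join_rel_def)
qed

lemma join_rel_commute: "join_rel r s = join_rel s r"
  by (simp add: join_rel_def Un_commute)

lemma glue_mono_least:
  assumes t: "equiv A t" and "r \<subseteq> t" "(i, j) \<in> t"
  shows "glue i j r \<subseteq> t"
proof (rule subrelI)
  fix u v assume "(u, v) \<in> glue i j r"
  then show "(u, v) \<in> t"
    unfolding glue_iff using assms(2,3) equiv_symD[OF t] equiv_transD[OF t] by blast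
qed

text \<open>Both sides are the least equivalence relation that contains \<open>r\<close> and \<open>s\<close> and relates \<open>i\<close> to \<open>j\<close>.\<close>
lemma join_rel_glue:
  assumes r: "equiv A r" and s: "equiv A s" and ij: "i \<in> A" "j \<in> A"
  shows "join_rel (glue i j r) s = glue i j (join_rel r s)"
proof (rule equalityI)
  have J: "equiv A (join_rel r s)" by (rule equiv_join_rel[OF r s])
  have sub: "t \<subseteq> glue i j t" for t by (auto simp: glue_def)
  have g: "equiv A (glue i j (join_rel r s))" by (rule equiv_glue[OF J ij])
  have "(i, i) \<in> r" "(j, j) \<in> r" using equiv_reflD[OF r] ij by auto
  then have ij': "(i, j) \<in> glue i j r" by (auto simp: glue_iff)
  have "(i, j) \<in> glue i j (join_rel r s)"
    using equiv_reflD[OF J] ij by (auto simp: glue_iff)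
  then show "join_rel (glue i j r) s \<subseteq> glue i j (join_rel r s)"
    using join_rel_upper[of r s] join_rel_upper[of s r] sub[of "join_rel r s"] 
    by (intro join_rel_least[OF g] glue_mono_least[OF g]) (auto simp: join_rel_commute)
  have J': "equiv A (join_rel (glue i j r) s)" by (rule equiv_join_rel[OF equiv_glue[OF r ij] s])
  have "r \<subseteq> join_rel (glue i j r) s" using sub[of r] join_rel_upper(1)[of "glue i j r" s] by blast
  moreover have "s \<subseteq> join_rel (glue i j r) s" by (rule join_rel_upper(2))
  ultimately show "glue i j (join_rel r s) \<subseteq> join_rel (glue i j r) s"
    using ij' join_rel_upper(1)[of "glue i j r" s] by (intro glue_mono_least[OF J'] join_rel_least[OF J']) auto
qed

lemma isolate_mono: "r \<subseteq> s \<Longrightarrow> isolate i r \<subseteq> isolate i s"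
  by (auto simp: isolate_def)

text \<open>As \<open>i\<close> is a singleton of \<open>isolate i r\<close>, it can be linked to other points through \<open>s\<close> only.\<close>
lemma join_rel_isolate_class:
  assumes r: "equiv A r" and s: "equiv A s" and i: "i \<in> A"
  shows "join_rel (isolate i r) s `` {i} = {i} \<longleftrightarrow> s `` {i} = {i}"
proof
  assume "join_rel (isolate i r) s `` {i} = {i}"
  then show "s `` {i} = {i}"
    using join_rel_upper(2)[of s "isolate i r"] equiv_reflD[OF s i] by blast
next
  assume si: "s `` {i} = {i}"
  define J where "J = join_rel (isolate i r) s"
  have J: "equiv A J" unfolding J_def by (rule equiv_join_rel[OF equiv_isolate[OF r i] s])
  have "isolate i s = s" by (rule isolate_idem[OF s si])
  moreover have "isolate i (isolate i r) = isolate i r" by (auto simp: isolate_def)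
  moreover have "isolate i (isolate i r) \<subseteq> isolate i J" "isolate i s \<subseteq> isolate i J"
    unfolding J_def by (intro isolate_mono join_rel_upper)+
  ultimately have "J \<subseteq> isolate i J"
    using join_rel_least[OF equiv_isolate[OF J i]] unfolding J_def by simp
  then show "J `` {i} = {i}" unfolding J_def[symmetric]
    using equiv_reflD[OF J i] by (auto simp: isolate_def)
qed

text \<open>A chain between points other than \<open>i\<close> enters and leaves \<open>i\<close> through \<open>s\<close>, because \<open>i\<close> is a singleton of
\<open>isolate i r\<close>. By transitivity of \<open>s\<close> it can bypass \<open>i\<close>.\<close>
lemma isolate_join_rel:
  assumes r: "equiv A r" and s: "equiv A s" and i: "i \<in> A"
  shows "isolate i (join_rel (isolate i r) s) = join_rel (isolate i r) (isolate i s)"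
proof (rule equalityI)
  define J where "J = join_rel (isolate i r) s"
  define T where "T = join_rel (isolate i r) (isolate i s)"
  have J: "equiv A J" unfolding J_def by (rule equiv_join_rel[OF equiv_isolate[OF r i] s])
  have T: "equiv A T" unfolding T_def
    by (rule equiv_join_rel[OF equiv_isolate[OF r i] equiv_isolate[OF s i]])
  have up: "isolate i r \<subseteq> T" "isolate i s \<subseteq> T" unfolding T_def by (rule join_rel_upper)+
  have "isolate i (isolate i r) = isolate i r" by (auto simp: isolate_def)
  moreover have "isolate i (isolate i r) \<subseteq> isolate i J" "isolate i s \<subseteq> isolate i J"
    unfolding J_def by (intro isolate_mono join_rel_upper)+
  ultimately show "T \<subseteq> isolate i J"
    using join_rel_least[OF equiv_isolate[OF J i]] unfolding T_def by simp
  \<comment> \<open>while a chain from \<open>u\<close> stands at \<open>i\<close>, remember the point \<open>w\<close> from which \<open>s\<close> led there\<close>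
  have key: "if v = i then \<exists>w. w \<noteq> i \<and> (u, w) \<in> T \<and> (w, i) \<in> s else (u, v) \<in> T"
    if "(u, v) \<in> (isolate i r \<union> s)\<^sup>+" "u \<noteq> i" for u v
    using that
  proof (induction rule: trancl_induct)
    case (base v)
    have "u \<in> A" using base equiv_fieldD[OF s] equiv_fieldD[OF equiv_isolate[OF r i]] by blast
    then have uT: "(u, u) \<in> T" by (rule equiv_reflD[OF T])
    show ?case
    proof (cases "v = i")
      case True
      then have "(u, i) \<in> s" using base by (auto simp: isolate_iff)
      then show ?thesis using True uT base by auto
    next
      case False
      then have "(u, v) \<in> T" using base up by (auto simp: isolate_iff)
      then show ?thesis using False by simp
    qed
  next
    case (step v w)
    show ?case
    proof (cases "v = i")
      case True
      then obtain z where z: "z \<noteq> i" "(u, z) \<in> T" "(z, i) \<in> s" using step by auto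
      show ?thesis
      proof (cases "w = i")
        case True
        then show ?thesis using z by auto
      next
        case False
        then have "(i, w) \<in> s" using step(2) True by (auto simp: isolate_iff)
        then have "(z, w) \<in> s" using z equiv_transD[OF s] by blast
        then have "(z, w) \<in> T" using z False up by (auto simp: isolate_iff)
        then show ?thesis using z False equiv_transD[OF T] by auto
      qed
    next
      case vi: False
      then have uv: "(u, v) \<in> T" using step by auto
      show ?thesis
      proof (cases "w = i")
        case True
        then have "(v, i) \<in> s" using step(2) vi by (auto simp: isolate_iff)
        then show ?thesis using True uv vi by auto
      next
        case False
        then have "(v, w) \<in> T" using step(2) vi up by (auto simp: isolate_iff)
        then show ?thesis using False uv equiv_transD[OF T] by auto
      qed
    qed
  qed
  show "isolate i J \<subseteq> T"
  proof (rule subrelI)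
    fix u v assume "(u, v) \<in> isolate i J"
    then consider "u = i" "v = i" | "u \<noteq> i" "v \<noteq> i" "(u, v) \<in> J" by (auto simp: isolate_iff)
    then show "(u, v) \<in> T"
    proof cases
      case 1
      then show ?thesis using equiv_reflD[OF T i] by simp
    next
      case 2
      then show ?thesis using key[of u v] by (simp add: J_def join_rel_def)
    qed
  qed
qed

text \<open>The right-hand side is symmetric in \<open>r\<close> and \<open>s\<close>, which makes splitting off self-adjoint for the
loop form.\<close>
lemma nblocks_join_isolate:
  assumes r: "equiv {1..k} r" and s: "equiv {1..k} s" and i: "i \<in> {1..k}"
  shows "nblocks k (join_rel (isolate i r) s) + (if s `` {i} = {i} then 0 else 1) =
    nblocks k (join_rel (isolate i r) (isolate i s))"
  using nblocks_isolate[OF equiv_join_rel[OF equiv_isolate[OF r i] s] i]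
  unfolding isolate_join_rel[OF assms] join_rel_isolate_class[OF assms] by simp

section \<open>Forms with self-adjoint generators\<close>

definition glue_factor :: "'a::field \<Rightarrow> nat \<Rightarrow> nat rel \<Rightarrow> 'a"
  where "glue_factor x i r = (if (i, Suc i) \<in> r then x else 1)"

definition isolate_factor :: "'a::field \<Rightarrow> nat \<Rightarrow> nat rel \<Rightarrow> 'a"
  where "isolate_factor x i r = (if r `` {i} = {i} then x else 1)"

text \<open>The generators are self-adjoint. A generator maps a diagram to a diagram, with a factor \<open>x\<close> if a
closed loop is removed; the factors record this.\<close>
definition arc_invariant :: "'a::field \<Rightarrow> nat \<Rightarrow> (nat rel \<Rightarrow> nat rel \<Rightarrow> 'a) \<Rightarrow> bool"
  where "arc_invariant x k F \<longleftrightarrow> (\<forall>r\<in>nc_rels k. \<forall>s\<in>nc_rels k.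
    (\<forall>i. 1 \<le> i \<and> i < k \<longrightarrow>
      glue_factor x i r * F (glue i (Suc i) r) s = glue_factor x i s * F r (glue i (Suc i) s)) \<and>
    (\<forall>i. 1 \<le> i \<and> i \<le> k \<longrightarrow>
      isolate_factor x i r * F (isolate i r) s = isolate_factor x i s * F r (isolate i s)))"

text \<open>Moving generators from the first to the second argument reduces the first one to the partition into
singletons. As this partition is an eigenvector of every splitting generator, its pairing with \<open>s\<close> is
a nonzero multiple of its pairing with \<open>s\<close> after a point has been split off, and the second argument
reduces to singletons as well.\<close>
lemma arc_invariant_unique:
  assumes F: "arc_invariant x k F" and G: "arc_invariant x k G" and x: "x \<noteq> 0"
    and base: "F (Id_on {1..k}) (Id_on {1..k}) = G (Id_on {1..k}) (Id_on {1..k})"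
    and r: "r \<in> nc_rels k" and s: "s \<in> nc_rels k"
  shows "F r s = G r s"
proof -
  have nz: "glue_factor x i t \<noteq> 0" "isolate_factor x i t \<noteq> 0" for i t
    using x by (auto simp: glue_factor_def isolate_factor_def)
  let ?I = "Id_on {1..k}"
  have "F ?I s = G ?I s" if "s \<in> nc_rels k" for s
    using that
  proof (induction "card (nonsingle k s)" arbitrary: s rule: less_induct)
    case less
    have q: "equiv {1..k} s" using nc_relsD[OF less.prems] by blast
    show ?case
    proof (cases "nonsingle k s = {}")
      case True
      have "s = ?I" using nonsingle_empty[OF q True] .
      then show ?thesis using base by simp
    next
      case False
      then obtain i where i: "i \<in> nonsingle k s" by blast
      then have ik: "1 \<le> i" "i \<le> k" by (auto simp: nonsingle_def)
      have "card (nonsingle k (isolate i s)) < card (nonsingle k s)"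
      proof (rule psubset_card_mono)
        show "finite (nonsingle k s)" by (simp add: nonsingle_def)
        show "nonsingle k (isolate i s) \<subset> nonsingle k s" using nonsingle_isolate[of k i s] i by blast
      qed
      then have IH: "F ?I (isolate i s) = G ?I (isolate i s)"
        using less nc_isolate[OF less.prems ik] by blast
      have "?I `` {i} = {i}" using ik by auto
      then have I: "isolate i ?I = ?I"
        using isolate_idem[OF nc_relsD(1)[OF Id_on_nc]] by blast
      have "isolate_factor x i ?I * F ?I s = isolate_factor x i s * F ?I (isolate i s)"
        using F Id_on_nc less.prems ik unfolding arc_invariant_def by (metis I)
      moreover have "isolate_factor x i ?I * G ?I s = isolate_factor x i s * G ?I (isolate i s)"
        using G Id_on_nc less.prems ik unfolding arc_invariant_def by (metis I)
      ultimately show ?thesis using IH nz(2)[of i ?I] by (metis mult_left_cancel)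
    qed
  qed
  with r have "\<forall>s\<in>nc_rels k. F r s = G r s"
  proof (induction rule: nc_rels_induct)
    case discrete
    then show ?case by blast
  next
    case (glue r i)
    show ?case
    proof
      fix s assume s: "s \<in> nc_rels k"
      have "glue_factor x i r * F (glue i (Suc i) r) s = glue_factor x i r * G (glue i (Suc i) r) s"
        using F G glue s nc_glue[OF s glue.hyps(2,3)] unfolding arc_invariant_def by metis
      then show "F (glue i (Suc i) r) s = G (glue i (Suc i) r) s" using nz by simp
    qed
  next
    case (isolate r i)
    show ?case
    proof
      fix s assume s: "s \<in> nc_rels k"
      have "isolate_factor x i r * F (isolate i r) s = isolate_factor x i r * G (isolate i r) s"
        using F G isolate s nc_isolate[OF s isolate.hyps(2,3)] unfolding arc_invariant_def by metis
      then show "F (isolate i r) s = G (isolate i r) s" using nz by simp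
    qed
  qed
  then show ?thesis using s by blast
qed

context cheb_values
begin

section \<open>The path expansion of the loop form\<close>

text \<open>For noncrossing \<open>r\<close> and \<open>s\<close> the exponent is the number of closed loops formed by the arcs of \<open>r\<close>
above the line and those of \<open>s\<close> below it, by Euler's formula.\<close>
definition loop_form :: "nat \<Rightarrow> nat rel \<Rightarrow> nat rel \<Rightarrow> 'a"
  where "loop_form k r s =
    x powi (2 * int (nblocks k (join_rel r s)) - int (nblocks k r) - int (nblocks k s) + int k)"

definition path_form :: "nat \<Rightarrow> nat rel \<Rightarrow> nat rel \<Rightarrow> 'a"
  where "path_form k r s =
    (\<Sum>h\<in>walks (2 * k) 0. wt k h * amp k (region k r) h * amp k (region k s) h)"

lemma factor_powi: "(if c then x else 1) * x powi n = x powi (n + (if c then 1 else 0))"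
  using x_nz by (simp add: power_int_add mult.commute)

lemma arc_invariant_loop_form: "arc_invariant x k (loop_form k)"
  unfolding arc_invariant_def
proof (intro ballI conjI allI impI)
  fix r s i assume rs: "r \<in> nc_rels k" "s \<in> nc_rels k"
  then have r: "equiv {1..k} r" and s: "equiv {1..k} s" using nc_relsD by blast+
  show "glue_factor x i r * loop_form k (glue i (Suc i) r) s =
      glue_factor x i s * loop_form k r (glue i (Suc i) s)" if "1 \<le> i \<and> i < k"
  proof -
    have i: "i \<in> {1..k}" "Suc i \<in> {1..k}" using that by auto
    have "join_rel r (glue i (Suc i) s) = join_rel (glue i (Suc i) r) s"
      using join_rel_glue[OF r s i] join_rel_glue[OF s r i] by (simp add: join_rel_commute)
    then show ?thesis
      unfolding glue_factor_def loop_form_def factor_powi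
      using nblocks_glue[OF r i] nblocks_glue[OF s i] by (auto intro!: arg_cong[of _ _ "\<lambda>n. x powi n"])
  qed
  show "isolate_factor x i r * loop_form k (isolate i r) s =
      isolate_factor x i s * loop_form k r (isolate i s)" if "1 \<le> i \<and> i \<le> k"
  proof -
    have i: "i \<in> {1..k}" using that by auto
    have J: "nblocks k (join_rel (isolate i r) s) + (if s `` {i} = {i} then 0 else 1) =
        nblocks k (join_rel r (isolate i s)) + (if r `` {i} = {i} then 0 else 1)"
      using nblocks_join_isolate[OF r s i] nblocks_join_isolate[OF s r i]
      by (simp add: join_rel_commute)
    define p q where "p \<longleftrightarrow> r `` {i} = {i}" and "q \<longleftrightarrow> s `` {i} = {i}"
    show ?thesis
      using J unfolding isolate_factor_def loop_form_def factor_powi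
        nblocks_isolate[OF r i] nblocks_isolate[OF s i] p_def[symmetric] q_def[symmetric]
      by (intro arg_cong[of _ _ "\<lambda>n. x powi n"]) (cases p; cases q; simp)
  qed
qed

lemma path_form_arc:
  assumes r: "r \<in> nc_rels k" and s: "s \<in> nc_rels k" and j: "1 \<le> j" "j < 2 * k"
    and r': "region k r' = glue (j - 1) (Suc j) (isolate j (region k r))"
    and s': "region k s' = glue (j - 1) (Suc j) (isolate j (region k s))"
  shows "(if region k r `` {j} = {j} then x else 1) * path_form k r' s =
    (if region k s `` {j} = {j} then x else 1) * path_form k r s'"
proof -
  have "(if region k r `` {j} = {j} then x else 1) * path_form k r' s =
      (\<Sum>h\<in>walks (2 * k) 0. wt k h * arc_op j (amp k (region k r)) h * amp k (region k s) h)"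
    unfolding path_form_def sum_distrib_left
    by (rule sum.cong[OF refl]) (simp only: arc_op_amp[OF r j] r' mult_ac)
  also have "\<dots> = (\<Sum>h\<in>walks (2 * k) 0. wt k h * amp k (region k r) h * arc_op j (amp k (region k s)) h)"
    by (rule arc_op_adjoint[OF j])
  also have "\<dots> = (if region k s `` {j} = {j} then x else 1) * path_form k r s'"
    unfolding path_form_def sum_distrib_left
    by (rule sum.cong[OF refl]) (simp only: arc_op_amp[OF s j] s' mult_ac)
  finally show ?thesis .
qed

lemma arc_invariant_path_form: "arc_invariant x k (path_form k)"
  unfolding arc_invariant_def
proof (intro ballI conjI allI impI)
  fix r s i assume rs: "r \<in> nc_rels k" "s \<in> nc_rels k"
  show "glue_factor x i r * path_form k (glue i (Suc i) r) s =
      glue_factor x i s * path_form k r (glue i (Suc i) s)" if i: "1 \<le> i \<and> i < k"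
  proof -
    have j: "1 \<le> 2 * i" "2 * i < 2 * k" using i by auto
    obtain m where m: "i = Suc m" using i by (cases i) auto
    have p: "2 * i - 1 = Suc (2 * m)" "2 * i + 1 = Suc (2 * i)" using m by auto
    have f: "region k t `` {2 * i} = {2 * i} \<longleftrightarrow> (i, Suc i) \<in> t" if t: "t \<in> nc_rels k" for t
      using region_alone_iff[OF t j] mem_region_odd[OF nc_relsD(1)[OF t], of m i]
      unfolding p m[symmetric] by simp
    have e: "region k (glue i (Suc i) t) = glue (2 * i - 1) (Suc (2 * i)) (isolate (2 * i) (region k t))"
      if t: "t \<in> nc_rels k" for t
      using region_glue[OF nc_relsD(1)[OF t]] i by simp
    show ?thesis
      using path_form_arc[OF rs j e e] rs unfolding glue_factor_def f[OF rs(1)] f[OF rs(2)] by blast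
  qed
  show "isolate_factor x i r * path_form k (isolate i r) s =
      isolate_factor x i s * path_form k r (isolate i s)" if i: "1 \<le> i \<and> i \<le> k"
  proof -
    have j: "1 \<le> 2 * i - 1" "2 * i - 1 < 2 * k" using i by auto
    obtain m where m: "i = Suc m" using i by (cases i) auto
    have p: "2 * i - 1 - 1 = 2 * m" "2 * i - 1 + 1 = 2 * Suc m" using m by auto
    have f: "region k t `` {2 * i - 1} = {2 * i - 1} \<longleftrightarrow> t `` {i} = {i}" if t: "t \<in> nc_rels k" for t
    proof -
      have "region k t `` {2 * i - 1} = {2 * i - 1} \<longleftrightarrow> gap t m i"
        using region_alone_iff[OF t j] i m unfolding p mem_region_even by simp
      also have "\<dots> \<longleftrightarrow> t `` {i} = {i}"
        using gap_single_iff[OF nc_relsD(1)[OF t], of m] equiv_reflD[OF nc_relsD(1)[OF t], of i] i m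
        by auto
      finally show ?thesis .
    qed
    have "2 * i - 2 = 2 * i - 1 - 1" "2 * i = Suc (2 * i - 1)" using i by auto
    then have e: "region k (isolate i t) =
        glue (2 * i - 1 - 1) (Suc (2 * i - 1)) (isolate (2 * i - 1) (region k t))"
      if t: "t \<in> nc_rels k" for t
      using region_isolate[OF t] i by metis
    show ?thesis
      using path_form_arc[OF rs j e e] rs unfolding isolate_factor_def f[OF rs(1)] f[OF rs(2)] by blast
  qed
qed

text \<open>By \<open>profile_up_iff\<close> the amplitude has one factor for each rising step. In the square times the weight
this leaves the factor itself at rising steps and the inverse from the weight at falling steps.\<close>
lemma norm_profile:
  assumes r: "r \<in> nc_rels k"
  shows "wt k (profile k r) * (amp k (region k r) (profile k r))\<^sup>2 =
    (\<Prod>j<2 * k. if profile k r (Suc j) = Suc (profile k r j) then P (profile k r (Suc j))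
      else inverse (P (profile k r (Suc j))))"
proof -
  let ?h = "profile k r"
  define up where "up j \<longleftrightarrow> ?h (Suc j) = Suc (?h j)" for j
  define mn where "mn u \<longleftrightarrow> (\<forall>v. (v, u) \<in> region k r \<longrightarrow> u \<le> v)" for u
  have h0: "?h 0 = 0" using profile_in_walks[OF nc_relsD(1)[OF r]] by (simp add: walks_def)
  have wt: "wt k ?h = (\<Prod>j<2 * k. inverse (P (?h (Suc j))))"
    unfolding wt_def lessThan_Suc_atMost[symmetric] prod.lessThan_Suc_shift by (simp add: h0 P_0)
  have "amp k (region k r) ?h = class_prod {..2 * k} (region k r) (P \<circ> ?h)"
    using profile_respects[OF r] by (simp add: amp_def)
  also have "\<dots> = (\<Prod>u\<in>{u \<in> {..2 * k}. mn u}. P (?h u))"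
    unfolding class_prod_minima[OF finite_atMost equiv_region[OF nc_relsD(1)[OF r]]] mn_def by simp
  also have "\<dots> = (\<Prod>u\<le>2 * k. if mn u then P (?h u) else 1)"
    by (rule prod.inter_filter) simp
  also have "\<dots> = (\<Prod>j<2 * k. if mn (Suc j) then P (?h (Suc j)) else 1)"
    unfolding lessThan_Suc_atMost[symmetric] prod.lessThan_Suc_shift by (simp add: h0 P_0)
  also have "\<dots> = (\<Prod>j<2 * k. if up j then P (?h (Suc j)) else 1)"
    using profile_up_iff[OF r] by (intro prod.cong) (auto simp: up_def mn_def)
  finally have amp: "amp k (region k r) ?h = \<dots>" .
  have "wt k ?h * (amp k (region k r) ?h)\<^sup>2 =
      (\<Prod>j<2 * k. inverse (P (?h (Suc j))) * (if up j then P (?h (Suc j)) else 1)\<^sup>2)"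
    unfolding wt amp by (simp add: prod.distrib prod_power_distrib)
  also have "\<dots> = (\<Prod>j<2 * k. if up j then P (?h (Suc j)) else inverse (P (?h (Suc j))))"
    using P_nz by (intro prod.cong) (auto simp: power2_eq_square)
  finally show ?thesis by (simp add: up_def)
qed

text \<open>For singletons all even positions see one region, so every contributing walk returns to \<open>0\<close> after
every second step.\<close>
lemma path_form_Id: "path_form k (Id_on {1..k}) (Id_on {1..k}) = x ^ k"
proof -
  let ?I = "Id_on {1..k}"
  let ?h = "profile k ?I"
  let ?R = "region k ?I"
  have hw: "?h \<in> walks (2 * k) 0" by (rule profile_in_walks[OF nc_relsD(1)[OF Id_on_nc]])
  have hr: "?h respects ?R" by (rule profile_respects[OF Id_on_nc])
  have zero: "g j = 0" if g: "g \<in> walks (2 * k) 0" "g respects ?R" and j: "even j" "j \<le> 2 * k" for g j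
  proof -
    obtain a where a: "j = 2 * a" using j by blast
    have "gap ?I 0 a" by (auto simp: gap_def)
    then have "(2 * 0, 2 * a) \<in> ?R" using j a unfolding mem_region_even by simp
    then have "g (2 * 0) = g (2 * a)" by (rule congruentD[OF g(2)])
    then show ?thesis using a g(1) by (simp add: walks_def)
  qed
  have only: "amp k ?R g = 0" if g: "g \<in> walks (2 * k) 0 - {?h}" for g
  proof -
    have "\<not> g respects ?R"
    proof
      assume "g respects ?R"
      then have "g = ?h" using walk_zero_even_unique[of g "2 * k" 0 ?h] zero g hw hr by blast
      then show False using g by simp
    qed
    then show ?thesis by (simp add: amp_def)
  qed
  have "path_form k ?I ?I = wt k ?h * (amp k ?R ?h)\<^sup>2"
  proof -
    have "(\<Sum>g\<in>walks (2 * k) 0 - {?h}. wt k g * amp k ?R g * amp k ?R g) = 0"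
      by (intro sum.neutral ballI) (simp only: only mult_zero_right)
    then show ?thesis
      unfolding path_form_def sum.remove[OF finite_walks hw] power2_eq_square by (simp only: add_0_right mult.assoc)
  qed
  also have "\<dots> = (\<Prod>j<2 * k. if even j then x else 1)"
    unfolding norm_profile[OF Id_on_nc]
  proof (rule prod.cong[OF refl])
    fix j assume j: "j \<in> {..<2 * k}"
    show "(if ?h (Suc j) = Suc (?h j) then P (?h (Suc j)) else inverse (P (?h (Suc j)))) =
        (if even j then x else 1)"
    proof (cases "even j")
      case True
      then have "?h j = 0" using zero[OF hw hr] j by simp
      then show ?thesis using walk_step[OF hw, of j] j True P_1 by simp
    next
      case False
      then have "?h (Suc j) = 0" using zero[OF hw hr, of "Suc j"] j by simp
      then show ?thesis using False P_0 by simp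
    qed
  qed
  also have "\<dots> = x ^ k" by (induction k) (simp_all add: lessThan_Suc)
  finally show ?thesis .
qed

lemma loop_form_eq_path_form:
  assumes "r \<in> nc_rels k" "s \<in> nc_rels k"
  shows "loop_form k r s = path_form k r s"
proof (rule arc_invariant_unique[OF arc_invariant_loop_form arc_invariant_path_form x_nz _ assms])
  let ?I = "Id_on {1..k}"
  have "{1..k} // ?I = (\<lambda>i. {i}) ` {1..k}" by (auto simp: quotient_def)
  then have "nblocks k ?I = k" by (simp add: nblocks_def card_image)
  moreover have "join_rel ?I ?I = ?I" unfolding join_rel_def
    by (simp only: Un_absorb, rule trancl_id) (auto simp: trans_def)
  ultimately show "loop_form k ?I ?I = path_form k ?I ?I"
    unfolding path_form_Id loop_form_def by (simp only:) simp
qed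

lemma profile_le_of_amp_nonzero:
  assumes "r \<in> nc_rels k" "s \<in> nc_rels k" "amp k (region k r) (profile k s) \<noteq> 0"
  shows "profile k s j \<le> profile k r j"
  using assms profile_in_walks[OF nc_relsD(1)[OF assms(2)]]
  by (intro walk_le_profile) (auto simp: amp_def split: if_splits)

end

section \<open>Counting walks\<close>

definition extend_walk :: "nat \<Rightarrow> nat \<Rightarrow> (nat \<Rightarrow> nat) \<Rightarrow> nat \<Rightarrow> nat"
  where "extend_walk m e h = (\<lambda>j. if j \<le> m then h j else e)"

lemma walks_Suc:
  "walks (Suc m) e = extend_walk m e ` (walks m (Suc e) \<union> (if e = 0 then {} else walks m (e - 1)))"
proof (intro equalityI subsetI)
  fix h assume h: "h \<in> walks (Suc m) e"
  define g where "g j = (if j \<le> m then h j else h m)" for j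
  have "h (Suc m) = e" using h by (simp add: walks_def)
  then have "h m = Suc e \<or> e = Suc (h m)" using walk_step[OF h, of m] by auto
  moreover have "g \<in> walks m (h m)" using h by (auto simp: walks_def g_def)
  ultimately have "g \<in> walks m (Suc e) \<union> (if e = 0 then {} else walks m (e - 1))" by auto
  moreover have "h = extend_walk m e g"
    using h by (auto simp: extend_walk_def g_def walks_def)
  ultimately show "h \<in> extend_walk m e ` (walks m (Suc e) \<union> (if e = 0 then {} else walks m (e - 1)))"
    by blast
next
  fix h assume "h \<in> extend_walk m e ` (walks m (Suc e) \<union> (if e = 0 then {} else walks m (e - 1)))"
  then obtain g d where g: "h = extend_walk m e g" "g \<in> walks m d" "d = Suc e \<or> e = Suc d"
    by (auto split: if_splits)
  have "h (Suc j) = Suc (h j) \<or> h j = Suc (h (Suc j))" if "j < Suc m" for j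
  proof (cases "j = m")
    case True
    then show ?thesis using g by (auto simp: extend_walk_def walks_def)
  next
    case False
    then show ?thesis using that walk_step[OF g(2), of j] g(1) by (simp add: extend_walk_def)
  qed
  then show "h \<in> walks (Suc m) e" using g by (auto simp: walks_def extend_walk_def)
qed

lemma sum_walks_Suc:
  "(\<Sum>h\<in>walks (Suc m) e. f h) = (\<Sum>h\<in>walks m (Suc e). f (extend_walk m e h)) +
    (if e = 0 then 0 else \<Sum>h\<in>walks m (e - 1). f (extend_walk m e h))"
proof -
  let ?B = "if e = 0 then {} else walks m (e - 1)"
  have inj: "inj_on (extend_walk m e) (walks m (Suc e) \<union> ?B)"
  proof (rule inj_onI)
    fix g h assume g: "g \<in> walks m (Suc e) \<union> ?B" and h: "h \<in> walks m (Suc e) \<union> ?B"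
      and eq: "extend_walk m e g = extend_walk m e h"
    have le: "g j = h j" if "j \<le> m" for j using fun_cong[OF eq, of j] that by (simp add: extend_walk_def)
    obtain d where "g \<in> walks m d" using g by (auto split: if_splits)
    moreover obtain d' where "h \<in> walks m d'" using h by (auto split: if_splits)
    ultimately have "g j = g m" "h j = h m" if "m \<le> j" for j using that by (auto simp: walks_def)
    then show "g = h" using le by (metis ext linear order_refl)
  qed
  have disj: "walks m (Suc e) \<inter> ?B = {}" by (auto simp: walks_def split: if_splits)
  have "(\<Sum>h\<in>walks (Suc m) e. f h) = (\<Sum>h\<in>walks m (Suc e) \<union> ?B. f (extend_walk m e h))"
    unfolding walks_Suc sum.reindex[OF inj] by simp
  also have "\<dots> = (\<Sum>h\<in>walks m (Suc e). f (extend_walk m e h)) + (\<Sum>h\<in>?B. f (extend_walk m e h))"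
    by (rule sum.union_disjoint[OF finite_walks _ disj]) (simp add: finite_walks)
  finally show ?thesis by simp
qed

definition num_walks :: "nat \<Rightarrow> nat \<Rightarrow> int"
  where "num_walks m e = int (card (walks m e))"

lemma num_walks_0: "num_walks 0 e = (if e = 0 then 1 else 0)"
proof -
  have "walks 0 e = (if e = 0 then {\<lambda>_. 0} else {})" by (auto simp: walks_def)
  then show ?thesis by (simp add: num_walks_def)
qed

lemma num_walks_Suc_0: "num_walks (Suc m) 0 = num_walks m 1"
  using sum_walks_Suc[of "\<lambda>_. 1 :: int" m 0] by (simp add: num_walks_def)

lemma num_walks_Suc_Suc: "num_walks (Suc m) (Suc e) = num_walks m e + num_walks m (Suc (Suc e))"
  using sum_walks_Suc[of "\<lambda>_. 1 :: int" m "Suc e"] by (simp add: num_walks_def)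

lemma ibinom_Suc: "ibinom (Suc m) j = ibinom m j + ibinom m (j - 1)"
proof -
  consider "j < 0" | "j = 0" | i where "j = int (Suc i)"
    by (metis int_cases neg_int_cases not_less nonneg_int_cases old.nat.exhaust of_nat_0 linorder_neqE_linordered_idom)
  then show ?thesis by cases (auto simp: ibinom_def nat_add_distrib)
qed

lemma ibinom_middle: "int m = 2 * j - 1 \<Longrightarrow> ibinom m j = ibinom m (j - 1)"
proof -
  assume m: "int m = 2 * j - 1"
  then have j: "j \<ge> 1" by simp
  define i where "i = nat (j - 1)"
  have "m = 2 * i + 1" "nat j = Suc i" using m j by (simp_all add: i_def)
  then show ?thesis using j binomial_symmetric[of i "2 * i + 1"] by (simp add: ibinom_def i_def)
qed

text \<open>The ballot numbers. The boundary case \<open>e = 0\<close> needs that the two middle binomial coefficients of an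
odd row agree.\<close>
lemma num_walks_ibinom:
  "int e + 2 * j = int m \<Longrightarrow> num_walks m e = ibinom m j - ibinom m (j - 1)"
proof (induction m arbitrary: e j)
  case 0
  then have "j = 0 \<and> e = 0 \<or> j < 0 \<and> e > 0" by auto
  then show ?case by (auto simp: num_walks_0 ibinom_def)
next
  case (Suc m)
  show ?case
  proof (cases e)
    case 0
    have "num_walks (Suc m) e = ibinom m (j - 1) - ibinom m (j - 1 - 1)"
      unfolding 0 num_walks_Suc_0 by (rule Suc.IH) (use Suc.prems 0 in simp)
    moreover have "ibinom m j = ibinom m (j - 1)" by (rule ibinom_middle) (use Suc.prems 0 in simp)
    ultimately show ?thesis unfolding ibinom_Suc by simp
  next
    case (Suc d)
    have "num_walks m d = ibinom m j - ibinom m (j - 1)"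
      by (rule Suc.IH) (use Suc.prems Suc in simp)
    moreover have "num_walks m (Suc (Suc d)) = ibinom m (j - 1) - ibinom m (j - 1 - 1)"
      by (rule Suc.IH) (use Suc.prems Suc in simp)
    ultimately show ?thesis unfolding Suc num_walks_Suc_Suc ibinom_Suc by simp
  qed
qed

section \<open>Counting rises and falls\<close>

definition net_rises :: "nat \<Rightarrow> nat \<Rightarrow> (nat \<Rightarrow> nat) \<Rightarrow> int"
  where "net_rises m r h = (\<Sum>j<m. if h (Suc j) = r then (if h (Suc j) = Suc (h j) then 1 else -1) else 0)"

lemma net_rises_extend:
  assumes "h \<in> walks m d"
  shows "net_rises (Suc m) r (extend_walk m e h) =
    net_rises m r h + (if e = r then (if e = Suc d then 1 else -1) else 0)"
proof -
  have "net_rises m r (extend_walk m e h) = net_rises m r h"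
    unfolding net_rises_def by (intro sum.cong) (auto simp: extend_walk_def)
  moreover have "h m = d" using assms by (simp add: walks_def)
  ultimately show ?thesis by (simp add: net_rises_def extend_walk_def)
qed

definition total_rises :: "nat \<Rightarrow> nat \<Rightarrow> nat \<Rightarrow> int"
  where "total_rises m e r = (\<Sum>h\<in>walks m e. net_rises m r h)"

text \<open>The recursion of \<open>num_walks\<close> with a source at \<open>e = r\<close> from the last step.\<close>
lemma total_rises_Suc:
  "total_rises (Suc m) e r = total_rises m (Suc e) r - (if e = r then num_walks m (Suc e) else 0) +
    (if e = 0 then 0 else total_rises m (e - 1) r + (if e = r then num_walks m (e - 1) else 0))"
proof -
  have *: "(\<Sum>h\<in>walks m d. net_rises (Suc m) r (extend_walk m e h)) =
      total_rises m d r + (if e = r then (if e = Suc d then 1 else -1) else 0) * num_walks m d" for d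
    by (simp add: total_rises_def num_walks_def sum.distrib net_rises_extend cong: sum.cong)
  show ?thesis unfolding total_rises_def[of "Suc m"] sum_walks_Suc * by simp
qed

text \<open>Both terms satisfy the recursion of \<open>num_walks\<close> away from \<open>e = r\<close>, and they cancel at the boundary
\<open>e = -1\<close>, where both arguments are \<open>2 r + 1\<close>. At \<open>e = r\<close> the bend of \<open>max e (2 r - e)\<close> produces the source
term.\<close>
lemma total_rises_eq:
  assumes "1 \<le> r"
  shows "total_rises m e r = num_walks m (max e (2 * r - e)) - num_walks m (2 * r + e + 2)"
proof (induction m arbitrary: e)
  case 0
  then show ?case using assms by (auto simp: total_rises_def net_rises_def num_walks_0)
next
  case (Suc m)
  have step: "num_walks (Suc m) (2 * r + e + 2) = num_walks m (2 * r + e + 1) + num_walks m (2 * r + e + 3)"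
    using num_walks_Suc_Suc[of m "2 * r + e + 1"] by (simp add: eval_nat_numeral)
  consider "e = r" | "e < r" | "r < e" by linarith
  then show ?case
  proof cases
    case 1
    then obtain d where d: "e = Suc d" "r = Suc d" using assms by (cases e) auto
    have m: "max (Suc e) (2 * r - Suc e) = Suc (Suc d)" "max (e - 1) (2 * r - (e - 1)) = Suc (Suc d)"
      "max e (2 * r - e) = Suc d" using 1 d by auto
    show ?thesis
      unfolding total_rises_Suc Suc.IH step m num_walks_Suc_Suc by (simp add: d eval_nat_numeral)
  next
    case 2
    then obtain a where a: "2 * r - e = Suc a" by (metis Suc_pred' zero_less_diff less_add_same_cancel1 mult_2 less_trans trans_less_add2)
    have m: "max (Suc e) (2 * r - Suc e) = a" "max e (2 * r - e) = Suc a" using 2 a by auto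
    show ?thesis
    proof (cases e)
      case 0
      show ?thesis unfolding total_rises_Suc Suc.IH step m num_walks_Suc_Suc using 2 0 a
        by (simp add: eval_nat_numeral)
    next
      case (Suc d)
      have m': "max (e - 1) (2 * r - (e - 1)) = Suc (Suc a)" using 2 a Suc by auto
      show ?thesis unfolding total_rises_Suc Suc.IH step m m' num_walks_Suc_Suc using 2 Suc
        by (simp add: eval_nat_numeral)
    qed
  next
    case 3
    then obtain d where d: "e = Suc d" by (cases e) auto
    have m: "max (Suc e) (2 * r - Suc e) = Suc e" "max e (2 * r - e) = Suc d"
      "max (e - 1) (2 * r - (e - 1)) = d" using 3 d by auto
    show ?thesis unfolding total_rises_Suc Suc.IH step m num_walks_Suc_Suc using 3 d
      by (simp add: eval_nat_numeral)
  qed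
qed

lemma total_rises_Dyck:
  assumes "1 \<le> r"
  shows "total_rises (2 * k) 0 r = d_coef k (int r)"
proof -
  have "num_walks (2 * k) (2 * r) = f_coef k (int r)"
    using num_walks_ibinom[of "2 * r" "int k - int r" "2 * k"] by (simp add: f_coef_def)
  moreover have "num_walks (2 * k) (2 * r + 2) = f_coef k (int r + 1)"
    using num_walks_ibinom[of "2 * r + 2" "int k - (int r + 1)" "2 * k"] by (simp add: f_coef_def)
  ultimately show ?thesis using total_rises_eq[OF assms, of "2 * k" 0] by (simp add: d_coef_def)
qed

lemma d_coef_eq_0: "int k < r \<Longrightarrow> d_coef k r = 0"
  by (simp add: d_coef_def f_coef_def ibinom_def)

lemma power_int_sum:
  assumes "(a :: 'a::field) \<noteq> 0"
  shows "a powi (\<Sum>i\<in>I. f i) = (\<Prod>i\<in>I. a powi f i)"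
  using assms by (induction I rule: infinite_finite_induct) (simp_all add: power_int_add)

context cheb_values
begin

lemma prod_steps_eq:
  assumes h: "h \<in> walks m e"
  shows "(\<Prod>j<m. if h (Suc j) = Suc (h j) then P (h (Suc j)) else inverse (P (h (Suc j)))) =
    (\<Prod>r\<le>m. P r powi net_rises m r h)"
proof -
  have "(\<Prod>r\<le>m. P r powi net_rises m r h) = (\<Prod>r\<le>m. \<Prod>j<m. P r powi
      (if h (Suc j) = r then (if h (Suc j) = Suc (h j) then 1 else -1) else 0))"
    unfolding net_rises_def by (simp add: power_int_sum[OF P_nz])
  also have "\<dots> = (\<Prod>j<m. \<Prod>r\<le>m. P r powi
      (if h (Suc j) = r then (if h (Suc j) = Suc (h j) then 1 else -1) else 0))"
    by (rule prod.swap)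
  also have "\<dots> = (\<Prod>j<m. if h (Suc j) = Suc (h j) then P (h (Suc j)) else inverse (P (h (Suc j))))"
  proof (rule prod.cong[OF refl])
    fix j assume "j \<in> {..<m}"
    then have "h (Suc j) \<in> {..m}" using walks_le[OF h, of "Suc j"] by auto
    have "(\<Prod>r\<le>m. P r powi (if h (Suc j) = r then (if h (Suc j) = Suc (h j) then 1 else -1) else 0)) =
        (\<Prod>r\<le>m. if r = h (Suc j) then P r powi (if h (Suc j) = Suc (h j) then 1 else -1) else 1)"
      by (intro prod.cong) auto
    also have "\<dots> = P (h (Suc j)) powi (if h (Suc j) = Suc (h j) then 1 else -1)"
      using \<open>h (Suc j) \<in> {..m}\<close> by (simp add: prod.delta)
    finally show "(\<Prod>r\<le>m. P r powi (if h (Suc j) = r then (if h (Suc j) = Suc (h j) then 1 else -1) else 0)) =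
        (if h (Suc j) = Suc (h j) then P (h (Suc j)) else inverse (P (h (Suc j))))"
      by (simp add: power_int_minus)
  qed
  finally show ?thesis by simp
qed

lemma prod_walks_steps:
  "(\<Prod>h\<in>walks (2 * k) 0. \<Prod>j<2 * k. if h (Suc j) = Suc (h j) then P (h (Suc j))
      else inverse (P (h (Suc j)))) = (\<Prod>r = 1..k. P r powi d_coef k (int r))"
proof -
  have "(\<Prod>h\<in>walks (2 * k) 0. \<Prod>j<2 * k. if h (Suc j) = Suc (h j) then P (h (Suc j))
      else inverse (P (h (Suc j)))) = (\<Prod>h\<in>walks (2 * k) 0. \<Prod>r\<le>2 * k. P r powi net_rises (2 * k) r h)"
    by (intro prod.cong prod_steps_eq) auto
  also have "\<dots> = (\<Prod>r\<le>2 * k. P r powi total_rises (2 * k) 0 r)"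
    by (subst prod.swap) (simp add: total_rises_def power_int_sum[OF P_nz])
  also have "\<dots> = (\<Prod>r\<in>{1..k}. P r powi d_coef k (int r))"
  proof (rule prod.mono_neutral_cong_right)
    show "\<forall>r\<in>{..2 * k} - {1..k}. P r powi total_rises (2 * k) 0 r = 1"
    proof
      fix r assume "r \<in> {..2 * k} - {1..k}"
      then consider "r = 0" | "k < r" by fastforce
      then show "P r powi total_rises (2 * k) 0 r = 1"
        by cases (auto simp: P_0 total_rises_Dyck d_coef_eq_0)
    qed
  qed (auto simp: total_rises_Dyck)
  finally show ?thesis .
qed

end

section \<open>Triangular matrices\<close>

text \<open>A permutation with nonzero contribution lowers \<open>\<mu>\<close> at every index that it moves. As it preserves the
sum of \<open>\<mu>\<close>, it moves none. The measure replaces an ordering of the rows.\<close>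
lemma det_triangular_measure:
  fixes A :: "'a::comm_ring_1 mat" and \<mu> :: "nat \<Rightarrow> nat"
  assumes A: "A \<in> carrier_mat n n"
    and tri: "\<And>i l. i < n \<Longrightarrow> l < n \<Longrightarrow> i \<noteq> l \<Longrightarrow> A $$ (i, l) \<noteq> 0 \<Longrightarrow> \<mu> l < \<mu> i"
  shows "det A = (\<Prod>i<n. A $$ (i, i))"
proof -
  have zero: "signof p * (\<Prod>i = 0..<n. A $$ (i, p i)) = 0" if p: "p permutes {0..<n}" "p \<noteq> id" for p
  proof (rule ccontr)
    assume "signof p * (\<Prod>i = 0..<n. A $$ (i, p i)) \<noteq> 0"
    then have "(\<Prod>i = 0..<n. A $$ (i, p i)) \<noteq> 0" by auto
    then have nz: "A $$ (i, p i) \<noteq> 0" if "i < n" for i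
      using that by (metis atLeast0LessThan finite_lessThan lessThan_iff prod_zero)
    have pn: "p i < n" if "i < n" for i using permutes_in_image[OF p(1), of i] that by simp
    have le: "\<mu> (p i) \<le> \<mu> i" if "i < n" for i
      using tri[of i "p i"] nz[OF that] pn[OF that] that by (cases "i = p i") auto
    obtain i where i: "p i \<noteq> i" using p(2) by (auto simp: fun_eq_iff)
    then have "i < n" using p(1) by (meson atLeastLessThan_iff not_le permutes_def zero_le)
    then have "\<mu> (p i) < \<mu> i" using tri[of i "p i"] nz pn i by auto
    then have "(\<Sum>i = 0..<n. \<mu> (p i)) < (\<Sum>i = 0..<n. \<mu> i)"
      using le \<open>i < n\<close> by (intro sum_strict_mono_ex1) auto
    moreover have "(\<Sum>i = 0..<n. \<mu> (p i)) = (\<Sum>i = 0..<n. \<mu> i)"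
      using sum.permute[OF p(1), of \<mu>] by (simp add: o_def)
    ultimately show False by simp
  qed
  have "det A = (\<Sum>p | p permutes {0..<n}. signof p * (\<Prod>i = 0..<n. A $$ (i, p i)))"
    by (rule det_def'[OF A])
  also have "\<dots> = signof id * (\<Prod>i = 0..<n. A $$ (i, id i))"
    by (subst sum.remove[of _ id]) (auto simp: permutes_id zero finite_permutations)
  finally show ?thesis by (simp add: atLeast0LessThan)
qed

section \<open>Set partitions as equivalence relations\<close>

definition same_block :: "'b set set \<Rightarrow> 'b rel"
  where "same_block Q = {(u, v). \<exists>B\<in>Q. u \<in> B \<and> v \<in> B}"

lemma equiv_same_block: "partition_on A Q \<Longrightarrow> equiv A (same_block Q)"
  using equiv_partition_on[of A Q] by (simp add: same_block_def)

lemma quotient_same_block: "partition_on A Q \<Longrightarrow> A // same_block Q = Q"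
  using partition_on_eq_quotient[of A Q] by (simp add: same_block_def)

lemma same_block_quotient:
  assumes "equiv A r"
  shows "same_block (A // r) = r"
proof (intro equalityI subrelI)
  fix u v assume "(u, v) \<in> same_block (A // r)"
  then obtain w where "(w, u) \<in> r" "(w, v) \<in> r" by (auto simp: same_block_def elim!: quotientE)
  then show "(u, v) \<in> r" using equiv_symD[OF assms] equiv_transD[OF assms] by blast
next
  fix u v assume uv: "(u, v) \<in> r"
  then have "u \<in> A" using equiv_fieldD[OF assms] by blast
  then show "(u, v) \<in> same_block (A // r)"
    unfolding same_block_def using uv equiv_reflD[OF assms] by (auto intro!: bexI[of _ "r `` {u}"] quotientI)
qed

lemma noncrossing_iff:
  assumes Q: "partition_on A Q"
  shows "noncrossing Q \<longleftrightarrow> noncrossing_rel (same_block Q)"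
proof -
  have uniq: "B = C" if "B \<in> Q" "C \<in> Q" "u \<in> B" "u \<in> C" for B C u
    using partition_onD2[OF Q] that by (auto simp: disjoint_def)
  show ?thesis
  proof
    assume nc: "noncrossing Q"
    show "noncrossing_rel (same_block Q)" unfolding noncrossing_rel_def
    proof (intro allI impI, elim conjE)
      fix a b c d assume A: "a < b" "b < c" "c < d" "(a, c) \<in> same_block Q" "(b, d) \<in> same_block Q"
      then obtain B C where BC: "B \<in> Q" "C \<in> Q" "a \<in> B" "c \<in> B" "b \<in> C" "d \<in> C"
        by (auto simp: same_block_def)
      have "B = C"
      proof (rule ccontr)
        assume "B \<noteq> C"
        from nc[unfolded noncrossing_def, rule_format, OF BC(1,2) this]
        show False using A(1-3) BC by blast
      qed
      then show "(a, b) \<in> same_block Q" using BC by (auto simp: same_block_def)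
    qed
  next
    assume nc: "noncrossing_rel (same_block Q)"
    show "noncrossing Q" unfolding noncrossing_def
    proof (intro ballI impI notI, elim exE conjE)
      fix B C a b c d assume A: "B \<in> Q" "C \<in> Q" "B \<noteq> C" "a < b" "b < c" "c < d"
        "a \<in> B" "c \<in> B" "b \<in> C" "d \<in> C"
      then have "(a, c) \<in> same_block Q" "(b, d) \<in> same_block Q" by (auto simp: same_block_def)
      then have "(a, b) \<in> same_block Q" using noncrossing_relD[OF nc A(4-6)] by blast
      then obtain D where "D \<in> Q" "a \<in> D" "b \<in> D" by (auto simp: same_block_def)
      then show False using uniq A by metis
    qed
  qed
qed

lemma bij_same_block: "bij_betw same_block (noncrossing_partitions k) (nc_rels k)"
proof (rule bij_betw_byWitness[where f' = "\<lambda>r. {1..k} // r"])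
  show "\<forall>Q\<in>noncrossing_partitions k. {1..k} // same_block Q = Q"
    by (simp add: noncrossing_partitions_def quotient_same_block)
  show "\<forall>r\<in>nc_rels k. same_block ({1..k} // r) = r" by (simp add: nc_rels_def same_block_quotient)
  show "same_block ` noncrossing_partitions k \<subseteq> nc_rels k"
    by (auto simp: noncrossing_partitions_def nc_rels_def equiv_same_block noncrossing_iff[symmetric])
  show "(\<lambda>r. {1..k} // r) ` nc_rels k \<subseteq> noncrossing_partitions k"
  proof
    fix Q assume "Q \<in> (\<lambda>r. {1..k} // r) ` nc_rels k"
    then obtain r where r: "equiv {1..k} r" "noncrossing_rel r" "Q = {1..k} // r" by (auto simp: nc_rels_def)
    then have "partition_on {1..k} Q" by (simp add: partition_on_quotient)
    then show "Q \<in> noncrossing_partitions k"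
      using r by (simp add: noncrossing_partitions_def noncrossing_iff same_block_quotient)
  qed
qed

lemma same_block_mono: "refines A P Q \<Longrightarrow> same_block P \<subseteq> same_block Q"
  unfolding refines_def same_block_def by blast

text \<open>Together with \<open>same_block_mono\<close> this identifies refinement with inclusion of relations.\<close>
lemma refines_of_same_block:
  assumes P: "partition_on A P" and Q: "partition_on A Q" and sub: "same_block P \<subseteq> same_block Q"
  shows "refines A P Q"
  unfolding refines_def
proof (intro conjI ballI P Q)
  fix X assume X: "X \<in> P"
  then have "X \<noteq> {}" using partition_onD3[OF P] by blast
  then obtain u where u: "u \<in> X" by blast
  then obtain Y where Y: "Y \<in> Q" "u \<in> Y" using partition_onD1[OF P] partition_onD1[OF Q] X by blast
  have "v \<in> Y" if v: "v \<in> X" for v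
  proof -
    have "(u, v) \<in> same_block Q" using sub X u v by (auto simp: same_block_def)
    then obtain Z where "Z \<in> Q" "u \<in> Z" "v \<in> Z" by (auto simp: same_block_def)
    moreover then have "Z = Y" using Y partition_onD2[OF Q] by (auto simp: disjoint_def)
    ultimately show ?thesis by simp
  qed
  then show "\<exists>Y\<in>Q. X \<subseteq> Y" using Y by blast
qed

lemma join_partition_lattice:
  assumes P: "partition_on A P" and Q: "partition_on A Q"
  shows "P \<squnion>\<^bsub>partition_lattice A\<^esub> Q = A // join_rel (same_block P) (same_block Q)"
proof -
  let ?L = "partition_lattice A" and ?J = "A // join_rel (same_block P) (same_block Q)"
  interpret L: Lattice.lattice ?L by (rule lattice_partition_lattice)
  note p = equiv_same_block[OF P] and q = equiv_same_block[OF Q]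
  have j: "equiv A (join_rel (same_block P) (same_block Q))" by (rule equiv_join_rel[OF p q])
  have J: "partition_on A ?J" by (rule partition_on_quotient[OF j])
  have sb: "same_block ?J = join_rel (same_block P) (same_block Q)" by (rule same_block_quotient[OF j])
  have "least ?L ?J (Upper ?L {P, Q})"
  proof (rule least_UpperI)
    fix u assume "u \<in> {P, Q}"
    then show "u \<sqsubseteq>\<^bsub>?L\<^esub> ?J"
      using refines_of_same_block[OF P J] refines_of_same_block[OF Q J]
        join_rel_upper[of "same_block P" "same_block Q"]
        join_rel_upper[of "same_block Q" "same_block P"] unfolding sb
      by (auto simp: partition_lattice_def join_rel_commute)
  next
    fix y assume "y \<in> Upper ?L {P, Q}"
    then have y: "refines A P y" "refines A Q y" "partition_on A y"
      by (auto simp: Upper_def partition_lattice_def P Q)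
    have "same_block ?J \<subseteq> same_block y"
      unfolding sb
      by (rule join_rel_least[OF equiv_same_block[OF y(3)] same_block_mono[OF y(1)] same_block_mono[OF y(2)]])
    then show "?J \<sqsubseteq>\<^bsub>?L\<^esub> y"
      using refines_of_same_block[OF J y(3)] by (simp add: partition_lattice_def)
  qed (auto simp: partition_lattice_def P Q J)
  moreover have "least ?L (P \<squnion>\<^bsub>?L\<^esub> Q) (Upper ?L {P, Q})"
    unfolding join_def by (rule L.sup_of_two_least) (auto simp: partition_lattice_def P Q)
  ultimately show ?thesis by (metis L.least_unique)
qed

section \<open>Chebyshev polynomials at an indeterminate\<close>

text \<open>The Chebyshev polynomials are monic, so none of them vanishes at an indeterminate.\<close>
lemma coeff_cheb: "coeff (cheb n :: 'a::comm_ring_1 poly) n = 1 \<and> (\<forall>i>n. coeff (cheb n :: 'a poly) i = 0)"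
proof (induction n rule: cheb.induct)
  case (3 n)
  have "coeff (cheb (Suc (Suc n)) :: 'a poly) (Suc i) = coeff (cheb (Suc n)) i - coeff (cheb n) (Suc i)" for i
    by simp
  note rec = this
  show ?case
  proof (intro conjI allI impI)
    show "coeff (cheb (Suc (Suc n)) :: 'a poly) (Suc (Suc n)) = 1" unfolding rec using 3 by simp
    fix i assume i: "Suc (Suc n) < i"
    then obtain l where l: "i = Suc l" "Suc n < l" by (cases i) auto
    then show "coeff (cheb (Suc (Suc n)) :: 'a poly) i = 0" unfolding l(1) rec using 3 by simp
  qed
qed (auto simp: coeff_pCons split: nat.splits)

lemma cheb_sqrt_n: "poly (cheb n) (sqrt_n :: 'a::field poly fract) = to_fract (cheb n :: 'a poly)"
proof (induction n rule: cheb.induct)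
  case (3 n)
  have "poly (cheb (Suc (Suc n))) (sqrt_n :: 'a poly fract) =
      sqrt_n * poly (cheb (Suc n)) sqrt_n - poly (cheb n) sqrt_n"
    by simp
  also have "\<dots> = to_fract ([:0, 1:] * cheb (Suc n) - cheb n)"
    unfolding 3 by (simp only: sqrt_n_def to_fract_mult to_fract_diff)
  finally show ?case by (simp only: cheb.simps)
qed (simp_all add: sqrt_n_def)

lemma cheb_values_sqrt_n: "cheb_values (\<lambda>n. poly (cheb n) (sqrt_n :: 'a::field poly fract)) sqrt_n"
proof
  fix n
  have "(cheb n :: 'a poly) \<noteq> 0" using coeff_cheb[of n, where 'a = 'a] by (metis coeff_0 zero_neq_one)
  then show "poly (cheb n) (sqrt_n :: 'a poly fract) \<noteq> 0" by (simp add: cheb_sqrt_n)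
qed simp_all

context cheb_values
begin

section \<open>The Gram determinant\<close>

lemma det_gram_matrix:
  assumes ps: "distinct ps" "set ps = noncrossing_partitions k"
  shows "det (gram_matrix k ps (x\<^sup>2)) = x powi a_exp k * (\<Prod>r = 1..k. P r powi d_coef k (int r))"
proof -
  define n where "n = length ps"
  define R where "R i = same_block (ps ! i)" for i
  define p where "p i = profile k (R i)" for i
  define b where "b i = int (nblocks k (R i))" for i
  \<comment> \<open>the columns of \<open>M1\<close> and the rows of \<open>M2\<close> belong to the Dyck paths, enumerated as profiles\<close>
  define M1 where "M1 = mat n n (\<lambda>(i, l). x powi b i * (wt k (p l) * amp k (region k (R i)) (p l)))"
  define M2 where "M2 = mat n n (\<lambda>(l, j). x powi (b j - int k) * amp k (region k (R j)) (p l))"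
  define \<mu> where "\<mu> l = (\<Sum>j<2 * k. p l j)" for l
  have psi: "ps ! i \<in> noncrossing_partitions k" if "i < n" for i
    using that ps(2) nth_mem n_def by blast
  have part: "partition_on {1..k} (ps ! i)" if "i < n" for i
    using psi[OF that] by (simp add: noncrossing_partitions_def)
  have bij_ps: "bij_betw (\<lambda>i. ps ! i) {..<n} (noncrossing_partitions k)"
    using bij_betw_nth[OF ps(1), of "{..<n}" "set ps"] ps(2) n_def by simp
  have bij_R: "bij_betw R {..<n} (nc_rels k)"
    using bij_betw_trans[OF bij_ps bij_same_block] by (simp add: R_def[abs_def] o_def)
  have bij_p: "bij_betw p {..<n} (walks (2 * k) 0)"
    using bij_betw_trans[OF bij_R bij_profile] by (simp add: p_def[abs_def] o_def)
  have R: "R i \<in> nc_rels k" if "i < n" for i using bij_R that by (auto simp: bij_betw_def)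
  have pw: "p i \<in> walks (2 * k) 0" if "i < n" for i using bij_p that by (auto simp: bij_betw_def)
  have card: "card (ps ! i) = nblocks k (R i)" if "i < n" for i
    using quotient_same_block[OF part[OF that]] by (simp add: nblocks_def R_def)
  have entry: "(x\<^sup>2) ^ card (ps ! i \<squnion>\<^bsub>partition_lattice {1..k}\<^esub> ps ! j) =
      (\<Sum>l<n. M1 $$ (i, l) * M2 $$ (l, j))" if ij: "i < n" "j < n" for i j
  proof -
    have "(x\<^sup>2) ^ card (ps ! i \<squnion>\<^bsub>partition_lattice {1..k}\<^esub> ps ! j) =
        x ^ (2 * nblocks k (join_rel (R i) (R j)))"
      unfolding join_partition_lattice[OF part[OF ij(1)] part[OF ij(2)]]
      by (simp add: nblocks_def R_def power_mult)
    also have "\<dots> = x powi (b i + (b j - int k) +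
        (2 * int (nblocks k (join_rel (R i) (R j))) - b i - b j + int k))"
      by (simp flip: power_int_of_nat)
    also have "\<dots> = x powi b i * x powi (b j - int k) * loop_form k (R i) (R j)"
      unfolding loop_form_def b_def using x_nz by (simp only: power_int_add simp_thms)
    also have "loop_form k (R i) (R j) =
        (\<Sum>h\<in>walks (2 * k) 0. wt k h * amp k (region k (R i)) h * amp k (region k (R j)) h)"
      unfolding loop_form_eq_path_form[OF R[OF ij(1)] R[OF ij(2)]] path_form_def ..
    also have "\<dots> = (\<Sum>l<n. wt k (p l) * amp k (region k (R i)) (p l) * amp k (region k (R j)) (p l))"
      by (rule sum.reindex_bij_betw[OF bij_p, symmetric])
    finally show ?thesis
      using ij by (simp add: M1_def M2_def sum_distrib_left mult_ac)
  qed
  have G: "gram_matrix k ps (x\<^sup>2) = M1 * M2"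
  proof (rule eq_matI)
    fix i j assume "i < dim_row (M1 * M2)" "j < dim_col (M1 * M2)"
    then have ij: "i < n" "j < n" by (simp_all add: M1_def M2_def)
    then show "gram_matrix k ps (x\<^sup>2) $$ (i, j) = (M1 * M2) $$ (i, j)"
      using entry[OF ij] by (simp add: gram_matrix_def n_def[symmetric] scalar_prod_def M1_def M2_def
          atLeast0LessThan)
  qed (simp_all add: gram_matrix_def n_def M1_def M2_def)
  have less: "\<mu> l < \<mu> i" if il: "i < n" "l < n" "i \<noteq> l" "amp k (region k (R i)) (p l) \<noteq> 0" for i l
  proof -
    have le: "p l j \<le> p i j" for j
      using profile_le_of_amp_nonzero[OF R[OF il(1)] R[OF il(2)]] il(4) by (simp add: p_def)
    have "p l \<noteq> p i" using bij_p il by (auto simp: bij_betw_def inj_on_def)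
    then obtain j where j: "p l j \<noteq> p i j" by blast
    have "p i j = 0 \<and> p l j = 0" if "2 * k \<le> j"
      using pw[OF il(1)] pw[OF il(2)] that by (simp add: walks_def)
    then have "j < 2 * k" using j by (metis not_less)
    then show ?thesis
      unfolding \<mu>_def using le j by (intro sum_strict_mono_ex1) (auto simp: order_less_le)
  qed
  have d1: "det M1 = (\<Prod>i<n. M1 $$ (i, i))"
    by (rule det_triangular_measure[where \<mu> = \<mu>]) (use less in \<open>auto simp: M1_def\<close>)
  have "det M2 = det (transpose_mat M2)" by (rule det_transpose[symmetric, of _ n]) (simp add: M2_def)
  also have "\<dots> = (\<Prod>i<n. transpose_mat M2 $$ (i, i))"
    by (rule det_triangular_measure[where \<mu> = \<mu>]) (use less in \<open>auto simp: M2_def\<close>)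
  also have "\<dots> = (\<Prod>i<n. M2 $$ (i, i))" by (simp add: M2_def)
  finally have d2: "det M2 = (\<Prod>i<n. M2 $$ (i, i))" .
  have "det (gram_matrix k ps (x\<^sup>2)) = det M1 * det M2"
    unfolding G by (rule det_mult[of _ n]) (simp_all add: M1_def M2_def)
  also have "\<dots> = (\<Prod>i<n. x powi (2 * b i - int k) * (wt k (p i) * (amp k (region k (R i)) (p i))\<^sup>2))"
    unfolding d1 d2 prod.distrib[symmetric]
  proof (rule prod.cong[OF refl])
    fix i assume "i \<in> {..<n}"
    moreover have "x powi (2 * b i - int k) = x powi b i * x powi (b i - int k)"
      using x_nz power_int_add[of x "b i" "b i - int k"] by simp
    ultimately show "M1 $$ (i, i) * M2 $$ (i, i) =
        x powi (2 * b i - int k) * (wt k (p i) * (amp k (region k (R i)) (p i))\<^sup>2)"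
      by (simp add: M1_def M2_def power2_eq_square mult_ac)
  qed
  also have "\<dots> = x powi (\<Sum>i<n. 2 * b i - int k) *
      (\<Prod>i<n. wt k (p i) * (amp k (region k (R i)) (p i))\<^sup>2)"
    by (simp add: prod.distrib power_int_sum[OF x_nz])
  also have "(\<Sum>i<n. 2 * b i - int k) = a_exp k"
    unfolding a_exp_def sum.reindex_bij_betw[OF bij_ps, symmetric]
    using card by (intro sum.cong) (auto simp: b_def)
  also have "(\<Prod>i<n. wt k (p i) * (amp k (region k (R i)) (p i))\<^sup>2) =
      (\<Prod>i<n. \<Prod>j<2 * k. if p i (Suc j) = Suc (p i j) then P (p i (Suc j)) else inverse (P (p i (Suc j))))"
  proof (rule prod.cong[OF refl])
    fix i assume "i \<in> {..<n}"
    then show "wt k (p i) * (amp k (region k (R i)) (p i))\<^sup>2 =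
        (\<Prod>j<2 * k. if p i (Suc j) = Suc (p i j) then P (p i (Suc j)) else inverse (P (p i (Suc j))))"
      unfolding p_def by (intro norm_profile R) simp
  qed
  also have "\<dots> = (\<Prod>h\<in>walks (2 * k) 0. \<Prod>j<2 * k. if h (Suc j) = Suc (h j) then P (h (Suc j))
      else inverse (P (h (Suc j))))"
    by (rule prod.reindex_bij_betw[OF bij_p])
  finally show ?thesis unfolding prod_walks_steps .
qed

end

theorem theorem5p3:
  fixes k :: nat and ps :: "nat set set list"
  assumes "distinct ps" and "set ps = noncrossing_partitions k"
  shows "det (gram_matrix k ps ((sqrt_n :: 'a::field_char_0 poly fract)\<^sup>2)) =
    sqrt_n powi a_exp k * (\<Prod>r = 1..k. poly (cheb r) sqrt_n powi d_coef k (int r))"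
  by (rule cheb_values.det_gram_matrix[OF cheb_values_sqrt_n assms])

end
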